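(* Let $M_1,M_2$ be two non-negative TR functions on $\mathbb{R}^n$ such that $\dim(\mathrm{Newt}(M_1)+\mathrm{Newt}(M_2))=n$ (Minkowski sum). Then there are only finitely many $2$-cycles $[F]$ in $\mathbb{R}^n$ which are strongly regular over $M_1,M_2$, i.e. which satisfy $M_1\cdot M_2\cdot[F]=1$, $M_1\cdot M_1\cdot[F]\le1$ and $M_2\cdot M_2\cdot[F]\le1$.
   Context: A $k$-dimensional tropical fan $F$ in $\mathbb{R}^n$ is a finite pure $k$-dimensional fan of strongly convex rational polyhedral cones, with a positive integer weight $\omega_F(\sigma)$ for each $\sigma\in F^{(k)}$ ($F^{(i)}$ = set of $i$-dimensional cones), satisfying the balancing condition: for every $\tau\in F^{(k-1)}$, $\sum_{\sigma>\tau}\omega_F(\sigma)v_{\sigma/\tau}\in\langle\tau\rangle$, where $\langle\cdot\rangle$ is linear span and $v_{\sigma/\tau}\in\mathbb{Z}^n$ represents the primitive generator of $(\mathbb{Z}^n\cap\langle\sigma\rangle)/(\mathbb{Z}^n\cap\langle\tau\rangle)$ pointing towards $\sigma$. A refinement of $F$ is a tropical fan with the same support whose cones are contained in cones of $F$, with induced weights. Two tropical fans are equivalent if they have a common refinement; an (affine tropical) $k$-cycle $[F]$ is an equivalence class. Cones of weight $0$ are discarded; the zero cycle is allowed. A tropical regular (TR) function on $\mathbb{R}^n$ is $T=\max(l_1,\dots,l_m)$ with $l_i\in(\mathbb{Z}^n)^\vee$; it is called non-negative if it is of the form $\max(0,l_1,\dots,l_m)$. Its Newton polytope $\mathrm{Newt}(T)$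 is the convex hull of the linear forms in the maximum. The product $T\cdot[F]$ with a $k$-cycle is the $(k-1)$-cycle obtained by choosing a representative $F$ such that $T$ is linear on each cone, and giving $\tau\in F^{(k-1)}$ the weight $\sum_{\sigma>\tau}\omega_F(\sigma)T_\sigma(v_{\sigma/\tau})-T_\tau\big(\sum_{\sigma>\tau}\omega_F(\sigma)v_{\sigma/\tau}\big)$, where $T_\sigma,T_\tau$ are the linear extensions of $T|_\sigma,T|_\tau$ to $\langle\sigma\rangle,\langle\tau\rangle$; this is independent of all choices. A $0$-cycle is identified with the weight of the origin, and products are iterated: $T_1\cdot T_2\cdot[F]=T_1\cdot(T_2\cdot[F])$. *)

theory Defs
  imports "HOL-Analysis.Analysis"
begin

section \<open>Rational fans\<close>

definition int_points :: "(real ^ 'n) set" where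
  "int_points = {x. \<forall>i. x $ i \<in> \<int>}"

definition rational_cone :: "(real ^ 'n) set \<Rightarrow> bool" where
  "rational_cone \<sigma> \<longleftrightarrow> (\<exists>V. finite V \<and> V \<subseteq> int_points \<and> \<sigma> = convex_cone hull V)"

definition strongly_convex :: "(real ^ 'n) set \<Rightarrow> bool" where
  "strongly_convex \<sigma> \<longleftrightarrow> (\<forall>x. x \<in> \<sigma> \<and> - x \<in> \<sigma> \<longrightarrow> x = 0)"

text \<open>The library relation \<open>face_of\<close> also admits the empty set as a face, which is not a cone
  and is therefore excluded. A fan may be empty: this is how the zero cycle is represented.\<close>

definition rational_fan :: "(real ^ 'n) set set \<Rightarrow> bool" where
  "rational_fan F \<longleftrightarrow>
     finite F \<and>
     (\<forall>\<sigma>\<in>F. rational_cone \<sigma> \<and> strongly_convex \<sigma>) \<and>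
     (\<forall>\<sigma>\<in>F. \<forall>\<tau>. \<tau> face_of \<sigma> \<and> \<tau> \<noteq> {} \<longrightarrow> \<tau> \<in> F) \<and>
     (\<forall>\<sigma>\<in>F. \<forall>\<tau>\<in>F. \<sigma> \<inter> \<tau> face_of \<sigma> \<and> \<sigma> \<inter> \<tau> face_of \<tau>)"

text \<open>\<open>dim\<close> is the dimension of the linear span, which is the dimension of a cone.\<close>

definition pure_dim :: "nat \<Rightarrow> (real ^ 'n) set set \<Rightarrow> bool" where
  "pure_dim k F \<longleftrightarrow> (\<forall>\<tau>\<in>F. \<exists>\<sigma>\<in>F. \<tau> \<subseteq> \<sigma> \<and> dim \<sigma> = k)"

definition facet_cofaces :: "(real ^ 'n) set set \<Rightarrow> (real ^ 'n) set \<Rightarrow> (real ^ 'n) set set" where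
  "facet_cofaces F \<tau> = {\<sigma>\<in>F. \<tau> face_of \<sigma> \<and> dim \<sigma> = Suc (dim \<tau>)}"

text \<open>\<open>v\<close> represents the primitive generator of
  \<open>(\<int>\<^sup>n \<inter> span \<sigma>) / (\<int>\<^sup>n \<inter> span \<tau>)\<close> which points towards \<open>\<sigma>\<close>, i.e. lies in the image of
  \<open>\<sigma>\<close> modulo \<open>span \<tau>\<close>.\<close>

definition is_primitive_normal ::
    "(real ^ 'n) set \<Rightarrow> (real ^ 'n) set \<Rightarrow> real ^ 'n \<Rightarrow> bool" where
  "is_primitive_normal \<sigma> \<tau> v \<longleftrightarrow>
     v \<in> int_points \<inter> span \<sigma> \<and>
     (\<forall>w \<in> int_points \<inter> span \<sigma>. \<exists>m::int. w - of_int m *\<^sub>R v \<in> span \<tau>) \<and>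
     (\<exists>s\<in>\<sigma>. \<exists>t\<in>span \<tau>. v = s + t)"

definition primitive_normal ::
    "(real ^ 'n) set \<Rightarrow> (real ^ 'n) set \<Rightarrow> real ^ 'n" where
  "primitive_normal \<sigma> \<tau> = (SOME v. is_primitive_normal \<sigma> \<tau> v)"


section \<open>Tropical fans and cycles\<close>

text \<open>Weights are integers, stored as reals. Only the cones of top dimension carry a weight;
  the weight function is normalised to vanish on all other arguments.\<close>

type_synonym 'n weighted_fan = "(real ^ 'n) set set \<times> ((real ^ 'n) set \<Rightarrow> real)"

definition weighted_normal_sum :: "'n::finite weighted_fan \<Rightarrow> (real ^ 'n) set \<Rightarrow> real ^ 'n" where
  "weighted_normal_sum W \<tau> =
     (\<Sum>\<sigma>\<in>facet_cofaces (fst W) \<tau>. snd W \<sigma> *\<^sub>R primitive_normal \<sigma> \<tau>)"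

definition tropical_fan :: "nat \<Rightarrow> 'n::finite weighted_fan \<Rightarrow> bool" where
  "tropical_fan k W \<longleftrightarrow>
     rational_fan (fst W) \<and> pure_dim k (fst W) \<and>
     (\<forall>\<sigma>\<in>fst W. dim \<sigma> = k \<longrightarrow> snd W \<sigma> \<in> \<int> \<and> 0 < snd W \<sigma>) \<and>
     (\<forall>\<sigma>. \<not> (\<sigma> \<in> fst W \<and> dim \<sigma> = k) \<longrightarrow> snd W \<sigma> = 0) \<and>
     (\<forall>\<tau>\<in>fst W. Suc (dim \<tau>) = k \<longrightarrow> weighted_normal_sum W \<tau> \<in> span \<tau>)"

definition refines :: "nat \<Rightarrow> 'n::finite weighted_fan \<Rightarrow> 'n weighted_fan \<Rightarrow> bool" where
  "refines k R W \<longleftrightarrow>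
     tropical_fan k R \<and> \<Union> (fst R) = \<Union> (fst W) \<and>
     (\<forall>\<rho>\<in>fst R. \<exists>\<sigma>\<in>fst W. \<rho> \<subseteq> \<sigma>) \<and>
     (\<forall>\<rho>\<in>fst R. \<forall>\<sigma>\<in>fst W. dim \<rho> = k \<and> dim \<sigma> = k \<and> \<rho> \<subseteq> \<sigma> \<longrightarrow> snd R \<rho> = snd W \<sigma>)"

definition fan_equiv :: "nat \<Rightarrow> ('n::finite weighted_fan \<times> 'n weighted_fan) set" where
  "fan_equiv k =
     {(A, B). tropical_fan k A \<and> tropical_fan k B \<and> (\<exists>R. refines k R A \<and> refines k R B)}"

type_synonym 'n cycle = "'n weighted_fan set"

definition cycles :: "nat \<Rightarrow> 'n::finite cycle set" where
  "cycles k = {W. tropical_fan k W} // fan_equiv k"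


section \<open>Tropical regular functions\<close>

text \<open>A linear form in \<open>(\<int>\<^sup>n)\<^sup>\<or>\<close> is identified with the integral vector \<open>l\<close> that represents it
  as \<open>x \<mapsto> l \<bullet> x\<close>.\<close>

definition max_of_forms :: "(real ^ 'n) set \<Rightarrow> real ^ 'n \<Rightarrow> real" where
  "max_of_forms L x = Max ((\<lambda>l. l \<bullet> x) ` L)"

definition TR_presentation :: "(real ^ 'n) set \<Rightarrow> (real ^ 'n \<Rightarrow> real) \<Rightarrow> bool" where
  "TR_presentation L T \<longleftrightarrow> finite L \<and> L \<noteq> {} \<and> L \<subseteq> int_points \<and> T = max_of_forms L"

definition nonneg_TR_function :: "(real ^ 'n \<Rightarrow> real) \<Rightarrow> bool" where
  "nonneg_TR_function T \<longleftrightarrow> (\<exists>L. TR_presentation L T \<and> 0 \<in> L)"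

text \<open>The convex hull does not depend on the presentation chosen: \<open>T\<close> is its support function.\<close>

definition Newt :: "(real ^ 'n \<Rightarrow> real) \<Rightarrow> (real ^ 'n) set" where
  "Newt T = convex hull (SOME L. TR_presentation L T)"


section \<open>Products\<close>

definition linear_on_cone :: "(real ^ 'n \<Rightarrow> real) \<Rightarrow> (real ^ 'n) set \<Rightarrow> bool" where
  "linear_on_cone T \<sigma> \<longleftrightarrow> (\<exists>f. linear f \<and> (\<forall>x\<in>\<sigma>. f x = T x))"

text \<open>The extension is only determined on \<open>span \<sigma>\<close>, and it is only evaluated there.\<close>

definition linear_ext :: "(real ^ 'n \<Rightarrow> real) \<Rightarrow> (real ^ 'n) set \<Rightarrow> real ^ 'n \<Rightarrow> real" where
  "linear_ext T \<sigma> = (SOME f. linear f \<and> (\<forall>x\<in>\<sigma>. f x = T x))"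

definition product_weight ::
    "(real ^ 'n \<Rightarrow> real) \<Rightarrow> 'n::finite weighted_fan \<Rightarrow> (real ^ 'n) set \<Rightarrow> real" where
  "product_weight T W \<tau> =
     (\<Sum>\<sigma>\<in>facet_cofaces (fst W) \<tau>. snd W \<sigma> * linear_ext T \<sigma> (primitive_normal \<sigma> \<tau>))
       - linear_ext T \<tau> (weighted_normal_sum W \<tau>)"

text \<open>The product of \<open>T\<close> with a \<open>k\<close>-dimensional tropical fan on whose cones \<open>T\<close> is linear. Cones of
  dimension \<open>k - 1\<close> and weight \<open>0\<close> are discarded, and so are the cones contained in no
  remaining one.\<close>

definition fan_product ::
    "nat \<Rightarrow> (real ^ 'n \<Rightarrow> real) \<Rightarrow> 'n::finite weighted_fan \<Rightarrow> 'n weighted_fan" where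
  "fan_product k T W =
     (let S = {\<tau>\<in>fst W. Suc (dim \<tau>) = k \<and> product_weight T W \<tau> \<noteq> 0}
      in ({\<rho>\<in>fst W. \<exists>\<tau>\<in>S. \<rho> \<subseteq> \<tau>}, \<lambda>\<tau>. if \<tau> \<in> S then product_weight T W \<tau> else 0))"

text \<open>The product of \<open>T\<close> with a \<open>k\<close>-cycle, for \<open>k \<ge> 1\<close>; it is a \<open>(k - 1)\<close>-cycle. The zero cycles of
  different dimensions coincide as sets of weighted fans, so \<open>k\<close> is an explicit argument.\<close>

definition cycle_product ::
    "nat \<Rightarrow> (real ^ 'n \<Rightarrow> real) \<Rightarrow> 'n::finite cycle \<Rightarrow> 'n cycle" where
  "cycle_product k T C =
     fan_equiv (k - 1) `` {fan_product k T (SOME W. W \<in> C \<and> (\<forall>\<sigma>\<in>fst W. linear_on_cone T \<sigma>))}"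

text \<open>The number with which a \<open>0\<close>-cycle is identified. For the zero cycle it is \<open>0\<close>, because weight
  functions vanish outside the fan.\<close>

definition origin_weight :: "'n::finite cycle \<Rightarrow> real" where
  "origin_weight C = snd (SOME W. W \<in> C) {0}"

text \<open>The number \<open>S \<cdot> T \<cdot> C = S \<cdot> (T \<cdot> C)\<close> for a \<open>2\<close>-cycle \<open>C\<close>.\<close>

definition intersection_number ::
    "(real ^ 'n \<Rightarrow> real) \<Rightarrow> (real ^ 'n \<Rightarrow> real) \<Rightarrow> 'n::finite cycle \<Rightarrow> real" where
  "intersection_number S T C = origin_weight (cycle_product 1 S (cycle_product 2 T C))"

definition strongly_regular ::
    "(real ^ 'n \<Rightarrow> real) \<Rightarrow> (real ^ 'n \<Rightarrow> real) \<Rightarrow> 'n::finite cycle \<Rightarrow> bool" where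
  "strongly_regular M\<^sub>1 M\<^sub>2 C \<longleftrightarrow>
     intersection_number M\<^sub>1 M\<^sub>2 C = 1 \<and>
     intersection_number M\<^sub>1 M\<^sub>1 C \<le> 1 \<and>
     intersection_number M\<^sub>2 M\<^sub>2 C \<le> 1"

end

theory Submission
  imports Defs
begin

text \<open>
  Let \<open>M = M\<^sub>1 + M\<^sub>2 - m\<close> with a linear form \<open>m\<close> in the interior of \<open>Newt M\<^sub>1 + Newt M\<^sub>2\<close>; then
  \<open>M x \<ge> c \<bar>x\<bar>\<close> for some \<open>c > 0\<close>. For a fixed cycle \<open>F\<close> the number \<open>S \<cdot> T \<cdot> F\<close> is bilinear and symmetric
  in \<open>S, T\<close>, vanishes if one of them is linear, and is monotone in \<open>S\<close> if \<open>T\<close> is convex. Hence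
  \<open>M \<cdot> M \<cdot> F \<le> 4\<close> for a strongly regular \<open>F\<close>. Let \<open>u\<close> be a primitive vector inside a two-dimensional cone \<open>\<sigma>\<close> of
  \<open>F\<close>, let \<open>l\<close> be a form in the plane of \<open>\<sigma>\<close> orthogonal to \<open>u\<close>, and let \<open>T = max 0 l\<close>. The curve \<open>T \<cdot> F\<close> contains the
  ray \<open>u\<close> with multiplicity \<open>\<omega>(\<sigma>) l(v)\<close>, where \<open>u, v\<close> is a lattice basis of the plane, and \<open>T \<le> \<bar>l\<bar> M / c\<close>. So
  \<open>c \<bar>u\<bar> \<omega>(\<sigma>) l(v) \<le> M \<cdot> T \<cdot> F = T \<cdot> M \<cdot> F \<le> 4 \<bar>l\<bar> / c\<close>, which bounds \<open>\<omega>(\<sigma>)\<close> times the covolume of the lattice of the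
  plane of \<open>\<sigma>\<close>. Therefore only finitely many planes and weights occur. Finally, by balancing the weight of \<open>F\<close>
  on such a plane is constant away from the other planes, so that finitely many cycles remain.
\<close>

section \<open>Planar cones\<close>

text \<open>Symmetry and positivity of the pairing come from one matrix. On a fan with
  \<open>T\<close> linear on each cone, the multiplicity of \<open>T \<cdot> F\<close> at a ray
  \<open>u\<close> is a combination of the values of \<open>T\<close> at the primitive ray
  generators, like a graph Laplacian. The matrix is symmetric because the index of the lattice
  spanned by \<open>u, u'\<close> does not depend on their order, non-negative off the diagonal
  because weights are positive, and by balancing it kills linear functions. The constant 4 is
  \<open>1 + 2 * 1 + 1\<close>. The obstacle is that a cycle is a class of fans and each product
  picks some fan on which its factor is linear, whereas the estimate compares several products. Fans
  are therefore compared through the weights seen by germs, that is, points with a direction, and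
  hyperplane cuts supply common refinements. Points and directions are arbitrary real vectors, while
  balancing concerns rational rays only; hence the finiteness argument moves along segments and
  records the signs of finitely many forms. Since cones have dimension at most two, polyhedral
  geometry reduces to rays and cones with two generators.\<close>

definition indep2 :: "'a::real_vector \<Rightarrow> 'a \<Rightarrow> bool" where
  "indep2 a b \<longleftrightarrow> (\<forall>s t. s *\<^sub>R a + t *\<^sub>R b = 0 \<longrightarrow> s = 0 \<and> t = 0)"

definition ray :: "'a::real_vector \<Rightarrow> 'a set" where
  "ray a = {t *\<^sub>R a | t. 0 \<le> t}"

definition cone2 :: "'a::real_vector \<Rightarrow> 'a \<Rightarrow> 'a set" where
  "cone2 a b = {s *\<^sub>R a + t *\<^sub>R b | s t. 0 \<le> s \<and> 0 \<le> t}"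

lemma indep2D: "indep2 a b \<Longrightarrow> s *\<^sub>R a + t *\<^sub>R b = 0 \<Longrightarrow> s = 0 \<and> t = 0"
  unfolding indep2_def by blast

lemma indep2_unique:
  assumes "indep2 a b"
  shows "s *\<^sub>R a + t *\<^sub>R b = s' *\<^sub>R a + t' *\<^sub>R b \<longleftrightarrow> s = s' \<and> t = t'"
proof
  assume "s *\<^sub>R a + t *\<^sub>R b = s' *\<^sub>R a + t' *\<^sub>R b"
  then have "(s - s') *\<^sub>R a + (t - t') *\<^sub>R b = 0" by (simp add: algebra_simps)
  from indep2D [OF assms this] show "s = s' \<and> t = t'" by simp
qed auto

lemma indep2_unique':
  assumes "indep2 a b" shows "s *\<^sub>R a = s' *\<^sub>R a + t' *\<^sub>R b \<longleftrightarrow> s = s' \<and> t' = 0"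
  using indep2_unique [OF assms, of s 0 s' t'] by auto

lemma indep2_commute: "indep2 a b \<longleftrightarrow> indep2 b a"
  unfolding indep2_def by (metis add.commute)

lemma indep2_nonzero: assumes "indep2 a b" shows "a \<noteq> 0" "b \<noteq> 0"
  using assms [unfolded indep2_def, rule_format, of 1 0] assms [unfolded indep2_def, rule_format, of 0 1]
  by auto

lemma not_indep2: "\<not> indep2 a b \<longleftrightarrow> a = 0 \<or> (\<exists>c. b = c *\<^sub>R a)"
proof
  assume "\<not> indep2 a b"
  then obtain s t where st: "s *\<^sub>R a + t *\<^sub>R b = 0" "s \<noteq> 0 \<or> t \<noteq> 0" unfolding indep2_def by blast
  show "a = 0 \<or> (\<exists>c. b = c *\<^sub>R a)"
  proof (cases "t = 0")
    case True with st show ?thesis by auto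
  next
    case False
    have "t *\<^sub>R b = (- s) *\<^sub>R a" using st(1) by (simp add: eq_neg_iff_add_eq_0 add.commute)
    then have "(1/t) *\<^sub>R (t *\<^sub>R b) = (1/t) *\<^sub>R (- s) *\<^sub>R a" by simp
    then have "b = (- s / t) *\<^sub>R a" using False by simp
    then show ?thesis by blast
  qed
next
  assume "a = 0 \<or> (\<exists>c. b = c *\<^sub>R a)"
  then show "\<not> indep2 a b"
  proof
    assume "a = 0" then show ?thesis using indep2_nonzero by blast
  next
    assume "\<exists>c. b = c *\<^sub>R a"
    then obtain c where "b = c *\<^sub>R a" by blast
    then have "c *\<^sub>R a + (-1) *\<^sub>R b = 0" by simp
    from indep2D [OF _ this] show ?thesis by auto
  qed
qed

lemma indep2_combine:
  assumes "indep2 a b" "t \<noteq> 0" shows "indep2 a (s *\<^sub>R a + t *\<^sub>R b)"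
proof (rule ccontr)
  assume "\<not> ?thesis"
  then obtain c where "s *\<^sub>R a + t *\<^sub>R b = c *\<^sub>R a"
    using not_indep2 [of a "s *\<^sub>R a + t *\<^sub>R b"] indep2_nonzero [OF assms(1)] by auto
  then have "c *\<^sub>R a = s *\<^sub>R a + t *\<^sub>R b" by simp
  then show False using indep2_unique' [OF assms(1)] assms(2) by simp
qed

lemma in_span2: "x \<in> span {a, b} \<longleftrightarrow> (\<exists>s t. x = s *\<^sub>R a + t *\<^sub>R b)"
proof
  assume "x \<in> span {a, b}"
  then obtain s where "x - s *\<^sub>R a \<in> span {b}" unfolding span_breakdown_eq by blast
  then obtain t where "x - s *\<^sub>R a = t *\<^sub>R b" unfolding span_singleton by auto
  then have "x = s *\<^sub>R a + t *\<^sub>R b" by (simp add: algebra_simps)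
  then show "\<exists>s t. x = s *\<^sub>R a + t *\<^sub>R b" by blast
next
  assume "\<exists>s t. x = s *\<^sub>R a + t *\<^sub>R b"
  then show "x \<in> span {a, b}" by (auto intro!: span_add span_scale intro: span_base)
qed

lemma in_span1: "x \<in> span {a} \<longleftrightarrow> (\<exists>t. x = t *\<^sub>R a)"
  unfolding span_singleton by auto

text \<open>The clause \<open>a \<noteq> b\<close> is recorded because \<open>{a, a}\<close>
  collapses to a singleton, which may be independent although \<open>indep2 a a\<close>
  fails.\<close>

lemma indep2_independent: "indep2 a b \<Longrightarrow> independent {a, b} \<and> a \<noteq> b"
proof -
  assume ab: "indep2 a b"
  then have b: "b \<notin> span {a}" using not_indep2 [of a b] by (auto simp: in_span1)
  moreover have "independent {a}" using indep2_nonzero(1) [OF ab] by simp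
  ultimately have "independent {b, a}" using independent_insertI by blast
  moreover have "a \<noteq> b" using b span_base [of a "{a}"] by auto
  ultimately show ?thesis by (simp add: insert_commute)
qed

lemma dim_ge_2:
  fixes x :: "'a::euclidean_space"
  assumes "indep2 x y" "x \<in> S" "y \<in> S" shows "2 \<le> dim S"
proof -
  have "card {x,y} \<le> dim S"
    using indep2_independent [OF assms(1)] assms(2,3)
    by (meson empty_subsetI independent_card_le_dim insert_subset)
  then show ?thesis using indep2_independent [OF assms(1)] by simp
qed

lemma span_indep2_eq:
  fixes x :: "'a::euclidean_space"
  assumes "indep2 x y" "x \<in> span {a, b}" "y \<in> span {a, b}" shows "span {x, y} = span {a, b}"
proof -
  have "dim {a,b} \<le> card {a,b}" by (rule dim_le_card') simp
  moreover have "card {a,b} \<le> 2" by (cases "a = b") auto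
  moreover have "2 \<le> dim {x, y}" by (rule dim_ge_2 [OF assms(1)]) auto
  ultimately have d: "dim {a, b} \<le> dim {x, y}" by linarith
  have "span {x, y} \<subseteq> span {a, b}" using assms(2,3) by (simp add: span_minimal)
  moreover have "dim (span {a, b}) \<le> dim (span {x, y})" using d by simp
  ultimately show ?thesis
    by (intro subspace_dim_equal) auto
qed


section \<open>Rays and planar cones as finitely generated convex cones\<close>

lemma mem_ray: "x \<in> ray a \<longleftrightarrow> (\<exists>t\<ge>0. x = t *\<^sub>R a)"
  unfolding ray_def by auto

lemma mem_cone2: "x \<in> cone2 a b \<longleftrightarrow> (\<exists>s\<ge>0. \<exists>t\<ge>0. x = s *\<^sub>R a + t *\<^sub>R b)"
  unfolding cone2_def by auto

lemma ray_self [simp]: "a \<in> ray a"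
  unfolding mem_ray by (rule exI [of _ 1]) simp

lemma cone2_self [simp]: "a \<in> cone2 a b" "b \<in> cone2 a b"
  unfolding mem_cone2 by (rule exI [of _ 1], simp, rule exI [of _ 0], simp,
    rule exI [of _ 0], simp, rule exI [of _ 1], simp)

lemma cone2_commute: "cone2 a b = cone2 b a"
  unfolding cone2_def by (auto; metis add.commute)

lemma ray_subset_cone2: "ray a \<subseteq> cone2 a b" "ray b \<subseteq> cone2 a b"
proof -
  have *: "ray a \<subseteq> cone2 a b" for a b :: 'a
  proof
    fix x assume "x \<in> ray a"
    then obtain t where "0 \<le> t" "x = t *\<^sub>R a + 0 *\<^sub>R b" unfolding mem_ray by auto
    then show "x \<in> cone2 a b" unfolding mem_cone2 by blast
  qed
  show "ray a \<subseteq> cone2 a b" "ray b \<subseteq> cone2 a b" using * [of a b] * [of b a] cone2_commute [of a b] by auto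
qed

lemma convex_cone_imp_convex: "convex_cone C \<Longrightarrow> convex C"
  by (simp add: convex_cone_def)

lemma convex_cone_ray: "convex_cone (ray a)"
proof -
  have "x + y \<in> ray a" if xy: "x \<in> ray a" "y \<in> ray a" for x y
  proof -
    obtain s t where "0 \<le> s" "0 \<le> t" "x = s *\<^sub>R a" "y = t *\<^sub>R a" using xy unfolding mem_ray by blast
    then have "x + y = (s + t) *\<^sub>R a" "0 \<le> s + t" by (auto simp: scaleR_left_distrib)
    then show ?thesis unfolding mem_ray by blast
  qed
  moreover have "c *\<^sub>R x \<in> ray a" if x: "x \<in> ray a" and c: "0 \<le> c" for x c
  proof -
    obtain t where "0 \<le> t" "x = t *\<^sub>R a" using x unfolding mem_ray by blast
    then have "c *\<^sub>R x = (c * t) *\<^sub>R a" "0 \<le> c * t" using c by auto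
    then show ?thesis unfolding mem_ray by blast
  qed
  moreover have "0 \<in> ray a" unfolding mem_ray by (rule exI [of _ 0]) simp
  ultimately show ?thesis unfolding convex_cone_iff by blast
qed

lemma convex_cone_cone2: "convex_cone (cone2 a b)"
proof -
  have eq: "cone2 a b = (\<Union>x\<in>ray a. \<Union>y\<in>ray b. {x + y})"
    unfolding cone2_def ray_def by blast
  show ?thesis unfolding eq by (intro convex_cone_sums convex_cone_ray)
qed

lemma ray_hull: "convex_cone hull {a} = ray a"
proof (rule hull_unique)
  show "{a} \<subseteq> ray a" by simp
  show "ray a \<subseteq> t'" if "{a} \<subseteq> t'" "convex_cone t'" for t'
    using that convex_cone_scaleR [OF that(2)] unfolding ray_def by auto
qed (rule convex_cone_ray)

lemma cone_hull_insert:
  "convex_cone hull (insert x V) = {y + t *\<^sub>R x | y t. y \<in> convex_cone hull V \<and> 0 \<le> t}"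
proof -
  have "convex_cone hull (V \<union> {x}) = {y + t *\<^sub>R x | y t. y \<in> convex_cone hull V \<and> 0 \<le> t}"
    unfolding convex_cone_hull_Un ray_hull ray_def by blast
  then show ?thesis by simp
qed

lemma cone2_hull: "convex_cone hull {a, b} = cone2 a b"
  unfolding cone_hull_insert ray_hull cone2_def mem_ray by (auto; metis add.commute)

lemma closed_ray: fixes a :: "'a::euclidean_space" shows "closed (ray a)"
  unfolding ray_hull [symmetric] by (rule closed_convex_cone_hull) simp

lemma closed_cone2: fixes a :: "'a::euclidean_space" shows "closed (cone2 a b)"
  unfolding cone2_hull [symmetric] by (rule closed_convex_cone_hull) simp

lemma span_ray: "span (ray a) = span {a}"
proof (rule subset_antisym; rule span_minimal)
  show "ray a \<subseteq> span {a}" unfolding ray_def by (auto intro: span_scale span_base)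
  show "{a} \<subseteq> span (ray a)" by (auto intro: span_base)
qed auto

lemma span_cone2: "span (cone2 a b) = span {a, b}"
proof (rule subset_antisym; rule span_minimal)
  show "cone2 a b \<subseteq> span {a, b}" unfolding cone2_def using in_span2 by blast
  show "{a, b} \<subseteq> span (cone2 a b)" by (auto intro: span_base)
qed auto

lemma dim_ray:
  fixes a :: "'a::euclidean_space"
  assumes "a \<noteq> 0" shows "dim (ray a) = 1"
proof -
  have "dim (ray a) = dim {a}" by (metis dim_span span_ray)
  also have "\<dots> = 1" using dim_eq_card_independent [of "{a}"] assms by simp
  finally show ?thesis .
qed

lemma dim_cone2:
  fixes a :: "'a::euclidean_space"
  assumes "indep2 a b" shows "dim (cone2 a b) = 2"
proof -
  have "dim (cone2 a b) = dim {a, b}" by (metis dim_span span_cone2)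
  also have "\<dots> = 2" using dim_eq_card_independent [of "{a,b}"] indep2_independent [OF assms] by simp
  finally show ?thesis .
qed

text \<open>Gram-Schmidt without the division: \<open>a \<bullet> a\<close> times the component of
  \<open>b\<close> orthogonal to \<open>a\<close>. In this scaling the form is integral for integral
  \<open>a\<close>, \<open>b\<close>. For independent vectors it cuts out the line of
  \<open>a\<close> in their plane and is positive on the side of \<open>b\<close>.\<close>

definition perp :: "'a::real_inner \<Rightarrow> 'a \<Rightarrow> 'a" where
  "perp a b = (a \<bullet> a) *\<^sub>R b - (a \<bullet> b) *\<^sub>R a"

lemma perp_orth: "perp a b \<bullet> a = 0"
  unfolding perp_def by (simp add: inner_diff_left inner_commute [of b a])

lemma perp_norm: "perp a b \<bullet> perp a b = (a \<bullet> a) * (perp a b \<bullet> b)"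
proof -
  have "perp a b \<bullet> perp a b = perp a b \<bullet> ((a \<bullet> a) *\<^sub>R b - (a \<bullet> b) *\<^sub>R a)"
    by (simp only: perp_def [of a b])
  then show ?thesis
    by (simp only: inner_diff_right inner_scaleR_right perp_orth mult_zero_right diff_0_right)
qed

lemma perp_pos: assumes "indep2 a b" shows "0 < perp a b \<bullet> b"
proof -
  have ne: "perp a b \<noteq> 0"
  proof
    assume "perp a b = 0"
    then have "(- (a \<bullet> b)) *\<^sub>R a + (a \<bullet> a) *\<^sub>R b = 0" unfolding perp_def by simp
    then have "a \<bullet> a = 0" using indep2D [OF assms] by blast
    then show False using indep2_nonzero [OF assms] by simp
  qed
  have "0 < perp a b \<bullet> perp a b" using ne by simp
  also have "\<dots> = (a \<bullet> a) * (perp a b \<bullet> b)" by (rule perp_norm)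
  finally show ?thesis using inner_ge_zero [of a] zero_less_mult_iff by (metis linorder_not_less)
qed

section \<open>Faces of rays and planar cones\<close>

lemma face_of_cone_zero:
  fixes C :: "'a::euclidean_space set"
  assumes "convex_cone C" "\<tau> face_of C" "x \<in> \<tau>" shows "0 \<in> \<tau>"
proof (cases "x = 0")
  case False
  have "x \<in> open_segment 0 (2 *\<^sub>R x)"
    unfolding in_segment using False by (auto intro!: exI [of _ "1/2"])
  moreover have "x \<in> C" using assms(2,3) face_of_imp_subset by blast
  then have "0 \<in> C" "2 *\<^sub>R x \<in> C"
    using convex_cone_contains_0 [OF assms(1)] convex_cone_scaleR [OF assms(1), of 2 x] by auto
  ultimately show ?thesis using assms(2,3) face_ofD by blast
qed (use assms in auto)

lemma face_of_cone_scale: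
  fixes C :: "'a::euclidean_space set"
  assumes C: "convex_cone C" "\<tau> face_of C" "x \<in> \<tau>" and "0 \<le> c" shows "c *\<^sub>R x \<in> \<tau>"
proof (cases "c \<le> 1 \<or> x = 0")
  case True
  have "convex \<tau>" using C(2) face_of_imp_convex by blast
  then have "(1 - c) *\<^sub>R 0 + c *\<^sub>R x \<in> \<tau>" if "c \<le> 1"
    using face_of_cone_zero [OF C] C(3) that \<open>0 \<le> c\<close> by (intro convexD) auto
  then show ?thesis using True C(3) by auto
next
  case False
  have "x \<in> open_segment 0 (c *\<^sub>R x)"
    unfolding in_segment using False by (auto intro!: exI [of _ "1/c"])
  moreover have "x \<in> C" using C(2,3) face_of_imp_subset by blast
  then have "0 \<in> C" "c *\<^sub>R x \<in> C"
    using convex_cone_contains_0 [OF C(1)] convex_cone_scaleR [OF C(1) \<open>0 \<le> c\<close>] by auto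
  ultimately show ?thesis using C(2,3) face_ofD by blast
qed

lemma face_of_cone_add:
  fixes C :: "'a::euclidean_space set"
  assumes C: "convex_cone C" "\<tau> face_of C" and xy: "x \<in> \<tau>" "y \<in> \<tau>" shows "x + y \<in> \<tau>"
proof -
  have "convex \<tau>" using C(2) face_of_imp_convex by blast
  then have "(1/2) *\<^sub>R (2 *\<^sub>R x) + (1/2) *\<^sub>R (2 *\<^sub>R y) \<in> \<tau>"
    using face_of_cone_scale [OF C] xy by (intro convexD) auto
  then show ?thesis by simp
qed

text \<open>\<open>y + z\<close> is the midpoint of \<open>2 *\<^sub>R y\<close> and
  \<open>2 *\<^sub>R z\<close>, so a face through it contains both. If \<open>y = z\<close> the open
  segment is empty and the claim is a rescaling.\<close>

lemma face_of_cone_split: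
  fixes C :: "'a::euclidean_space set"
  assumes C: "convex_cone C" "\<tau> face_of C" and "y + z \<in> \<tau>" and y: "y \<in> C" and z: "z \<in> C"
  shows "y \<in> \<tau>"
proof (cases "y = z")
  case True
  then have "(1/2) *\<^sub>R (y + z) \<in> \<tau>" using face_of_cone_scale [OF C assms(3), of "1/2"] by simp
  moreover have "(1/2) *\<^sub>R (y + z) = y" using True by (simp flip: scaleR_2)
  ultimately show ?thesis by simp
next
  case False
  have "y + z = (1 - 1/2) *\<^sub>R (2 *\<^sub>R y) + (1/2) *\<^sub>R (2 *\<^sub>R z)" by simp
  moreover have "2 *\<^sub>R y \<noteq> 2 *\<^sub>R z" using False by simp
  ultimately have "y + z \<in> open_segment (2 *\<^sub>R y) (2 *\<^sub>R z)"
    unfolding in_segment by (intro conjI exI [of _ "1/2"]) auto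
  moreover have "2 *\<^sub>R y \<in> C" "2 *\<^sub>R z \<in> C" using y z convex_cone_scaleR [OF C(1)] by auto
  ultimately have "2 *\<^sub>R y \<in> \<tau>" using C(2) assms(3) face_ofD by blast
  then show ?thesis using face_of_cone_scale [OF C, of "2 *\<^sub>R y" "1/2"] by simp
qed

lemma faces_of_ray:
  fixes a :: "'a::euclidean_space"
  assumes "\<tau> face_of ray a" "\<tau> \<noteq> {}" shows "\<tau> = {0} \<or> \<tau> = ray a"
proof -
  note C = convex_cone_ray [of a] assms(1)
  have "0 \<in> \<tau>" using face_of_cone_zero [OF C] assms(2) by blast
  have sub: "\<tau> \<subseteq> ray a" using assms(1) face_of_imp_subset by blast
  have "\<tau> = ray a" if x: "x \<in> \<tau>" "x \<noteq> 0" for x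
  proof -
    have "x \<in> ray a" using sub x by auto
    then obtain t where t: "0 \<le> t" "x = t *\<^sub>R a" unfolding mem_ray by blast
    then have "0 < t" using x(2) by (cases "t = 0") auto
    then have "a \<in> \<tau>" using face_of_cone_scale [OF C x(1), of "1/t"] t by simp
    then have "ray a \<subseteq> \<tau>" unfolding ray_def using face_of_cone_scale [OF C \<open>a \<in> \<tau>\<close>] by auto
    then show ?thesis using sub by simp
  qed
  then show ?thesis using \<open>0 \<in> \<tau>\<close> by blast
qed

text \<open>Together with \<open>s *\<^sub>R a + t *\<^sub>R b\<close> a face contains every
  generator whose coefficient is not zero, so it is determined by which of \<open>a\<close>,
  \<open>b\<close> it contains.\<close>

lemma faces_of_cone2:
  fixes a :: "'a::euclidean_space"
  assumes "\<tau> face_of cone2 a b" "\<tau> \<noteq> {}"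
  shows "\<tau> = {0} \<or> \<tau> = ray a \<or> \<tau> = ray b \<or> \<tau> = cone2 a b"
proof -
  note C = convex_cone_cone2 [of a b] assms(1)
  have z: "0 \<in> \<tau>" using face_of_cone_zero [OF C] assms(2) by blast
  have sub: "\<tau> \<subseteq> cone2 a b" using assms(1) face_of_imp_subset by blast
  have dec: "\<exists>s t. 0 \<le> s \<and> 0 \<le> t \<and> x = s *\<^sub>R a + t *\<^sub>R b \<and> (s = 0 \<or> a \<in> \<tau>) \<and> (t = 0 \<or> b \<in> \<tau>)"
    if "x \<in> \<tau>" for x
  proof -
    have "x \<in> cone2 a b" using sub that by auto
    then obtain s t where st: "0 \<le> s" "0 \<le> t" "x = s *\<^sub>R a + t *\<^sub>R b"
      unfolding mem_cone2 by blast
    have m: "s *\<^sub>R a \<in> cone2 a b" "t *\<^sub>R b \<in> cone2 a b"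
      using convex_cone_scaleR [OF convex_cone_cone2 st(1) cone2_self(1)]
        convex_cone_scaleR [OF convex_cone_cone2 st(2) cone2_self(2)] by blast+
    have "s *\<^sub>R a \<in> \<tau>" using face_of_cone_split [OF C _ m] that st by simp
    then have "a \<in> \<tau>" if "s \<noteq> 0" using face_of_cone_scale [OF C, of "s *\<^sub>R a" "1/s"] st that by simp
    moreover have "t *\<^sub>R b \<in> \<tau>"
      using face_of_cone_split [OF C _ m(2) m(1)] that st by (simp add: add.commute)
    then have "b \<in> \<tau>" if "t \<noteq> 0" using face_of_cone_scale [OF C, of "t *\<^sub>R b" "1/t"] st that by simp
    ultimately show ?thesis using st by blast
  qed
  have ra: "ray a \<subseteq> \<tau>" if "a \<in> \<tau>" unfolding ray_def using face_of_cone_scale [OF C that] by auto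
  have rb: "ray b \<subseteq> \<tau>" if "b \<in> \<tau>" unfolding ray_def using face_of_cone_scale [OF C that] by auto
  have ab: "cone2 a b \<subseteq> \<tau>" if "a \<in> \<tau>" "b \<in> \<tau>" unfolding cone2_def
    using face_of_cone_add [OF C] face_of_cone_scale [OF C that(1)] face_of_cone_scale [OF C that(2)] by auto
  consider "a \<in> \<tau>" "b \<in> \<tau>" | "a \<in> \<tau>" "b \<notin> \<tau>" | "a \<notin> \<tau>" "b \<in> \<tau>" | "a \<notin> \<tau>" "b \<notin> \<tau>" by blast
  then show ?thesis
  proof cases
    case 1 then show ?thesis using ab sub by blast
  next
    case 2
    have "\<tau> \<subseteq> ray a"
    proof
      fix x assume "x \<in> \<tau>"
      then obtain s t where "0 \<le> s" "x = s *\<^sub>R a + t *\<^sub>R b" "t = 0 \<or> b \<in> \<tau>" using dec by blast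
      then show "x \<in> ray a" using 2 unfolding mem_ray by auto
    qed
    then show ?thesis using ra 2 by blast
  next
    case 3
    have "\<tau> \<subseteq> ray b"
    proof
      fix x assume "x \<in> \<tau>"
      then obtain s t where "0 \<le> t" "x = s *\<^sub>R a + t *\<^sub>R b" "s = 0 \<or> a \<in> \<tau>" using dec by blast
      then show "x \<in> ray b" using 3 unfolding mem_ray by auto
    qed
    then show ?thesis using rb 3 by blast
  next
    case 4
    have "\<tau> \<subseteq> {0}"
    proof
      fix x assume "x \<in> \<tau>"
      then obtain s t where "x = s *\<^sub>R a + t *\<^sub>R b" "s = 0 \<or> a \<in> \<tau>" "t = 0 \<or> b \<in> \<tau>" using dec by blast
      then show "x \<in> {0}" using 4 by auto
    qed
    then show ?thesis using z by blast
  qed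
qed

text \<open>The form \<open>perp a b\<close> vanishes on \<open>a\<close> and is positive at
  \<open>b\<close>, so it supports the cone exactly along the ray of \<open>a\<close>.\<close>

lemma ray_face_of_cone2:
  fixes a :: "'a::euclidean_space"
  assumes "indep2 a b" shows "ray a face_of cone2 a b"
proof -
  let ?l = "perp a b"
  have l: "?l \<bullet> (s *\<^sub>R a + t *\<^sub>R b) = t * (?l \<bullet> b)" for s t
    by (simp add: inner_add_right perp_orth)
  have "cone2 a b \<inter> {x. ?l \<bullet> x = 0} face_of cone2 a b"
  proof (rule face_of_Int_supporting_hyperplane_ge)
    show "convex (cone2 a b)" by (rule convex_cone_imp_convex [OF convex_cone_cone2])
    show "0 \<le> ?l \<bullet> x" if "x \<in> cone2 a b" for x
      using that l perp_pos [OF assms] unfolding mem_cone2 by auto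
  qed
  moreover have "cone2 a b \<inter> {x. ?l \<bullet> x = 0} = ray a"
  proof (intro subset_antisym subsetI)
    fix x assume "x \<in> cone2 a b \<inter> {x. ?l \<bullet> x = 0}"
    then have x: "x \<in> cone2 a b" "?l \<bullet> x = 0" by simp_all
    from x(1) obtain s t where st: "0 \<le> s" "x = s *\<^sub>R a + t *\<^sub>R b" unfolding mem_cone2 by metis
    then have "t * (?l \<bullet> b) = 0" using l [of s t] x(2) by simp
    with st show "x \<in> ray a" using perp_pos [OF assms] unfolding mem_ray by auto
  next
    fix x assume x: "x \<in> ray a"
    then have "?l \<bullet> x = 0" unfolding mem_ray by (auto simp: perp_orth)
    then show "x \<in> cone2 a b \<inter> {x. ?l \<bullet> x = 0}" using x ray_subset_cone2(1) [of a b] by blast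
  qed
  ultimately show ?thesis by simp
qed

lemma zero_face_of_ray:
  fixes a :: "'a::euclidean_space"
  shows "{0} face_of ray a"
proof -
  have "ray a \<inter> {x. a \<bullet> x = 0} face_of ray a"
  proof (rule face_of_Int_supporting_hyperplane_ge)
    show "convex (ray a)" by (rule convex_cone_imp_convex [OF convex_cone_ray])
    show "0 \<le> a \<bullet> x" if "x \<in> ray a" for x using that unfolding mem_ray by auto
  qed
  moreover have "ray a \<inter> {x. a \<bullet> x = 0} = {0}" unfolding mem_ray set_eq_iff
    by (auto simp: mem_ray intro: exI [of _ 0])
  ultimately show ?thesis by simp
qed

section \<open>Classification of strongly convex rational cones of dimension at most two\<close>

lemma strongly_convex_ray: "strongly_convex (ray a)"
  unfolding strongly_convex_def
proof (intro allI impI)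
  fix x assume "x \<in> ray a \<and> - x \<in> ray a"
  then obtain s t where st: "0 \<le> s" "0 \<le> t" "x = s *\<^sub>R a" "- x = t *\<^sub>R a" unfolding mem_ray by blast
  then have "(s + t) *\<^sub>R a = 0" by (metis add.right_inverse scaleR_left_distrib)
  then have "s + t = 0 \<or> a = 0" by simp
  with st show "x = 0" by auto
qed

lemma strongly_convex_cone2: assumes "indep2 a b" shows "strongly_convex (cone2 a b)"
  unfolding strongly_convex_def
proof (intro allI impI)
  fix x assume "x \<in> cone2 a b \<and> - x \<in> cone2 a b"
  then obtain s t s' t' where st: "0 \<le> s" "0 \<le> t" "x = s *\<^sub>R a + t *\<^sub>R b"
    and st': "0 \<le> s'" "0 \<le> t'" "- x = s' *\<^sub>R a + t' *\<^sub>R b" unfolding mem_cone2 by blast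
  then have "(s + s') *\<^sub>R a + (t + t') *\<^sub>R b = x + - x" by (simp only: scaleR_left_distrib add_ac)
  then have "s + s' = 0 \<and> t + t' = 0" using indep2D [OF assms] by simp
  with st st' have "s = 0" "t = 0" by linarith+
  then show "x = 0" using st by simp
qed

text \<open>The explicit form of a strongly convex rational cone of dimension at most two, see
  \<open>rational_flat_cone\<close> and \<open>flat_cone_rational\<close>; it replaces generating
  sets of unknown size.\<close>

definition flat_cone :: "(real ^ 'n) set \<Rightarrow> bool" where
  "flat_cone \<sigma> \<longleftrightarrow> \<sigma> = {0} \<or> (\<exists>a\<in>int_points. a \<noteq> 0 \<and> \<sigma> = ray a) \<or>
     (\<exists>a\<in>int_points. \<exists>b\<in>int_points. indep2 a b \<and> \<sigma> = cone2 a b)"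

text \<open>Induction on the generators. The dimension bound puts a new generator \<open>x\<close>
  into the plane of the old \<open>a, b\<close>. If both coordinates of \<open>x\<close> are
  non-negative, \<open>x\<close> is redundant; if the signs differ, \<open>x\<close> takes the place
  of the generator with the positive coordinate; if both are non-positive and
  \<open>x \<noteq> 0\<close>, then \<open>- x\<close> lies in the cone, against strong
  convexity.\<close>

lemma flat_coneI:
  assumes "finite V" "V \<subseteq> int_points" "strongly_convex (convex_cone hull V)"
    "dim (convex_cone hull V) \<le> 2"
  shows "flat_cone (convex_cone hull V)"
  using assms
proof (induction V)
  case empty
  show ?case by (simp add: flat_cone_def)
next
  case (insert x V)
  let ?C = "convex_cone hull V" and ?D = "convex_cone hull (insert x V)"
  have sub: "?C \<subseteq> ?D" by (simp add: hull_mono subset_insertI)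
  have D: "strongly_convex ?D" "dim ?D \<le> 2" using insert.prems by auto
  have "flat_cone ?C"
  proof (rule insert.IH)
    show "strongly_convex ?C" using sub D(1) unfolding strongly_convex_def by blast
    show "dim ?C \<le> 2" using dim_subset [OF sub] D by linarith
  qed (use insert.prems in auto)
  have xi: "x \<in> int_points" using insert.prems by auto
  have xD: "x \<in> ?D" by (simp add: hull_inc)
  have cD: "convex_cone ?D" by (rule convex_cone_convex_cone_hull)
  consider (0) "?C = {0}" | (1) a where "a \<in> int_points" "a \<noteq> 0" "?C = ray a"
    | (2) a b where "a \<in> int_points" "b \<in> int_points" "indep2 a b" "?C = cone2 a b"
    using \<open>flat_cone ?C\<close> unfolding flat_cone_def by blast
  then show ?case
  proof cases
    case 0
    then have "?D = ray x" unfolding cone_hull_insert by (auto simp: ray_def)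
    then show ?thesis using xi by (cases "x = 0") (auto simp: flat_cone_def ray_def)
  next
    case 1
    have De: "?D = cone2 a x" unfolding cone_hull_insert 1(3) ray_def cone2_def by blast
    show ?thesis
    proof (cases "indep2 a x")
      case True then show ?thesis using De 1 xi unfolding flat_cone_def by blast
    next
      case False
      then obtain c where c: "x = c *\<^sub>R a" using not_indep2 [of a x] 1 by blast
      have "0 \<le> c"
      proof (rule ccontr)
        assume "\<not> 0 \<le> c"
        then have "- x = (- c) *\<^sub>R a" "0 \<le> - c" using c by auto
        then have "- x \<in> ?D" using De convex_cone_scaleR [OF cD, of "- c" a] by simp
        then have "x = 0" using xD D(1) unfolding strongly_convex_def by blast
        then show False using c 1 \<open>\<not> 0 \<le> c\<close> by simp
      qed
      have "cone2 a x \<subseteq> ray a"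
      proof
        fix y assume "y \<in> cone2 a x"
        then obtain s t where "0 \<le> s" "0 \<le> t" "y = s *\<^sub>R a + t *\<^sub>R x" unfolding mem_cone2 by blast
        then have "y = (s + t * c) *\<^sub>R a" "0 \<le> s + t * c" using c \<open>0 \<le> c\<close> by (auto simp: scaleR_left_distrib)
        then show "y \<in> ray a" unfolding mem_ray by blast
      qed
      then have "?D = ray a" using De ray_subset_cone2 by blast
      then show ?thesis using 1 unfolding flat_cone_def by blast
    qed
  next
    case 2
    have De: "y \<in> ?D \<longleftrightarrow> (\<exists>p\<ge>0. \<exists>q\<ge>0. \<exists>t\<ge>0. y = p *\<^sub>R a + q *\<^sub>R b + t *\<^sub>R x)" for y
      unfolding cone_hull_insert 2(4) cone2_def by blast
    have abD: "a \<in> ?D" "b \<in> ?D" using sub 2 by auto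
    have "x \<in> span {a, b}"
    proof (rule ccontr)
      assume n: "x \<notin> span {a, b}"
      then have "independent (insert x {a, b})"
        using indep2_independent [OF 2(3)] independent_insertI by blast
      moreover have "insert x {a, b} \<subseteq> ?D" using abD xD by auto
      ultimately have "card (insert x {a, b}) \<le> dim ?D" using independent_card_le_dim by blast
      moreover have "x \<noteq> a" "x \<noteq> b" using n span_base [of a "{a,b}"] span_base [of b "{a,b}"] by auto
      ultimately show False using D(2) indep2_independent [OF 2(3)] by simp
    qed
    then obtain \<alpha> \<beta> where x: "x = \<alpha> *\<^sub>R a + \<beta> *\<^sub>R b" unfolding in_span2 by blast
    have neg: False if "0 \<le> p" "0 \<le> q" "- x = p *\<^sub>R a + q *\<^sub>R b" "x \<noteq> 0" for p q
    proof -
      have "- x \<in> ?D" unfolding De using that(1-3) by (intro exI [of _ p] exI [of _ q] exI [of _ 0] conjI) auto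
      then show False using xD D(1) that(4) unfolding strongly_convex_def by blast
    qed
    have gen: "flat_cone ?D" if ab': "a' \<in> int_points" "b' \<in> int_points" "indep2 a' b'" "a' \<in> ?D" "b' \<in> ?D"
      "a \<in> cone2 a' b'" "b \<in> cone2 a' b'" "x \<in> cone2 a' b'" for a' b'
    proof -
      have "cone2 a' b' \<subseteq> ?D"
        unfolding cone2_hull [symmetric] using ab' cD by (intro hull_minimal) auto
      moreover have "?D \<subseteq> cone2 a' b'"
      proof
        fix y assume "y \<in> ?D"
        then obtain p q t where "0 \<le> p" "0 \<le> q" "0 \<le> t" "y = p *\<^sub>R a + q *\<^sub>R b + t *\<^sub>R x" using De by blast
        then show "y \<in> cone2 a' b'" using ab' convex_cone_cone2 [of a' b']
          by (simp add: convex_cone_add convex_cone_scaleR)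
      qed
      ultimately show ?thesis using ab' unfolding flat_cone_def by blast
    qed
    have key: "flat_cone ?D" if ab: "a \<in> int_points" "b \<in> int_points" "indep2 a b" "a \<in> ?D" "b \<in> ?D"
        "x = \<alpha> *\<^sub>R a + \<beta> *\<^sub>R b" "0 < \<alpha>" "\<beta> < 0"
        and g: "\<And>a' b'. a' \<in> int_points \<Longrightarrow> b' \<in> int_points \<Longrightarrow> indep2 a' b' \<Longrightarrow> a' \<in> ?D \<Longrightarrow> b' \<in> ?D \<Longrightarrow>
          a \<in> cone2 a' b' \<Longrightarrow> b \<in> cone2 a' b' \<Longrightarrow> x \<in> cone2 a' b' \<Longrightarrow> flat_cone ?D" for a b \<alpha> \<beta>
    proof (rule g [of b x])
      show "indep2 b x" using indep2_combine [of b a \<alpha> \<beta>] ab indep2_commute [of a b] by (simp add: add.commute)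
      have "x - \<beta> *\<^sub>R b = \<alpha> *\<^sub>R a" using ab by simp
      then have "(1/\<alpha>) *\<^sub>R (x - \<beta> *\<^sub>R b) = a" using ab by simp
      then have "a = (- \<beta> / \<alpha>) *\<^sub>R b + (1/\<alpha>) *\<^sub>R x"
        by (simp add: scaleR_diff_right)
      moreover have "0 \<le> - \<beta> / \<alpha>" "0 \<le> 1/\<alpha>" using ab by (auto simp: divide_nonpos_pos)
      ultimately show "a \<in> cone2 b x" unfolding mem_cone2 by blast
    qed (use ab xi xD in auto)
    consider "0 \<le> \<alpha>" "0 \<le> \<beta>" | "0 < \<alpha>" "\<beta> < 0" | "\<alpha> < 0" "0 < \<beta>" | "\<alpha> \<le> 0" "\<beta> \<le> 0" "x \<noteq> 0"
    proof -
      have "x = 0 \<Longrightarrow> \<alpha> = 0 \<and> \<beta> = 0" using x indep2D [OF 2(3), of \<alpha> \<beta>] by simp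
      moreover have "(0 \<le> \<alpha> \<and> 0 \<le> \<beta>) \<or> (0 < \<alpha> \<and> \<beta> < 0) \<or> (\<alpha> < 0 \<and> 0 < \<beta>) \<or>
          (\<alpha> \<le> 0 \<and> \<beta> \<le> 0 \<and> \<not> (\<alpha> = 0 \<and> \<beta> = 0))" by linarith
      ultimately show thesis using that by blast
    qed
    then show ?thesis
    proof cases
      case 1
      show ?thesis
      proof (rule gen [of a b])
        show "x \<in> cone2 a b" unfolding mem_cone2 using 1 x by blast
      qed (use 2 abD in auto)
    next
      case c: 2
      show ?thesis using key [of a b \<alpha> \<beta>] 2 abD x c gen by blast
    next
      case c: 3
      have "x = \<beta> *\<^sub>R b + \<alpha> *\<^sub>R a" using x by simp
      then show ?thesis using key [of b a \<beta> \<alpha>] 2 abD c gen indep2_commute [of a b] by blast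
    next
      case 4
      then show ?thesis using neg [of "- \<alpha>" "- \<beta>"] x by simp
    qed
  qed
qed

lemma rational_flat_cone:
  assumes "rational_cone \<sigma>" "strongly_convex \<sigma>" "dim \<sigma> \<le> 2" shows "flat_cone \<sigma>"
proof -
  obtain V where V: "finite V" "V \<subseteq> int_points" "\<sigma> = convex_cone hull V"
    using assms(1) unfolding rational_cone_def by blast
  then show ?thesis using flat_coneI assms by blast
qed

lemma flat_cone_rational:
  assumes "flat_cone \<sigma>" shows "rational_cone \<sigma>" "strongly_convex \<sigma>" "dim \<sigma> \<le> 2"
proof -

  have "rational_cone \<sigma> \<and> strongly_convex \<sigma> \<and> dim \<sigma> \<le> 2"
    using assms unfolding flat_cone_def
  proof (elim disjE bexE conjE)
    assume "\<sigma> = {0}"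
    moreover have "rational_cone {0::real^'n}" unfolding rational_cone_def
      by (intro exI [of _ "{}"]) auto
    ultimately show ?thesis by (auto simp: strongly_convex_def)
  next
    fix a assume a: "a \<in> int_points" "a \<noteq> 0" "\<sigma> = ray a"
    then have "rational_cone \<sigma>" unfolding rational_cone_def
      using ray_hull [of a] by (intro exI [of _ "{a}"]) auto
    then show ?thesis using a dim_ray [of a] strongly_convex_ray [of a] by simp
  next
    fix a b assume a: "a \<in> int_points" "b \<in> int_points" "indep2 a b" "\<sigma> = cone2 a b"
    then have "rational_cone \<sigma>" unfolding rational_cone_def
      using cone2_hull [of a b] by (intro exI [of _ "{a,b}"]) auto
    then show ?thesis using a dim_cone2 [of a b] strongly_convex_cone2 [of a b] by simp
  qed
  then show "rational_cone \<sigma>" "strongly_convex \<sigma>" "dim \<sigma> \<le> 2" by auto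
qed

lemma int_points_simps:
  "0 \<in> int_points" "x \<in> int_points \<Longrightarrow> y \<in> int_points \<Longrightarrow> x + y \<in> int_points"
  "x \<in> int_points \<Longrightarrow> y \<in> int_points \<Longrightarrow> x - y \<in> int_points"
  "x \<in> int_points \<Longrightarrow> - x \<in> int_points"
  "c \<in> \<int> \<Longrightarrow> x \<in> int_points \<Longrightarrow> c *\<^sub>R x \<in> int_points"
  unfolding int_points_def by auto

lemma int_points_inner: "x \<in> int_points \<Longrightarrow> y \<in> int_points \<Longrightarrow> x \<bullet> y \<in> \<int>"
  unfolding int_points_def inner_vec_def by (auto intro!: Ints_sum Ints_mult)

lemma int_points_sum: "(\<And>i. i \<in> A \<Longrightarrow> f i \<in> int_points) \<Longrightarrow> sum f A \<in> int_points"
  by (induction A rule: infinite_finite_induct) (auto simp: int_points_simps)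

lemma perp_int: "a \<in> int_points \<Longrightarrow> b \<in> int_points \<Longrightarrow> perp a b \<in> int_points"
  unfolding perp_def by (intro int_points_simps int_points_inner)

lemma flat_cone_convex_cone: "flat_cone \<sigma> \<Longrightarrow> convex_cone \<sigma>"
  unfolding flat_cone_def using convex_cone_ray convex_cone_cone2 by fastforce

lemma flat_cone_closed: "flat_cone \<sigma> \<Longrightarrow> closed \<sigma>"
  unfolding flat_cone_def using closed_ray closed_cone2 by fastforce

lemma flat_cone_dim2:
  assumes "flat_cone \<sigma>" "dim \<sigma> = 2"
  obtains a b where "a \<in> int_points" "b \<in> int_points" "indep2 a b" "\<sigma> = cone2 a b"
proof -
  have "dim {0::real^'n} = 0" by simp
  then have "\<sigma> \<noteq> {0}" using assms(2) by (metis zero_neq_numeral)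
  moreover have "\<not> (\<exists>a\<in>int_points. a \<noteq> 0 \<and> \<sigma> = ray a)" using assms(2) dim_ray by fastforce
  ultimately show thesis using assms(1) that unfolding flat_cone_def by blast
qed

lemma flat_cone_dim1:
  assumes "flat_cone \<sigma>" "dim \<sigma> = 1"
  obtains a where "a \<in> int_points" "a \<noteq> 0" "\<sigma> = ray a"
proof -
  have "dim {0::real^'n} = 0" by simp
  then have "\<sigma> \<noteq> {0}" using assms(2) by (metis zero_neq_one)
  moreover have "\<not> (\<exists>a\<in>int_points. \<exists>b\<in>int_points. indep2 a b \<and> \<sigma> = cone2 a b)"
    using assms(2) dim_cone2 by fastforce
  ultimately show thesis using assms(1) that unfolding flat_cone_def by blast
qed

lemma ray_eqD:
  assumes "ray u = ray a" "u \<noteq> 0" shows "\<exists>c>0. a = c *\<^sub>R u"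
proof -
  have "a \<in> ray u" using assms(1) by simp
  then obtain c where c: "0 \<le> c" "a = c *\<^sub>R u" unfolding mem_ray by metis
  have "u \<in> ray a" using assms(1) ray_self [of u] by simp
  then obtain t where "u = t *\<^sub>R a" unfolding mem_ray by metis
  then have "c \<noteq> 0" using c assms(2) by auto
  then show ?thesis using c by (intro exI [of _ c]) auto
qed

lemma ray_scale: assumes "0 < c" shows "ray (c *\<^sub>R u) = ray u"
proof (intro subset_antisym subsetI)
  fix x assume "x \<in> ray (c *\<^sub>R u)"
  then obtain t where "0 \<le> t" "x = t *\<^sub>R c *\<^sub>R u" unfolding mem_ray by metis
  then show "x \<in> ray u" using assms unfolding mem_ray by (intro exI [of _ "t * c"]) auto
next
  fix x assume "x \<in> ray u"
  then obtain t where "0 \<le> t" "x = t *\<^sub>R u" unfolding mem_ray by metis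
  then show "x \<in> ray (c *\<^sub>R u)" using assms unfolding mem_ray by (intro exI [of _ "t / c"]) auto
qed

lemma cone2_rays: "cone2 a b = (\<Union>x\<in>ray a. \<Union>y\<in>ray b. {x + y})"
  unfolding cone2_def ray_def by blast

lemma indep2_scale: assumes "indep2 a b" "c \<noteq> 0" shows "indep2 (c *\<^sub>R a) b"
  using indep2_combine [of b a c 0] assms indep2_commute by auto

section \<open>Germs\<close>

text \<open>A convex set with this germ contains a whole initial segment from \<open>u\<close> in
  direction \<open>d\<close> (\<open>germE\<close>). With \<open>u\<close>, \<open>d\<close>
  independent, at most one cone of a two-dimensional fan has a given germ, even if \<open>u\<close>
  lies on a ray shared by several cones; points alone would not separate these.\<close>

definition germ :: "'a::real_vector set \<Rightarrow> 'a \<Rightarrow> 'a \<Rightarrow> bool" where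
  "germ \<sigma> u d \<longleftrightarrow> u \<in> \<sigma> \<and> (\<exists>e>0. u + e *\<^sub>R d \<in> \<sigma>)"

lemma germE:
  assumes "germ \<sigma> u d" "convex \<sigma>"
  obtains e where "0 < e" "\<And>s. 0 \<le> s \<Longrightarrow> s \<le> e \<Longrightarrow> u + s *\<^sub>R d \<in> \<sigma>"
proof -
  obtain e where e: "0 < e" "u \<in> \<sigma>" "u + e *\<^sub>R d \<in> \<sigma>" using assms(1) unfolding germ_def by blast
  have "u + s *\<^sub>R d \<in> \<sigma>" if "0 \<le> s" "s \<le> e" for s
  proof -
    have "(1 - s/e) *\<^sub>R u + (s/e) *\<^sub>R (u + e *\<^sub>R d) \<in> \<sigma>"
      using assms(2) e that by (intro convexD) auto
    moreover have "(1 - s/e) *\<^sub>R u + (s/e) *\<^sub>R (u + e *\<^sub>R d) = u + s *\<^sub>R d"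
      using e by (simp add: algebra_simps)
    ultimately show ?thesis by simp
  qed
  with e(1) show thesis using that by blast
qed

lemma germ_common:
  assumes "germ \<sigma> u d" "convex \<sigma>" "germ \<sigma>' u d" "convex \<sigma>'"
  obtains e where "0 < e" "u + e *\<^sub>R d \<in> \<sigma>" "u + e *\<^sub>R d \<in> \<sigma>'" "u \<in> \<sigma>" "u \<in> \<sigma>'"
proof -
  obtain e where e: "0 < e" "\<And>s. 0 \<le> s \<Longrightarrow> s \<le> e \<Longrightarrow> u + s *\<^sub>R d \<in> \<sigma>" using germE assms(1,2) by blast
  obtain e' where e': "0 < e'" "\<And>s. 0 \<le> s \<Longrightarrow> s \<le> e' \<Longrightarrow> u + s *\<^sub>R d \<in> \<sigma>'" using germE assms(3,4) by blast
  show thesis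
  proof (rule that [of "min e e'"])
    show "u \<in> \<sigma>" "u \<in> \<sigma>'" using assms unfolding germ_def by auto
  qed (use e e' in auto)
qed

lemma indep2_germ: "indep2 u d \<Longrightarrow> e \<noteq> 0 \<Longrightarrow> indep2 u (u + e *\<^sub>R d)"
  using indep2_combine [of u d e 1] by simp

lemma germ_cone2:
  assumes "indep2 u b"
  shows "germ (cone2 u b) u d \<longleftrightarrow> (\<exists>s\<ge>0. \<exists>t. d = s *\<^sub>R b + t *\<^sub>R u)"
proof
  assume "germ (cone2 u b) u d"
  then obtain e where e: "0 < e" "u + e *\<^sub>R d \<in> cone2 u b" unfolding germ_def by blast
  then obtain s t where st: "0 \<le> s" "0 \<le> t" "u + e *\<^sub>R d = s *\<^sub>R u + t *\<^sub>R b" unfolding mem_cone2 by metis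
  then have "e *\<^sub>R d = (s - 1) *\<^sub>R u + t *\<^sub>R b" by (simp add: algebra_simps)
  then have "(1/e) *\<^sub>R (e *\<^sub>R d) = (1/e) *\<^sub>R ((s - 1) *\<^sub>R u + t *\<^sub>R b)" by simp
  then have "d = (t/e) *\<^sub>R b + ((s - 1)/e) *\<^sub>R u" using e(1) by (simp add: scaleR_right_distrib)
  moreover have "0 \<le> t/e" using st e by simp
  ultimately show "\<exists>s\<ge>0. \<exists>t. d = s *\<^sub>R b + t *\<^sub>R u" by blast
next
  assume "\<exists>s\<ge>0. \<exists>t. d = s *\<^sub>R b + t *\<^sub>R u"
  then obtain s t where st: "0 \<le> s" "d = s *\<^sub>R b + t *\<^sub>R u" by blast
  \<comment> \<open>Small enough for \<open>1 + e * t\<close>, the coefficient of \<open>u\<close>,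
    to stay non-negative when \<open>t\<close> is negative.\<close>
  define e where "e = 1 / (1 + \<bar>t\<bar>)"
  have e: "0 < e" unfolding e_def by (simp add: add_pos_nonneg)
  have "e * \<bar>t\<bar> \<le> 1" unfolding e_def by simp
  moreover have "\<bar>e * t\<bar> = e * \<bar>t\<bar>" using e by (simp add: abs_mult)
  ultimately have "0 \<le> 1 + e * t" by linarith
  moreover have "u + e *\<^sub>R d = (1 + e * t) *\<^sub>R u + (e * s) *\<^sub>R b" using st by (simp add: algebra_simps)
  moreover have "0 \<le> e * s" using e st by simp
  ultimately have "u + e *\<^sub>R d \<in> cone2 u b" unfolding mem_cone2 by blast
  then show "germ (cone2 u b) u d" using e unfolding germ_def by auto
qed

lemma germ_interior:
  assumes "0 < s" "0 < t"
  shows "germ (cone2 a b) (s *\<^sub>R a + t *\<^sub>R b) d \<longleftrightarrow> d \<in> span {a, b}"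
proof
  assume "germ (cone2 a b) (s *\<^sub>R a + t *\<^sub>R b) d"
  then obtain e where e: "0 < e" "s *\<^sub>R a + t *\<^sub>R b + e *\<^sub>R d \<in> cone2 a b" unfolding germ_def by blast
  have "s *\<^sub>R a + t *\<^sub>R b + e *\<^sub>R d \<in> span {a, b}" using e(2) span_cone2 [of a b] span_base by blast
  moreover have "s *\<^sub>R a + t *\<^sub>R b \<in> span {a, b}" using in_span2 by blast
  ultimately have "(s *\<^sub>R a + t *\<^sub>R b + e *\<^sub>R d) - (s *\<^sub>R a + t *\<^sub>R b) \<in> span {a, b}" by (rule span_diff)
  then have "e *\<^sub>R d \<in> span {a, b}" by simp
  then have "(1/e) *\<^sub>R (e *\<^sub>R d) \<in> span {a, b}" by (rule span_scale)
  then show "d \<in> span {a, b}" using e by simp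
next
  assume "d \<in> span {a, b}"
  then obtain p q where d: "d = p *\<^sub>R a + q *\<^sub>R b" unfolding in_span2 by blast
  \<comment> \<open>A step too short to exhaust either of the positive coordinates \<open>s\<close>
    and \<open>t\<close>.\<close>
  define e where "e = min (s / (1 + \<bar>p\<bar>)) (t / (1 + \<bar>q\<bar>))"
  have e: "0 < e" unfolding e_def using assms by (simp add: add_pos_nonneg)
  have "e * (1 + \<bar>p\<bar>) \<le> s" "e * (1 + \<bar>q\<bar>) \<le> t"
    using min.cobounded1 [of "s / (1 + \<bar>p\<bar>)" "t / (1 + \<bar>q\<bar>)"] min.cobounded2 [of "s / (1 + \<bar>p\<bar>)" "t / (1 + \<bar>q\<bar>)"]
    unfolding e_def [symmetric] by (simp_all add: pos_le_divide_eq add_pos_nonneg)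
  then have "e * \<bar>p\<bar> \<le> s" "e * \<bar>q\<bar> \<le> t" using e by (simp_all add: distrib_left)
  moreover have "\<bar>e * p\<bar> = e * \<bar>p\<bar>" "\<bar>e * q\<bar> = e * \<bar>q\<bar>" using e by (auto simp: abs_mult)
  ultimately have nn: "0 \<le> s + e * p" "0 \<le> t + e * q" by linarith+
  have "s *\<^sub>R a + t *\<^sub>R b + e *\<^sub>R d = (s + e * p) *\<^sub>R a + (t + e * q) *\<^sub>R b" using d by (simp add: algebra_simps)
  then have "s *\<^sub>R a + t *\<^sub>R b + e *\<^sub>R d \<in> cone2 a b" unfolding mem_cone2 using nn by blast
  moreover have "s *\<^sub>R a + t *\<^sub>R b \<in> cone2 a b" unfolding mem_cone2 using assms less_imp_le by blast
  ultimately show "germ (cone2 a b) (s *\<^sub>R a + t *\<^sub>R b) d" using e unfolding germ_def by blast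
qed

section \<open>Surface fans\<close>

definition surface_fan :: "(real ^ 'n) set set \<Rightarrow> bool" where
  "surface_fan F \<longleftrightarrow> rational_fan F \<and> pure_dim 2 F"

lemma surface_fan_dim_le: assumes "surface_fan F" "\<sigma> \<in> F" shows "dim \<sigma> \<le> 2"
proof -
  obtain \<rho> where "\<sigma> \<subseteq> \<rho>" "dim \<rho> = 2" using assms unfolding surface_fan_def pure_dim_def by blast
  then show ?thesis using dim_subset by metis
qed

lemma surface_fan_flat: assumes "surface_fan F" "\<sigma> \<in> F" shows "flat_cone \<sigma>"
  using assms surface_fan_dim_le [OF assms] rational_flat_cone
  unfolding surface_fan_def rational_fan_def by blast

lemma surface_fan_face: "surface_fan F \<Longrightarrow> \<sigma> \<in> F \<Longrightarrow> \<tau> face_of \<sigma> \<Longrightarrow> \<tau> \<noteq> {} \<Longrightarrow> \<tau> \<in> F"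
  unfolding surface_fan_def rational_fan_def by blast

lemma surface_fan_Int: "surface_fan F \<Longrightarrow> \<sigma> \<in> F \<Longrightarrow> \<tau> \<in> F \<Longrightarrow> \<sigma> \<inter> \<tau> face_of \<sigma>"
  unfolding surface_fan_def rational_fan_def by blast

lemma surface_fan_finite: "surface_fan F \<Longrightarrow> finite F"
  unfolding surface_fan_def rational_fan_def by blast

lemma surface_fan_convex_cone: "surface_fan F \<Longrightarrow> \<sigma> \<in> F \<Longrightarrow> convex_cone \<sigma>"
  using surface_fan_flat flat_cone_convex_cone by blast

lemma surface_fan_convex: "surface_fan F \<Longrightarrow> \<sigma> \<in> F \<Longrightarrow> convex \<sigma>"
  using surface_fan_convex_cone convex_cone_imp_convex by blast

lemma surface_fan_dim2:
  assumes "surface_fan F" "\<sigma> \<in> F" "x \<in> \<sigma>" "y \<in> \<sigma>" "indep2 x y" shows "dim \<sigma> = 2"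
  using dim_ge_2 [OF assms(5,3,4)] surface_fan_dim_le [OF assms(1,2)] by simp

text \<open>The intersection is a face of \<sigma> with two independent vectors, while the proper
  faces of a planar cone have dimension at most one.\<close>

lemma surface_fan_subset:
  assumes F: "surface_fan F" "\<sigma> \<in> F" "\<sigma>' \<in> F" and xy: "indep2 x y" "x \<in> \<sigma> \<inter> \<sigma>'" "y \<in> \<sigma> \<inter> \<sigma>'"
  shows "\<sigma> \<subseteq> \<sigma>'"
proof -
  have "dim \<sigma> = 2" using surface_fan_dim2 [OF F(1,2)] xy by blast
  then obtain a b where ab: "indep2 a b" "\<sigma> = cone2 a b"
    using flat_cone_dim2 surface_fan_flat [OF F(1,2)] by metis
  have "\<sigma> \<inter> \<sigma>' face_of cone2 a b" using surface_fan_Int [OF F] ab by simp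
  moreover have "\<sigma> \<inter> \<sigma>' \<noteq> {}" using xy by blast
  ultimately have "\<sigma> \<inter> \<sigma>' = {0} \<or> \<sigma> \<inter> \<sigma>' = ray a \<or> \<sigma> \<inter> \<sigma>' = ray b \<or> \<sigma> \<inter> \<sigma>' = cone2 a b"
    by (rule faces_of_cone2)
  moreover have "2 \<le> dim (\<sigma> \<inter> \<sigma>')" using dim_ge_2 [OF xy] .
  moreover have "dim {0::real^'n} = 0" "dim (ray a) = 1" "dim (ray b) = 1"
    using dim_ray indep2_nonzero [OF ab(1)] by auto
  ultimately have "\<sigma> \<inter> \<sigma>' = \<sigma>" using ab by fastforce
  then show ?thesis by blast
qed

lemma surface_fan_unique:
  assumes "surface_fan F" "\<sigma> \<in> F" "\<sigma>' \<in> F" "indep2 x y" "x \<in> \<sigma> \<inter> \<sigma>'" "y \<in> \<sigma> \<inter> \<sigma>'"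
  shows "\<sigma> = \<sigma>'"
  using surface_fan_subset [OF assms(1,2,3,4)] surface_fan_subset [OF assms(1,3,2,4)] assms(5,6) by blast

lemma surface_fan_germ_unique:
  assumes F: "surface_fan F" "\<sigma> \<in> F" "\<sigma>' \<in> F" and d: "indep2 u d" "germ \<sigma> u d" "germ \<sigma>' u d"
  shows "\<sigma> = \<sigma>'"
proof -
  obtain e where "0 < e" "u + e *\<^sub>R d \<in> \<sigma>" "u + e *\<^sub>R d \<in> \<sigma>'" "u \<in> \<sigma>" "u \<in> \<sigma>'"
    using germ_common d(2,3) surface_fan_convex [OF F(1)] F(2,3) by metis
  then show ?thesis using surface_fan_unique [OF F indep2_germ [OF d(1), of e]] by simp
qed

lemma surface_fan_germ_dim:
  assumes F: "surface_fan F" "\<sigma> \<in> F" and d: "indep2 u d" "germ \<sigma> u d" shows "dim \<sigma> = 2"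
proof -
  obtain e where "0 < e" "u + e *\<^sub>R d \<in> \<sigma>" "u \<in> \<sigma>" using d(2) unfolding germ_def by blast
  then show ?thesis using surface_fan_dim2 [OF F _ _ indep2_germ [OF d(1)]] by auto
qed

text \<open>Purity puts a point of the support into a two-dimensional cone, where its coordinates
  are both positive or one of them vanishes. Local statements at arbitrary points are proved by this
  trichotomy.\<close>

lemma surface_fan_point_cases:
  assumes F: "surface_fan F" and "u \<noteq> 0"
  obtains (ray) "ray u \<in> F"
    | (interior) a b s t where "cone2 a b \<in> F" "a \<in> int_points" "b \<in> int_points" "indep2 a b"
        "0 < s" "0 < t" "u = s *\<^sub>R a + t *\<^sub>R b"
    | (outside) "\<And>\<sigma>. \<sigma> \<in> F \<Longrightarrow> u \<notin> \<sigma>"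
proof (cases "\<exists>\<sigma>\<in>F. u \<in> \<sigma>")
  case False then show thesis using outside by blast
next
  case True
  then obtain \<rho> where "\<rho> \<in> F" "u \<in> \<rho>" by blast
  then obtain \<sigma> where \<sigma>: "\<sigma> \<in> F" "u \<in> \<sigma>" "dim \<sigma> = 2"
    using F unfolding surface_fan_def pure_dim_def by blast
  then obtain a b where ab: "a \<in> int_points" "b \<in> int_points" "indep2 a b" "\<sigma> = cone2 a b"
    using flat_cone_dim2 surface_fan_flat [OF F] by metis
  have fr: "ray a \<in> F" "ray b \<in> F"
    using surface_fan_face [OF F \<sigma>(1)] ray_face_of_cone2 [OF ab(3)] ray_face_of_cone2 [of b a]
      ab indep2_commute [of a b] cone2_commute [of a b] ray_self by (metis empty_iff)+
  have "u \<in> cone2 a b" using \<sigma> ab by simp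
  then obtain s t where st: "0 \<le> s" "0 \<le> t" "u = s *\<^sub>R a + t *\<^sub>R b" unfolding mem_cone2 by metis
  consider "s = 0" "0 < t" | "t = 0" "0 < s" | "0 < s" "0 < t" using st assms(2) by fastforce
  then show thesis
  proof cases
    case 1 then show thesis using st fr ray_scale [of t b] ray by simp
  next
    case 2 then show thesis using st fr ray_scale [of s a] ray by simp
  next
    case 3 then show thesis using interior ab \<sigma> st by blast
  qed
qed

text \<open>The intersection is a face, and a face through an interior point contains both summands
  of that point, which are independent.\<close>

lemma surface_fan_interior_unique:
  assumes F: "surface_fan F" "cone2 a b \<in> F" "\<sigma> \<in> F" and st: "0 < s" "0 < t" and ab: "indep2 a b"
    and "s *\<^sub>R a + t *\<^sub>R b \<in> \<sigma>"
  shows "\<sigma> = cone2 a b"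
proof -
  note C = convex_cone_cone2 [of a b] surface_fan_Int [OF F]
  let ?x = "s *\<^sub>R a + t *\<^sub>R b"
  have m: "s *\<^sub>R a \<in> cone2 a b" "t *\<^sub>R b \<in> cone2 a b"
    using convex_cone_scaleR [OF convex_cone_cone2, of s a a b] convex_cone_scaleR [OF convex_cone_cone2, of t b a b]
      st by auto
  have "?x \<in> cone2 a b" using m convex_cone_add [OF convex_cone_cone2] by blast
  then have x: "?x \<in> cone2 a b \<inter> \<sigma>" using assms(7) by blast
  have "s *\<^sub>R a \<in> cone2 a b \<inter> \<sigma>" using face_of_cone_split [OF C x m] .
  moreover have "t *\<^sub>R b + s *\<^sub>R a \<in> cone2 a b \<inter> \<sigma>" using x by (simp add: add.commute)
  then have "t *\<^sub>R b \<in> cone2 a b \<inter> \<sigma>" using face_of_cone_split [OF C _ m(2,1)] by blast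
  moreover have "indep2 (s *\<^sub>R a) (t *\<^sub>R b)"
    using indep2_scale [OF ab, of s] indep2_scale [of b "s *\<^sub>R a" t] indep2_commute st by (metis less_irrefl)
  ultimately have "cone2 a b = \<sigma>" using surface_fan_unique [OF F] by blast
  then show ?thesis by simp
qed

section \<open>Weights of germs\<close>

definition weighted_surface :: "'n::finite weighted_fan \<Rightarrow> bool" where
  "weighted_surface W \<longleftrightarrow> surface_fan (fst W) \<and>
     (\<forall>\<sigma>\<in>fst W. dim \<sigma> = 2 \<longrightarrow> snd W \<sigma> \<in> \<int> \<and> 0 < snd W \<sigma>) \<and>
     (\<forall>\<sigma>. \<not> (\<sigma> \<in> fst W \<and> dim \<sigma> = 2) \<longrightarrow> snd W \<sigma> = 0)"

lemma tropical_fan_2: "tropical_fan 2 W \<longleftrightarrow>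
    weighted_surface W \<and> (\<forall>\<tau>\<in>fst W. dim \<tau> = 1 \<longrightarrow> weighted_normal_sum W \<tau> \<in> span \<tau>)"
  unfolding tropical_fan_def weighted_surface_def surface_fan_def by (auto simp: numeral_2_eq_2)

text \<open>At most one cone of the fan contributes to the sum. The function \<open>germ_weight W\<close> does not
  change under refinement and determines the cycle; it replaces the cycle in all that follows.\<close>

definition germ_weight :: "'n::finite weighted_fan \<Rightarrow> real ^ 'n \<Rightarrow> real ^ 'n \<Rightarrow> real" where
  "germ_weight W u d = (if indep2 u d then sum (snd W) {\<sigma>\<in>fst W. dim \<sigma> = 2 \<and> germ \<sigma> u d} else 0)"

lemma germ_weight_eq:
  assumes W: "surface_fan (fst W)" "\<sigma> \<in> fst W" and d: "indep2 u d" "germ \<sigma> u d"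
  shows "germ_weight W u d = snd W \<sigma>"
proof -
  have "{\<sigma>\<in>fst W. dim \<sigma> = 2 \<and> germ \<sigma> u d} = {\<sigma>}"
    using surface_fan_germ_unique [OF W _ d] surface_fan_germ_dim [OF W d] W d by blast
  then show ?thesis using d unfolding germ_weight_def by simp
qed

lemma germ_weight_nonzeroE:
  assumes "germ_weight W u d \<noteq> 0"
  obtains \<sigma> where "indep2 u d" "\<sigma> \<in> fst W" "dim \<sigma> = 2" "germ \<sigma> u d"
proof -
  have "indep2 u d" using assms unfolding germ_weight_def by presburger
  moreover then have "sum (snd W) {\<sigma>\<in>fst W. dim \<sigma> = 2 \<and> germ \<sigma> u d} \<noteq> 0"
    using assms unfolding germ_weight_def by simp
  then have "{\<sigma>\<in>fst W. dim \<sigma> = 2 \<and> germ \<sigma> u d} \<noteq> {}" by (metis sum.empty)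
  ultimately show thesis using that by blast
qed

lemma germ_weight_pos:
  assumes W: "weighted_surface W" "\<sigma> \<in> fst W" and d: "indep2 u d" "germ \<sigma> u d"
  shows "0 < germ_weight W u d"
  using germ_weight_eq [of W, OF _ W(2) d] surface_fan_germ_dim [OF _ W(2) d] W unfolding weighted_surface_def by metis

lemma germ_weight_eqI:
  assumes W: "surface_fan (fst W)" and W': "surface_fan (fst W')"
    and 1: "\<And>u d \<sigma>. indep2 u d \<Longrightarrow> \<sigma> \<in> fst W \<Longrightarrow> germ \<sigma> u d \<Longrightarrow> \<exists>\<sigma>'\<in>fst W'. germ \<sigma>' u d"
    and 2: "\<And>u d \<sigma> \<sigma>'. indep2 u d \<Longrightarrow> \<sigma> \<in> fst W \<Longrightarrow> \<sigma>' \<in> fst W' \<Longrightarrow> germ \<sigma> u d \<Longrightarrow> germ \<sigma>' u d \<Longrightarrow> snd W \<sigma> = snd W' \<sigma>'"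
    and 3: "\<And>u d \<sigma>. indep2 u d \<Longrightarrow> \<sigma> \<in> fst W' \<Longrightarrow> germ \<sigma> u d \<Longrightarrow> \<exists>\<sigma>'\<in>fst W. germ \<sigma>' u d"
  shows "germ_weight W = germ_weight W'"
proof (intro ext)
  fix u d
  show "germ_weight W u d = germ_weight W' u d"
  proof (cases "indep2 u d \<and> (\<exists>\<sigma>\<in>fst W. germ \<sigma> u d)")
    case True
    then obtain \<sigma> \<sigma>' where "indep2 u d" "\<sigma> \<in> fst W" "germ \<sigma> u d" "\<sigma>' \<in> fst W'" "germ \<sigma>' u d"
      using 1 by blast
    then show ?thesis using germ_weight_eq [OF W] germ_weight_eq [OF W'] 2 by metis
  next
    case False
    then have "germ_weight W u d = 0" using germ_weight_nonzeroE by metis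
    moreover have "germ_weight W' u d = 0" using False 3 germ_weight_nonzeroE by metis
    ultimately show ?thesis by simp
  qed
qed

section \<open>Primitive normals\<close>

text \<open>The primitive normal of a cone at one of its rays \<open>u\<close> depends only on the half-plane \<open>half_plane u b\<close>
  generated by the cone and the line of \<open>u\<close>, so it is unchanged when the cone is subdivided.\<close>

definition half_plane :: "'a::real_vector \<Rightarrow> 'a \<Rightarrow> 'a set" where
  "half_plane u b = {s *\<^sub>R b + t *\<^sub>R u | s t. 0 \<le> s}"

definition side_normal :: "real ^ 'n \<Rightarrow> real ^ 'n \<Rightarrow> real ^ 'n" where
  "side_normal u b = primitive_normal (half_plane u b) (span {u})"

definition primitive :: "real ^ 'n \<Rightarrow> bool" where
  "primitive u \<longleftrightarrow> u \<in> int_points \<and> u \<noteq> 0 \<and> (\<forall>w\<in>int_points \<inter> span {u}. \<exists>m::int. w = of_int m *\<^sub>R u)"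

lemma mem_half_plane: "x \<in> half_plane u b \<longleftrightarrow> (\<exists>s\<ge>0. \<exists>t. x = s *\<^sub>R b + t *\<^sub>R u)"
  unfolding half_plane_def by auto

lemma germ_cone2_half_plane: "indep2 u b \<Longrightarrow> germ (cone2 u b) u d \<longleftrightarrow> d \<in> half_plane u b"
  unfolding mem_half_plane by (rule germ_cone2)

lemma half_plane_eq:
  assumes "0 < s" shows "half_plane u (s *\<^sub>R b + t *\<^sub>R u) = half_plane u b"
proof (intro subset_antisym subsetI)
  fix x assume "x \<in> half_plane u (s *\<^sub>R b + t *\<^sub>R u)"
  then obtain p q where "0 \<le> p" "x = p *\<^sub>R (s *\<^sub>R b + t *\<^sub>R u) + q *\<^sub>R u" unfolding mem_half_plane by metis
  then have "x = (p * s) *\<^sub>R b + (p * t + q) *\<^sub>R u" "0 \<le> p * s" using assms by (auto simp: algebra_simps)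
  then show "x \<in> half_plane u b" unfolding mem_half_plane by metis
next
  fix x assume "x \<in> half_plane u b"
  then obtain p q where pq: "0 \<le> p" "x = p *\<^sub>R b + q *\<^sub>R u" unfolding mem_half_plane by metis
  then have "x = (p / s) *\<^sub>R (s *\<^sub>R b + t *\<^sub>R u) + (q - p / s * t) *\<^sub>R u" "0 \<le> p / s"
    using assms by (auto simp: algebra_simps)
  then show "x \<in> half_plane u (s *\<^sub>R b + t *\<^sub>R u)" unfolding mem_half_plane by metis
qed

lemma half_plane_span: "span (half_plane u b) = span {u, b}"
proof (rule subset_antisym; rule span_minimal)
  show "half_plane u b \<subseteq> span {u, b}"
  proof
    fix x assume "x \<in> half_plane u b"
    then obtain s t where "x = t *\<^sub>R u + s *\<^sub>R b" unfolding mem_half_plane by (metis add.commute)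
    then show "x \<in> span {u, b}" unfolding in_span2 by blast
  qed
  have "u = 0 *\<^sub>R b + 1 *\<^sub>R u" "b = 1 *\<^sub>R b + 0 *\<^sub>R u" by simp_all
  then have "u \<in> half_plane u b" "b \<in> half_plane u b" unfolding mem_half_plane
    by (metis order_refl, metis zero_le_one)
  then show "{u, b} \<subseteq> span (half_plane u b)" by (auto intro: span_base)
qed auto

text \<open>Stated as an equality of predicates because \<open>primitive_normal\<close> is a choice:
  equal predicates are what guarantees that the same vector is chosen for the cone and for the
  half-plane.\<close>

lemma is_primitive_normal_cone2:
  "is_primitive_normal (cone2 u b) (ray u) = is_primitive_normal (half_plane u b) (span {u})"
proof
  fix v
  have 1: "(\<exists>s\<in>cone2 u b. \<exists>t\<in>span {u}. v = s + t) \<longleftrightarrow> v \<in> half_plane u b"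
  proof
    assume "\<exists>s\<in>cone2 u b. \<exists>t\<in>span {u}. v = s + t"
    then obtain x y where xy: "x \<in> cone2 u b" "y \<in> span {u}" "v = x + y" by blast
    obtain p q where pq: "0 \<le> q" "x = p *\<^sub>R u + q *\<^sub>R b" using xy(1) unfolding mem_cone2 by metis
    obtain t where "y = t *\<^sub>R u" using xy(2) unfolding in_span1 by blast
    then have "v = q *\<^sub>R b + (p + t) *\<^sub>R u" using xy pq by (simp add: algebra_simps)
    then show "v \<in> half_plane u b" using pq unfolding mem_half_plane by metis
  next
    assume "v \<in> half_plane u b"
    then obtain s t where st: "0 \<le> s" "v = s *\<^sub>R b + t *\<^sub>R u" unfolding mem_half_plane by metis
    then have "s *\<^sub>R b \<in> cone2 u b" "t *\<^sub>R u \<in> span {u}"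
      using convex_cone_scaleR [OF convex_cone_cone2 st(1) cone2_self(2)] unfolding in_span1 by blast+
    then show "\<exists>s\<in>cone2 u b. \<exists>t\<in>span {u}. v = s + t" using st by blast
  qed
  have 2: "(\<exists>s\<in>half_plane u b. \<exists>t\<in>span {u}. v = s + t) \<longleftrightarrow> v \<in> half_plane u b"
  proof
    assume "\<exists>s\<in>half_plane u b. \<exists>t\<in>span {u}. v = s + t"
    then obtain x y where xy: "x \<in> half_plane u b" "y \<in> span {u}" "v = x + y" by blast
    obtain p q where pq: "0 \<le> q" "x = q *\<^sub>R b + p *\<^sub>R u" using xy(1) unfolding mem_half_plane by metis
    obtain t where "y = t *\<^sub>R u" using xy(2) unfolding in_span1 by blast
    then have "v = q *\<^sub>R b + (p + t) *\<^sub>R u" using xy pq by (simp add: algebra_simps)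
    then show "v \<in> half_plane u b" using pq unfolding mem_half_plane by metis
  next
    assume "v \<in> half_plane u b"
    moreover have "0 \<in> span {u}" "v = v + 0" by (auto simp: span_zero)
    ultimately show "\<exists>s\<in>half_plane u b. \<exists>t\<in>span {u}. v = s + t" by blast
  qed
  show "is_primitive_normal (cone2 u b) (ray u) v = is_primitive_normal (half_plane u b) (span {u}) v"
    unfolding is_primitive_normal_def span_cone2 span_ray half_plane_span span_span 1 2 ..
qed

lemma primitive_normal_cone2: "primitive_normal (cone2 u b) (ray u) = side_normal u b"
  unfolding primitive_normal_def side_normal_def is_primitive_normal_cone2 ..

text \<open>Division with remainder: \<open>v\<close> realises the least positive value of
  \<open>l\<close> on the lattice points of \<open>S\<close>; the remainder of any other value is
  attained too and must be zero. The point \<open>b\<close> shows that positive values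
  exist.\<close>

lemma lattice_generator:
  fixes S :: "(real ^ 'n) set"
  assumes l: "l \<in> int_points" and S: "subspace S" and b: "b \<in> int_points \<inter> S" "0 < l \<bullet> b"
  shows "\<exists>v\<in>int_points \<inter> S. 0 < l \<bullet> v \<and> (\<forall>w\<in>int_points \<inter> S. \<exists>m::int. l \<bullet> (w - of_int m *\<^sub>R v) = 0)"
proof -
  define P where "P n \<longleftrightarrow> 0 < n \<and> (\<exists>w\<in>int_points \<inter> S. l \<bullet> w = real n)" for n :: nat
  have "l \<bullet> b \<in> \<int>" using int_points_inner l b by blast
  then obtain z where z: "l \<bullet> b = of_int z" by (auto elim: Ints_cases)
  then have "P (nat z)" unfolding P_def using b by (auto intro!: bexI [of _ b])
  define n where "n = (LEAST n. P n)"
  have "P n" unfolding n_def using \<open>P (nat z)\<close> by (rule LeastI)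
  then obtain v where v: "0 < n" "v \<in> int_points \<inter> S" "l \<bullet> v = real n" unfolding P_def by blast
  have "\<exists>m::int. l \<bullet> (w - of_int m *\<^sub>R v) = 0" if w: "w \<in> int_points \<inter> S" for w
  proof -
    have "l \<bullet> w \<in> \<int>" using int_points_inner l w by blast
    then obtain z where z: "l \<bullet> w = of_int z" by (auto elim: Ints_cases)
    define w' where "w' = w - of_int (z div int n) *\<^sub>R v"
    have "w' \<in> int_points" unfolding w'_def using w v by (auto intro!: int_points_simps)
    moreover have "w' \<in> S" unfolding w'_def using w v S by (auto intro!: subspace_diff subspace_scale)
    ultimately have w': "w' \<in> int_points \<inter> S" by blast
    have "l \<bullet> w' = of_int z - of_int (z div int n) * real n" unfolding w'_def using z v by (simp add: inner_diff_right)
    also have "\<dots> = of_int (z mod int n)" by (simp add: minus_div_mult_eq_mod [symmetric])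
    finally have e: "l \<bullet> w' = of_int (z mod int n)" .
    have "z mod int n = 0"
    proof (rule ccontr)
      assume ne: "z mod int n \<noteq> 0"
      moreover have "0 \<le> z mod int n" "z mod int n < int n" using v by auto
      ultimately have "P (nat (z mod int n))" "nat (z mod int n) < n" unfolding P_def using w' e by (auto intro!: bexI [of _ w'])
      then show False using not_less_Least unfolding n_def by blast
    qed
    then show ?thesis using e unfolding w'_def by auto
  qed
  then show ?thesis using v by (intro bexI [of _ v]) auto
qed

text \<open>A lattice vector of least positive height over the line of \<open>u\<close>, measured by
  \<open>perp u b\<close>, satisfies the defining predicate, hence so does the chosen vector. The
  coefficient of \<open>u\<close> in \<open>side_normal_gen\<close> is a real number, as
  \<open>u\<close> need not be primitive here.\<close>

lemma side_normal_props:
  assumes u: "u \<in> int_points" and b: "b \<in> int_points" and ub: "indep2 u b"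
  shows side_normal_int: "side_normal u b \<in> int_points"
    and side_normal_dir: "\<exists>s>0. \<exists>t. side_normal u b = s *\<^sub>R b + t *\<^sub>R u"
    and side_normal_gen: "\<And>w. w \<in> int_points \<Longrightarrow> w \<in> span {u, b} \<Longrightarrow> \<exists>(m::int) k. w = of_int m *\<^sub>R side_normal u b + k *\<^sub>R u"
proof -
  have bS: "b \<in> int_points \<inter> span {u, b}" using b by (auto intro: span_base)
  obtain v where v: "v \<in> int_points \<inter> span {u, b}" "0 < perp u b \<bullet> v"
    "\<And>w. w \<in> int_points \<inter> span {u, b} \<Longrightarrow> \<exists>m::int. perp u b \<bullet> (w - of_int m *\<^sub>R v) = 0"
    using lattice_generator [OF perp_int [OF u b] subspace_span bS perp_pos [OF ub]] by blast
  have ker: "x \<in> span {u}" if x: "x \<in> span {u, b}" and "perp u b \<bullet> x = 0" for x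
  proof -
    obtain s t where st: "x = s *\<^sub>R u + t *\<^sub>R b" using x unfolding in_span2 by blast
    then have "perp u b \<bullet> x = t * (perp u b \<bullet> b)" by (simp add: inner_add_right perp_orth)
    then have "t = 0" using \<open>perp u b \<bullet> x = 0\<close> perp_pos [OF ub] by simp
    then show ?thesis using st unfolding in_span1 by auto
  qed
  have "is_primitive_normal (half_plane u b) (span {u}) v"
    unfolding is_primitive_normal_def half_plane_span span_span
  proof (intro conjI ballI)
    show "v \<in> int_points \<inter> span {u, b}" by fact
    fix w assume w: "w \<in> int_points \<inter> span {u, b}"
    then obtain m :: int where m: "perp u b \<bullet> (w - of_int m *\<^sub>R v) = 0" using v(3) by blast
    have "w - of_int m *\<^sub>R v \<in> span {u, b}" using w v(1) by (intro span_diff span_scale) auto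
    then show "\<exists>m::int. w - of_int m *\<^sub>R v \<in> span {u}" using ker m by blast
  next
    obtain s t where st: "v = s *\<^sub>R u + t *\<^sub>R b" using IntD2 [OF v(1)] unfolding in_span2 by blast
    then have "perp u b \<bullet> v = t * (perp u b \<bullet> b)" by (simp add: inner_add_right perp_orth)
    then have "0 < t" using v(2) perp_pos [OF ub] by (simp add: zero_less_mult_iff)
    then have "v \<in> half_plane u b" using st unfolding mem_half_plane by (metis add.commute less_imp_le)
    moreover have "0 \<in> span {u}" "v = v + 0" by (auto simp: span_zero)
    ultimately show "\<exists>s\<in>half_plane u b. \<exists>t\<in>span {u}. v = s + t" by blast
  qed
  then have side_normal: "is_primitive_normal (half_plane u b) (span {u}) (side_normal u b)"
    unfolding side_normal_def primitive_normal_def by (rule someI)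
  then show "side_normal u b \<in> int_points" unfolding is_primitive_normal_def by blast
  have gen: "\<exists>(m::int) k. w = of_int m *\<^sub>R side_normal u b + k *\<^sub>R u" if "w \<in> int_points" "w \<in> span {u, b}" for w
  proof -
    obtain m :: int where "w - of_int m *\<^sub>R side_normal u b \<in> span {u}"
      using side_normal \<open>w \<in> int_points\<close> \<open>w \<in> span {u, b}\<close> unfolding is_primitive_normal_def half_plane_span span_span by blast
    then obtain k where "w - of_int m *\<^sub>R side_normal u b = k *\<^sub>R u" unfolding in_span1 by blast
    then have "w = of_int m *\<^sub>R side_normal u b + k *\<^sub>R u" by (simp add: algebra_simps)
    then show ?thesis by blast
  qed
  then show "\<And>w. w \<in> int_points \<Longrightarrow> w \<in> span {u, b} \<Longrightarrow> \<exists>(m::int) k. w = of_int m *\<^sub>R side_normal u b + k *\<^sub>R u" by blast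
  obtain x y where xy: "x \<in> half_plane u b" "y \<in> span {u}" "side_normal u b = x + y"
    using side_normal unfolding is_primitive_normal_def span_span by blast
  obtain s t where st: "0 \<le> s" "x = s *\<^sub>R b + t *\<^sub>R u" using xy(1) unfolding mem_half_plane by metis
  obtain t' where "y = t' *\<^sub>R u" using xy(2) unfolding in_span1 by blast
  then have e: "side_normal u b = s *\<^sub>R b + (t + t') *\<^sub>R u" using xy(3) st by (simp add: algebra_simps)
  \<comment> \<open>Otherwise the normal would lie on the line of \<open>u\<close>, and so would
    \<open>b\<close>, which is a combination of the normal and \<open>u\<close>.\<close>
  have "s \<noteq> 0"
  proof
    assume s0: "s = 0"
    obtain m :: int and k where "b = of_int m *\<^sub>R side_normal u b + k *\<^sub>R u" using gen [of b] bS by blast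
    then have "b = (of_int m * (t + t') + k) *\<^sub>R u" using e s0 by (simp add: algebra_simps)
    then show False using ub not_indep2 [of u b] by blast
  qed
  then show "\<exists>s>0. \<exists>t. side_normal u b = s *\<^sub>R b + t *\<^sub>R u" using e st by (intro exI [of _ s]) auto
qed

lemma side_normal_indep: assumes "u \<in> int_points" "b \<in> int_points" "indep2 u b" shows "indep2 u (side_normal u b)"
proof -
  obtain s t where "0 < s" "side_normal u b = s *\<^sub>R b + t *\<^sub>R u" using side_normal_dir [OF assms] by blast
  then show ?thesis using indep2_combine [OF assms(3), of s t] by (simp add: add.commute)
qed

lemma side_normal_half_plane: assumes "u \<in> int_points" "b \<in> int_points" "indep2 u b"
  shows "half_plane u (side_normal u b) = half_plane u b" "side_normal u b \<in> half_plane u b"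
proof -
  obtain s t where st: "0 < s" "side_normal u b = s *\<^sub>R b + t *\<^sub>R u" using side_normal_dir [OF assms] by blast
  show "half_plane u (side_normal u b) = half_plane u b" unfolding st(2) by (rule half_plane_eq [OF st(1)])
  show "side_normal u b \<in> half_plane u b" unfolding mem_half_plane using st less_imp_le by metis
qed

lemma side_normal_pn: assumes "u \<in> int_points" "b \<in> int_points" "indep2 u b"
  shows "side_normal u (side_normal u b) = side_normal u b"
  unfolding side_normal_def [of u "side_normal u b"] side_normal_half_plane(1) [OF assms] by (simp add: side_normal_def)

text \<open>Both normals generate the lattice of the plane modulo the line of \<open>u\<close>, so
  they differ there by a unit \<open>m\<close> of the integers. Lying on opposite sides they force
  \<open>m = -1\<close>.\<close>

lemma side_normal_minus:
  assumes u: "u \<in> int_points" and b: "b \<in> int_points" and ub: "indep2 u b"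
  shows "side_normal u b + side_normal u (- b) \<in> span {u}"
proof -
  have b': "- b \<in> int_points" "indep2 u (- b)" using int_points_simps b indep2_combine [OF ub, of "-1" 0] by auto
  have sp: "span {u, - b} = span {u, b}"
  proof (rule span_indep2_eq [OF b'(2)])
    show "- b \<in> span {u, b}" by (intro span_neg span_base) auto
  qed (auto intro: span_base)
  have inS: "side_normal u b \<in> span {u, b}" "side_normal u (- b) \<in> span {u, b}"
    using side_normal_half_plane(2) [OF assms] side_normal_half_plane(2) [OF u b'] half_plane_span [of u b] half_plane_span [of u "-b"] sp
      span_base by blast+
  obtain m :: int and k where m: "side_normal u (- b) = of_int m *\<^sub>R side_normal u b + k *\<^sub>R u"
    using side_normal_gen [OF assms] side_normal_int [OF u b'] inS(2) by blast
  obtain m' :: int and k' where m': "side_normal u b = of_int m' *\<^sub>R side_normal u (- b) + k' *\<^sub>R u"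
    using side_normal_gen [OF u b'] side_normal_int [OF assms] inS(1) unfolding sp by blast
  obtain s t where st: "0 < s" "side_normal u b = s *\<^sub>R b + t *\<^sub>R u" using side_normal_dir [OF assms] by blast
  obtain s' t' where st': "0 < s'" "side_normal u (- b) = s' *\<^sub>R (- b) + t' *\<^sub>R u" using side_normal_dir [OF u b'] by blast
  have "t' *\<^sub>R u + (- s') *\<^sub>R b = (of_int m * t + k) *\<^sub>R u + (of_int m * s) *\<^sub>R b"
    using m unfolding st(2) st'(2) by (simp add: algebra_simps)
  then have ms: "of_int m * s = - s'" using indep2_unique [OF ub] by metis
  have "t *\<^sub>R u + s *\<^sub>R b = (of_int m' * t' + k') *\<^sub>R u + (- of_int m' * s') *\<^sub>R b"
    using m' unfolding st(2) st'(2) by (simp add: algebra_simps)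
  then have "- of_int m' * s' = s" using indep2_unique [OF ub] by metis
  then have "of_int m' * (of_int m * s) = s" unfolding ms by simp
  then have "(of_int m' * of_int m) * s = 1 * s" by (simp only: mult.assoc mult_1)
  then have "of_int m' * of_int m = (1::real)" using st(1) unfolding mult_cancel_right by simp
  then have "of_int (m' * m) = (1::real)" by simp
  then have "m' * m = 1" using of_int_eq_1_iff by blast
  moreover have "of_int m < (0::real)"
  proof (rule ccontr)
    assume "\<not> of_int m < (0::real)"
    then have "0 \<le> of_int m * s" using st(1) by simp
    then show False using ms st'(1) by simp
  qed
  then have "m < 0" by simp
  ultimately have "m = -1" unfolding zmult_eq_1_iff by auto
  then have "side_normal u b + side_normal u (- b) = k *\<^sub>R u" using m by simp
  then show ?thesis unfolding in_span1 by blast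
qed

text \<open>Relative to the face \<open>{0}\<close> nothing is divided out, so the primitive normal
  is the primitive lattice vector on the ray. This gives each rational ray a canonical
  generator.\<close>

lemma ray_generator:
  assumes a: "a \<in> int_points" "a \<noteq> 0"
  shows "primitive (primitive_normal (ray a) {0})" "ray (primitive_normal (ray a) {0}) = ray a"
proof -
  have aS: "a \<in> int_points \<inter> span {a}" using a by (auto intro: span_base)
  obtain v where v: "v \<in> int_points \<inter> span {a}" "0 < a \<bullet> v"
    "\<And>w. w \<in> int_points \<inter> span {a} \<Longrightarrow> \<exists>m::int. a \<bullet> (w - of_int m *\<^sub>R v) = 0"
    using lattice_generator [OF a(1) subspace_span aS] a by auto
  have ker: "x = 0" if "x \<in> span {a}" "a \<bullet> x = 0" for x using that a unfolding in_span1 by auto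
  have "is_primitive_normal (ray a) {0} v" unfolding is_primitive_normal_def span_ray
  proof (intro conjI ballI)
    show "v \<in> int_points \<inter> span {a}" by fact
    fix w assume w: "w \<in> int_points \<inter> span {a}"
    then obtain m :: int where m: "a \<bullet> (w - of_int m *\<^sub>R v) = 0" using v(3) by blast
    have "w - of_int m *\<^sub>R v \<in> span {a}" using w v(1) by (intro span_diff span_scale) auto
    then show "\<exists>m::int. w - of_int m *\<^sub>R v \<in> span {0}" using ker [OF _ m] by (intro exI [of _ m]) (simp add: span_zero)
  next
    obtain t where t: "v = t *\<^sub>R a" using IntD2 [OF v(1)] unfolding in_span1 by blast
    then have "0 < t" using v(2) inner_ge_zero [of a] by (simp add: zero_less_mult_iff)
    then have "v \<in> ray a" unfolding mem_ray using t less_imp_le by metis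
    moreover have "0 \<in> span {0::real^'n}" "v = v + 0" by (auto simp: span_zero)
    ultimately show "\<exists>s\<in>ray a. \<exists>t\<in>span {0}. v = s + t" by blast
  qed
  then have side_normal: "is_primitive_normal (ray a) {0} (primitive_normal (ray a) {0})"
    unfolding primitive_normal_def by (rule someI)
  let ?u = "primitive_normal (ray a) {0}"
  have z: "span {0::real^'n} = {0}" by simp
  have u: "?u \<in> int_points" "?u \<in> ray a" "\<And>w. w \<in> int_points \<Longrightarrow> w \<in> span {a} \<Longrightarrow> \<exists>m::int. w = of_int m *\<^sub>R ?u"
    using side_normal unfolding is_primitive_normal_def span_ray z by auto
  obtain t where t: "0 \<le> t" "?u = t *\<^sub>R a" using u(2) unfolding mem_ray by metis
  obtain m :: int where m: "a = of_int m *\<^sub>R ?u" using u(3) aS by blast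
  then have ne: "?u \<noteq> 0" using a(2) by auto
  then have "0 < t" using t by (cases "t = 0") auto
  then show r: "ray ?u = ray a" using t ray_scale by metis
  have "span {?u} = span {a}" using span_ray r by metis
  then show "primitive ?u" unfolding primitive_def using u ne by auto
qed

text \<open>Two primitive vectors on one ray are integral multiples of each other; the factors have
  product 1 and are positive.\<close>

lemma primitive_generator:
  assumes "primitive u" shows "primitive_normal (ray u) {0} = u"
proof -
  let ?v = "primitive_normal (ray u) {0}"
  have u: "u \<in> int_points" "u \<noteq> 0" using assms unfolding primitive_def by auto
  have v: "primitive ?v" "ray ?v = ray u" using ray_generator [OF u] .
  obtain c where c: "0 < c" "?v = c *\<^sub>R u" using ray_eqD [of u ?v] v(2) u(2) by auto
  have "?v \<in> span {u}" using c unfolding in_span1 by blast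
  then obtain m :: int where m: "?v = of_int m *\<^sub>R u" using assms v(1) unfolding primitive_def by blast
  have "u = (1/c) *\<^sub>R ?v" using c by simp
  then have "u \<in> span {?v}" unfolding in_span1 by blast
  then obtain m' :: int where m': "u = of_int m' *\<^sub>R ?v" using v(1) u(1) unfolding primitive_def by blast
  have "(of_int m' * of_int m) *\<^sub>R u = 1 *\<^sub>R u" using m m' by (metis scaleR_one scaleR_scaleR)
  then have "of_int m' * of_int m = (1::real)" using u(2) unfolding scaleR_cancel_right by blast
  then have "of_int (m' * m) = (1::real)" by simp
  then have "m' * m = 1" using of_int_eq_1_iff by blast
  moreover have "(of_int m :: real) *\<^sub>R u = c *\<^sub>R u" by (metis m c(2))
  then have "of_int m = c" using u(2) unfolding scaleR_cancel_right by blast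
  then have "0 < m" using c(1) of_int_0_less_iff [where 'a = real] by simp
  ultimately have "m = 1" unfolding zmult_eq_1_iff by auto
  then show ?thesis using m by simp
qed

section \<open>Local multiplicities\<close>

text \<open>\<open>normals\<close> and \<open>germ_mult\<close> refer to a fan only through its germ weights \<open>g\<close>. The fixed points \<open>v\<close>
  of \<open>side_normal u\<close> are the primitive normals at \<open>u\<close>, one for each half-plane bounded by the line of \<open>u\<close>.\<close>

definition normals :: "(real ^ 'n \<Rightarrow> real ^ 'n \<Rightarrow> real) \<Rightarrow> real ^ 'n \<Rightarrow> (real ^ 'n) set" where
  "normals g u = {v. g u v \<noteq> 0 \<and> side_normal u v = v}"

definition germ_normal_sum :: "(real ^ 'n \<Rightarrow> real ^ 'n \<Rightarrow> real) \<Rightarrow> real ^ 'n \<Rightarrow> real ^ 'n" where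
  "germ_normal_sum g u = (\<Sum>v\<in>normals g u. g u v *\<^sub>R v)"

text \<open>The one-sided derivative stands in for the linear extension of \<open>T\<close> on a
  cone (\<open>dir_deriv_linear_ext\<close>) without reference to that cone, so that multiplicities
  can be written in terms of germs.\<close>

definition dir_deriv :: "('a::real_vector \<Rightarrow> real) \<Rightarrow> 'a \<Rightarrow> 'a \<Rightarrow> real" where
  "dir_deriv T u v = Lim (at_right 0) (\<lambda>e. (T (u + e *\<^sub>R v) - T u) / e)"

definition germ_mult :: "(real ^ 'n \<Rightarrow> real) \<Rightarrow> (real ^ 'n \<Rightarrow> real ^ 'n \<Rightarrow> real) \<Rightarrow> real ^ 'n \<Rightarrow> real" where
  "germ_mult T g u = (\<Sum>v\<in>normals g u. g u v * dir_deriv T u v) - dir_deriv T u (germ_normal_sum g u)"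

lemma linear_ext:
  assumes "linear_on_cone T \<sigma>"
  shows linear_linear_ext: "linear (linear_ext T \<sigma>)" and linear_ext_eq: "\<And>x. x \<in> \<sigma> \<Longrightarrow> linear_ext T \<sigma> x = T x"
proof -
  have "linear (linear_ext T \<sigma>) \<and> (\<forall>x\<in>\<sigma>. linear_ext T \<sigma> x = T x)"
    using assms unfolding linear_on_cone_def linear_ext_def by (rule someI_ex)
  then show "linear (linear_ext T \<sigma>)" "\<And>x. x \<in> \<sigma> \<Longrightarrow> linear_ext T \<sigma> x = T x" by auto
qed

lemma dir_deriv_linear_ext:
  assumes T: "linear_on_cone T \<sigma>" and "convex \<sigma>" "germ \<sigma> u v"
  shows "dir_deriv T u v = linear_ext T \<sigma> v"
proof -
  obtain e where e: "0 < e" "\<And>s. 0 \<le> s \<Longrightarrow> s \<le> e \<Longrightarrow> u + s *\<^sub>R v \<in> \<sigma>" using germE assms(2,3) by blast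
  have "(T (u + s *\<^sub>R v) - T u) / s = linear_ext T \<sigma> v" if "0 < s" "s < e" for s
  proof -
    have "T (u + s *\<^sub>R v) = linear_ext T \<sigma> (u + s *\<^sub>R v)" using linear_ext_eq [OF T] e(2) [of s] that by simp
    also have "\<dots> = linear_ext T \<sigma> u + s * linear_ext T \<sigma> v"
      using linear_linear_ext [OF T] by (simp add: linear_add linear_scale)
    also have "linear_ext T \<sigma> u = T u" using linear_ext_eq [OF T] e(2) [of 0] e(1) by simp
    finally show ?thesis using that by simp
  qed
  then have "\<forall>\<^sub>F s in at_right 0. (T (u + s *\<^sub>R v) - T u) / s = linear_ext T \<sigma> v"
    unfolding eventually_at_right_field using e(1) by blast
  then have "((\<lambda>s. (T (u + s *\<^sub>R v) - T u) / s) \<longlongrightarrow> linear_ext T \<sigma> v) (at_right 0)"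
    by (rule tendsto_eventually)
  then show ?thesis unfolding dir_deriv_def by (intro tendsto_Lim) auto
qed

lemma dir_deriv_zero: "dir_deriv T u 0 = 0"
  unfolding dir_deriv_def by (intro tendsto_Lim) auto

section \<open>Multiplicities at rays and at interior points of cones\<close>

lemma facet_cofaces_ray:
  assumes F: "surface_fan F" "ray u \<in> F" and u: "u \<noteq> 0"
  shows "facet_cofaces F (ray u) = {\<sigma>\<in>F. dim \<sigma> = 2 \<and> u \<in> \<sigma>}"
proof -
  have "ray u face_of \<sigma>" if "\<sigma> \<in> F" "u \<in> \<sigma>" for \<sigma>
  proof -
    have "ray u \<subseteq> \<sigma>" using convex_cone_scaleR [OF surface_fan_convex_cone [OF F(1) that(1)]] that(2)
      unfolding ray_def by auto
    then have "\<sigma> \<inter> ray u = ray u" by blast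
    then show ?thesis using surface_fan_Int [OF F(1) that(1) F(2)] by simp
  qed
  moreover have "u \<in> \<sigma>" if "ray u face_of \<sigma>" for \<sigma>
    using face_of_imp_subset [OF that] ray_self by blast
  ultimately show ?thesis unfolding facet_cofaces_def dim_ray [OF u] by auto
qed

text \<open>By the list of faces of a planar cone, \<open>ray u\<close> is one of its two edges, and
  the generator of that edge can be rescaled to \<open>u\<close> itself.\<close>

lemma facet_coface_form:
  assumes F: "surface_fan F" "ray u \<in> F" and u: "u \<noteq> 0" and \<sigma>: "\<sigma> \<in> facet_cofaces F (ray u)"
  obtains b where "b \<in> int_points" "indep2 u b" "\<sigma> = cone2 u b" "ray b \<in> F"
proof -
  have sig: "\<sigma> \<in> F" "dim \<sigma> = 2" "ray u face_of \<sigma>"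
    using \<sigma> dim_ray [OF u] unfolding facet_cofaces_def by auto
  then obtain a b where ab: "a \<in> int_points" "b \<in> int_points" "indep2 a b" "\<sigma> = cone2 a b"
    using flat_cone_dim2 surface_fan_flat [OF F(1)] by metis
  have "ray u \<noteq> {}" using ray_self by blast
  then have cases: "ray u = {0} \<or> ray u = ray a \<or> ray u = ray b \<or> ray u = cone2 a b"
    using faces_of_cone2 sig(3) ab(4) by blast
  have "ray u \<noteq> {0}" using ray_self [of u] u by (metis singletonD)
  moreover have "ray u \<noteq> cone2 a b" using dim_ray [OF u] dim_cone2 [OF ab(3)] by (metis one_eq_numeral_iff num.distinct(1))
  ultimately have "ray u = ray a \<or> ray u = ray b" using cases by blast
  then obtain a' b' where ab': "b' \<in> int_points" "indep2 a' b'" "\<sigma> = cone2 a' b'" "ray u = ray a'"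
    using ab indep2_commute [of a b] cone2_commute [of a b] by metis
  show thesis
  proof (rule that)
    show "b' \<in> int_points" by fact
    obtain c where "0 < c" "u = c *\<^sub>R a'" using ray_eqD [of a' u] ab'(4) indep2_nonzero [OF ab'(2)] by metis
    then show "indep2 u b'" using indep2_scale [OF ab'(2), of c] by simp
    show "\<sigma> = cone2 u b'" unfolding ab'(3) cone2_rays ab'(4) ..
    have "ray b' face_of cone2 a' b'"
      using ray_face_of_cone2 [of b' a'] ab'(2) indep2_commute [of a' b'] cone2_commute [of a' b'] by simp
    then show "ray b' \<in> F" using surface_fan_face [OF F(1) sig(1)] ab'(3) ray_self by blast
  qed
qed

context
  fixes W :: "'n::finite weighted_fan" and u :: "real ^ 'n"
  assumes W: "weighted_surface W" and u: "u \<in> int_points" "u \<noteq> 0"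
begin

lemma weighted_surface_fan: "surface_fan (fst W)"
  using W unfolding weighted_surface_def by blast

lemma coface_normal:
  assumes r: "ray u \<in> fst W" and \<sigma>: "\<sigma> \<in> facet_cofaces (fst W) (ray u)"
  shows "germ \<sigma> u (primitive_normal \<sigma> (ray u))" "indep2 u (primitive_normal \<sigma> (ray u))"
    "germ_weight W u (primitive_normal \<sigma> (ray u)) = snd W \<sigma>" "0 < snd W \<sigma>"
    "primitive_normal \<sigma> (ray u) \<in> normals (germ_weight W) u"
proof -
  obtain b where b: "b \<in> int_points" "indep2 u b" "\<sigma> = cone2 u b"
    using facet_coface_form [OF weighted_surface_fan r u(2) \<sigma>] by metis
  have s: "\<sigma> \<in> fst W" "dim \<sigma> = 2" using \<sigma> unfolding facet_cofaces_ray [OF weighted_surface_fan r u(2)] by auto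
  have v: "primitive_normal \<sigma> (ray u) = side_normal u b" unfolding b(3) by (rule primitive_normal_cone2)
  show 1: "germ \<sigma> u (primitive_normal \<sigma> (ray u))"
    unfolding v unfolding b(3) germ_cone2_half_plane [OF b(2)] by (rule side_normal_half_plane(2) [OF u(1) b(1,2)])
  show 2: "indep2 u (primitive_normal \<sigma> (ray u))" unfolding v by (rule side_normal_indep [OF u(1) b(1,2)])
  show 3: "germ_weight W u (primitive_normal \<sigma> (ray u)) = snd W \<sigma>" by (rule germ_weight_eq [OF weighted_surface_fan s(1) 2 1])
  show 4: "0 < snd W \<sigma>" using W s unfolding weighted_surface_def by blast
  show "primitive_normal \<sigma> (ray u) \<in> normals (germ_weight W) u"
    unfolding normals_def mem_Collect_eq 3 using 4 side_normal_pn [OF u(1) b(1,2)] v by simp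
qed

text \<open>Turns the sums over cofaces in the definition of the product into sums over germs. A
  cone is recovered from its normal because the germ in this direction lies in a single cone;
  conversely, a normal of non-zero weight lies in the half-plane of the cone that has its
  germ.\<close>

lemma coface_bij:
  assumes r: "ray u \<in> fst W"
  shows "bij_betw (\<lambda>\<sigma>. primitive_normal \<sigma> (ray u)) (facet_cofaces (fst W) (ray u)) (normals (germ_weight W) u)"
proof (rule bij_betw_imageI)
  show "inj_on (\<lambda>\<sigma>. primitive_normal \<sigma> (ray u)) (facet_cofaces (fst W) (ray u))"
  proof (rule inj_onI)
    fix \<sigma> \<sigma>' assume s: "\<sigma> \<in> facet_cofaces (fst W) (ray u)" "\<sigma>' \<in> facet_cofaces (fst W) (ray u)"
      and e: "primitive_normal \<sigma> (ray u) = primitive_normal \<sigma>' (ray u)"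
    have m: "\<sigma> \<in> fst W" "\<sigma>' \<in> fst W" using s unfolding facet_cofaces_def by auto
    show "\<sigma> = \<sigma>'"
      by (rule surface_fan_germ_unique [OF weighted_surface_fan m coface_normal(2) [OF r s(1)] coface_normal(1) [OF r s(1)]])
        (simp add: e coface_normal(1) [OF r s(2)])
  qed
  show "(\<lambda>\<sigma>. primitive_normal \<sigma> (ray u)) ` facet_cofaces (fst W) (ray u) = normals (germ_weight W) u"
  proof (intro subset_antisym subsetI)
    fix v assume "v \<in> (\<lambda>\<sigma>. primitive_normal \<sigma> (ray u)) ` facet_cofaces (fst W) (ray u)"
    then show "v \<in> normals (germ_weight W) u" using coface_normal(5) [OF r] by blast
  next
    fix v assume v: "v \<in> normals (germ_weight W) u"
    then have "germ_weight W u v \<noteq> 0" "side_normal u v = v" unfolding normals_def by auto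
    then obtain \<sigma> where \<sigma>: "indep2 u v" "\<sigma> \<in> fst W" "dim \<sigma> = 2" "germ \<sigma> u v" using germ_weight_nonzeroE by metis
    then have s: "\<sigma> \<in> facet_cofaces (fst W) (ray u)"
      unfolding facet_cofaces_ray [OF weighted_surface_fan r u(2)] germ_def by blast
    obtain b where b: "b \<in> int_points" "indep2 u b" "\<sigma> = cone2 u b"
      using facet_coface_form [OF weighted_surface_fan r u(2) s] by metis
    have "v \<in> half_plane u b" using \<sigma>(4) unfolding b(3) germ_cone2_half_plane [OF b(2)] .
    then obtain p q where pq: "0 \<le> p" "v = p *\<^sub>R b + q *\<^sub>R u" unfolding mem_half_plane by metis
    have "p \<noteq> 0" using pq \<sigma>(1) not_indep2 [of u v] by auto
    then have "half_plane u v = half_plane u b" unfolding pq(2) using pq(1) by (intro half_plane_eq) simp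
    then have "primitive_normal \<sigma> (ray u) = side_normal u v" unfolding b(3) primitive_normal_cone2 side_normal_def by simp
    then show "v \<in> (\<lambda>\<sigma>. primitive_normal \<sigma> (ray u)) ` facet_cofaces (fst W) (ray u)"
      using s \<open>side_normal u v = v\<close> by (metis imageI)
  qed
qed

lemma coface_sum:
  assumes r: "ray u \<in> fst W"
  shows "(\<Sum>v\<in>normals (germ_weight W) u. f (germ_weight W u v) v)
    = (\<Sum>\<sigma>\<in>facet_cofaces (fst W) (ray u). f (snd W \<sigma>) (primitive_normal \<sigma> (ray u)))"
proof -
  have "(\<Sum>\<sigma>\<in>facet_cofaces (fst W) (ray u). f (snd W \<sigma>) (primitive_normal \<sigma> (ray u)))
     = (\<Sum>\<sigma>\<in>facet_cofaces (fst W) (ray u).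
         f (germ_weight W u (primitive_normal \<sigma> (ray u))) (primitive_normal \<sigma> (ray u)))"
    using coface_normal(3) [OF r] by (intro sum.cong) auto
  also have "\<dots> = (\<Sum>v\<in>normals (germ_weight W) u. f (germ_weight W u v) v)"
    using sum.reindex_bij_betw [OF coface_bij [OF r], of "\<lambda>v. f (germ_weight W u v) v"] by simp
  finally show ?thesis by simp
qed

lemma germ_normal_sum_ray: "ray u \<in> fst W \<Longrightarrow> weighted_normal_sum W (ray u) = germ_normal_sum (germ_weight W) u"
  unfolding weighted_normal_sum_def germ_normal_sum_def using coface_sum [of "\<lambda>c v. c *\<^sub>R v"] by simp

text \<open>Balancing places the normal sum on the line of \<open>u\<close>, so not only the terms
  of the sum but also the correction term is a directional derivative at \<open>u\<close>.\<close>

lemma product_weight_ray: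
  assumes r: "ray u \<in> fst W" and T: "\<And>\<sigma>. \<sigma> \<in> fst W \<Longrightarrow> linear_on_cone T \<sigma>"
    and bal: "germ_normal_sum (germ_weight W) u \<in> span {u}"
  shows "product_weight T W (ray u) = germ_mult T (germ_weight W) u"
proof -
  have 1: "linear_ext T \<sigma> (primitive_normal \<sigma> (ray u)) = dir_deriv T u (primitive_normal \<sigma> (ray u))"
    if s: "\<sigma> \<in> facet_cofaces (fst W) (ray u)" for \<sigma>
  proof -
    have "\<sigma> \<in> fst W" using s unfolding facet_cofaces_def by blast
    then show ?thesis
      using dir_deriv_linear_ext [OF T surface_fan_convex [OF weighted_surface_fan] coface_normal(1) [OF r s]] by simp
  qed
  have g: "germ (ray u) u (germ_normal_sum (germ_weight W) u)"
  proof -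
    obtain c where c: "germ_normal_sum (germ_weight W) u = c *\<^sub>R u" using bal unfolding in_span1 by blast
    \<comment> \<open>The normal sum may be a negative multiple of \<open>u\<close>; a short step in
      its direction still ends on the ray.\<close>
    define e where "e = 1 / (1 + \<bar>c\<bar>)"
    have e: "0 < e" unfolding e_def by (simp add: add_pos_nonneg)
    have "e * \<bar>c\<bar> \<le> 1" unfolding e_def by simp
    moreover have "\<bar>e * c\<bar> = e * \<bar>c\<bar>" using e by (simp add: abs_mult)
    ultimately have "0 \<le> 1 + e * c" by linarith
    moreover have "u + e *\<^sub>R c *\<^sub>R u = (1 + e * c) *\<^sub>R u" by (simp add: algebra_simps)
    ultimately have "u + e *\<^sub>R c *\<^sub>R u \<in> ray u" unfolding mem_ray by blast
    then show ?thesis using e unfolding germ_def c by auto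
  qed
  have 2: "linear_ext T (ray u) (germ_normal_sum (germ_weight W) u) = dir_deriv T u (germ_normal_sum (germ_weight W) u)"
    using dir_deriv_linear_ext [OF T [OF r] convex_cone_imp_convex [OF convex_cone_ray] g] by simp
  have "(\<Sum>\<sigma>\<in>facet_cofaces (fst W) (ray u). snd W \<sigma> * linear_ext T \<sigma> (primitive_normal \<sigma> (ray u)))
     = (\<Sum>\<sigma>\<in>facet_cofaces (fst W) (ray u). snd W \<sigma> * dir_deriv T u (primitive_normal \<sigma> (ray u)))"
    using 1 by (intro sum.cong) auto
  also have "\<dots> = (\<Sum>v\<in>normals (germ_weight W) u. germ_weight W u v * dir_deriv T u v)"
    using coface_sum [OF r, of "\<lambda>c v. c * dir_deriv T u v"] by simp
  finally show ?thesis unfolding product_weight_def germ_mult_def germ_normal_sum_ray [OF r] 2 by simp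
qed

text \<open>An interior point behaves like a ray of valence two: the cone is the only one there and
  has all germs of its plane, and these form one half-plane on the side of \<open>b\<close> and one
  on the side of \<open>- b\<close>, with equal weights.\<close>

lemma interior_normals:
  assumes c: "cone2 a b \<in> fst W" "a \<in> int_points" "b \<in> int_points" "indep2 a b"
    and st: "0 < s" "0 < t" "u = s *\<^sub>R a + t *\<^sub>R b"
  shows "indep2 u b" "normals (germ_weight W) u = {side_normal u b, side_normal u (- b)}" "side_normal u b \<noteq> side_normal u (- b)"
    "side_normal u b \<in> span {a, b}" "side_normal u (- b) \<in> span {a, b}"
    "germ_weight W u (side_normal u b) = snd W (cone2 a b)" "germ_weight W u (side_normal u (- b)) = snd W (cone2 a b)"
    "span {u, b} = span {a, b}"
proof -
  show ub: "indep2 u b"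
    using indep2_combine [of b a s t] c(4) st indep2_commute by (metis add.commute less_irrefl)
  have uS: "u \<in> span {a, b}" unfolding in_span2 using st by blast
  show sp: "span {u, b} = span {a, b}" using uS by (intro span_indep2_eq [OF ub]) (auto intro: span_base)
  have mb: "- b \<in> int_points" "indep2 u (- b)" using int_points_simps c(3) indep2_combine [OF ub, of "-1" 0] by auto
  note p = side_normal_half_plane(2) [OF u(1) c(3) ub] and p' = side_normal_half_plane(2) [OF u(1) mb]
  have hs: "x \<in> span {a, b}" if "x \<in> half_plane u b \<or> x \<in> half_plane u (- b)" for x
  proof -
    have "half_plane u (- b) \<subseteq> span {u, - b}" "half_plane u b \<subseteq> span {u, b}"
      using half_plane_span span_superset by metis+
    moreover have "span {u, - b} = span {a, b}"
      using uS by (intro span_indep2_eq [OF mb(2)]) (auto intro: span_base span_neg)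
    ultimately show ?thesis using that sp by blast
  qed
  show i: "side_normal u b \<in> span {a, b}" "side_normal u (- b) \<in> span {a, b}" using hs p p' by blast+
  have g: "germ (cone2 a b) u v" if "v \<in> span {a, b}" for v
    using germ_interior [OF st(1,2), of a b v] that st(3) by simp
  show w: "germ_weight W u (side_normal u b) = snd W (cone2 a b)" "germ_weight W u (side_normal u (- b)) = snd W (cone2 a b)"
    using germ_weight_eq [OF weighted_surface_fan c(1) _ g] side_normal_indep [OF u(1) c(3) ub] side_normal_indep [OF u(1) mb] i by blast+
  have pos: "0 < snd W (cone2 a b)" using W c(1) dim_cone2 [OF c(4)] unfolding weighted_surface_def by blast
  show "side_normal u b \<noteq> side_normal u (- b)"
  proof
    assume e: "side_normal u b = side_normal u (- b)"
    obtain k where "side_normal u b + side_normal u (- b) = k *\<^sub>R u" using side_normal_minus [OF u(1) c(3) ub] unfolding in_span1 by blast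
    then have "2 *\<^sub>R side_normal u b = k *\<^sub>R u" using e by (simp add: scaleR_2)
    then have "(1/2) *\<^sub>R (2 *\<^sub>R side_normal u b) = (1/2) *\<^sub>R (k *\<^sub>R u)" by simp
    then have "side_normal u b = (k/2) *\<^sub>R u" by simp
    then show False using side_normal_indep [OF u(1) c(3) ub] not_indep2 by blast
  qed
  show "normals (germ_weight W) u = {side_normal u b, side_normal u (- b)}"
  proof (intro subset_antisym subsetI)
    fix v assume "v \<in> {side_normal u b, side_normal u (- b)}"
    then show "v \<in> normals (germ_weight W) u"
      unfolding normals_def using w pos side_normal_pn [OF u(1) c(3) ub] side_normal_pn [OF u(1) mb] by auto
  next
    fix v assume "v \<in> normals (germ_weight W) u"
    then have v: "germ_weight W u v \<noteq> 0" "side_normal u v = v" unfolding normals_def by auto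
    then obtain \<sigma> where \<sigma>: "indep2 u v" "\<sigma> \<in> fst W" "germ \<sigma> u v" using germ_weight_nonzeroE by metis
    then have "\<sigma> = cone2 a b"
      using surface_fan_interior_unique [OF weighted_surface_fan c(1) \<sigma>(2) st(1,2) c(4)] st(3) unfolding germ_def by simp
    then have "v \<in> span {u, b}" using \<sigma>(3) germ_interior [OF st(1,2), of a b v] st(3) sp by simp
    then obtain p q where pq: "v = p *\<^sub>R u + q *\<^sub>R b" unfolding in_span2 by blast
    have "q \<noteq> 0" using pq \<sigma>(1) not_indep2 [of u v] by auto
    then consider "0 < q" | "0 < - q" by linarith
    then show "v \<in> {side_normal u b, side_normal u (- b)}"
    proof cases
      case 1
      have "half_plane u v = half_plane u b" unfolding pq using half_plane_eq [OF 1] by (simp add: add.commute)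
      then show ?thesis using v(2) unfolding side_normal_def by simp
    next
      case 2
      have "half_plane u v = half_plane u (- b)"
        unfolding pq using half_plane_eq [OF 2, of u "- b" p] by (simp add: add.commute)
      then show ?thesis using v(2) unfolding side_normal_def by simp
    qed
  qed
qed

lemma germ_normal_sum_interior:
  assumes c: "cone2 a b \<in> fst W" "a \<in> int_points" "b \<in> int_points" "indep2 a b"
    and st: "0 < s" "0 < t" "u = s *\<^sub>R a + t *\<^sub>R b"
  shows "germ_normal_sum (germ_weight W) u \<in> span {u}"
proof -
  note i = interior_normals [OF c st]
  have "germ_normal_sum (germ_weight W) u = snd W (cone2 a b) *\<^sub>R (side_normal u b + side_normal u (- b))"
    unfolding germ_normal_sum_def i(2) using i(3,6,7) by (simp add: scaleR_right_distrib)
  then show ?thesis using side_normal_minus [OF u(1) c(3) i(1)] span_scale by metis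
qed

text \<open>Near \<open>u\<close> the fan is a plane on which \<open>T\<close> is linear, so the
  derivative of the normal sum cancels the sum of the derivatives.\<close>

lemma germ_mult_interior:
  assumes c: "cone2 a b \<in> fst W" "a \<in> int_points" "b \<in> int_points" "indep2 a b"
    and st: "0 < s" "0 < t" "u = s *\<^sub>R a + t *\<^sub>R b" and T: "linear_on_cone T (cone2 a b)"
  shows "germ_mult T (germ_weight W) u = 0"
proof -
  note i = interior_normals [OF c st]
  have d: "dir_deriv T u v = linear_ext T (cone2 a b) v" if "v \<in> span {a, b}" for v
    using dir_deriv_linear_ext [OF T convex_cone_imp_convex [OF convex_cone_cone2]] germ_interior [OF st(1,2), of a b v] st(3) that by simp
  have n: "germ_normal_sum (germ_weight W) u = snd W (cone2 a b) *\<^sub>R side_normal u b + snd W (cone2 a b) *\<^sub>R side_normal u (- b)"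
    unfolding germ_normal_sum_def i(2) using i(3,6,7) by simp
  have "germ_normal_sum (germ_weight W) u \<in> span {a, b}" unfolding n using i(4,5) by (intro span_add span_scale)
  then have "dir_deriv T u (germ_normal_sum (germ_weight W) u) =
      snd W (cone2 a b) * dir_deriv T u (side_normal u b) + snd W (cone2 a b) * dir_deriv T u (side_normal u (- b))"
    using d i(4,5) linear_linear_ext [OF T] unfolding n by (simp add: linear_add linear_scale)
  moreover have "(\<Sum>v\<in>normals (germ_weight W) u. germ_weight W u v * dir_deriv T u v)
     = snd W (cone2 a b) * dir_deriv T u (side_normal u b) + snd W (cone2 a b) * dir_deriv T u (side_normal u (- b))"
    unfolding i(2) using i(3,6,7) by simp
  ultimately show ?thesis unfolding germ_mult_def by simp
qed

lemma normals_outside: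
  assumes "\<And>\<sigma>. \<sigma> \<in> fst W \<Longrightarrow> u \<notin> \<sigma>" shows "normals (germ_weight W) u = {}"
proof -
  have "germ_weight W u v = 0" for v
    using germ_weight_nonzeroE [of W u v] assms unfolding germ_def by metis
  then show ?thesis unfolding normals_def by simp
qed

text \<open>Although \<open>germ_mult\<close> is defined at every point, it is supported on the rays
  of any fan on whose cones \<open>T\<close> is linear; this makes sums of multiplicities
  finite.\<close>

lemma germ_mult_nonzero_ray:
  assumes T: "\<And>\<sigma>. \<sigma> \<in> fst W \<Longrightarrow> linear_on_cone T \<sigma>" and "germ_mult T (germ_weight W) u \<noteq> 0"
  shows "ray u \<in> fst W"
proof (rule surface_fan_point_cases [OF weighted_surface_fan u(2)])
  fix a b s t assume c: "cone2 a b \<in> fst W" "a \<in> int_points" "b \<in> int_points" "indep2 a b"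
    "0 < s" "0 < t" "u = s *\<^sub>R a + t *\<^sub>R b"
  then show ?thesis using germ_mult_interior [OF c T] assms(2) by blast
next
  assume "\<And>\<sigma>. \<sigma> \<in> fst W \<Longrightarrow> u \<notin> \<sigma>"
  then have "normals (germ_weight W) u = {}" by (rule normals_outside)
  then have "germ_mult T (germ_weight W) u = 0" unfolding germ_mult_def germ_normal_sum_def by (simp add: dir_deriv_zero)
  then show ?thesis using assms(2) by blast
qed

end

section \<open>Balancing in terms of germs\<close>

lemma tropical_weighted_surface: "tropical_fan 2 W \<Longrightarrow> weighted_surface W"
  unfolding tropical_fan_2 by blast

lemma tropical_surface_fan: "tropical_fan 2 W \<Longrightarrow> surface_fan (fst W)"
  using tropical_weighted_surface weighted_surface_def by blast

text \<open>Balancing at all integral vectors instead of the rays of \<open>W\<close> only: inside a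
  cone the two opposite normals cancel, outside the support there are none. In this form it depends
  on the germ weights alone.\<close>

lemma tropical_normal_sum:
  assumes W: "tropical_fan 2 W" and u: "u \<in> int_points" "u \<noteq> 0"
  shows "germ_normal_sum (germ_weight W) u \<in> span {u}"
proof -
  note ws = tropical_weighted_surface [OF W]
  show ?thesis
  proof (rule surface_fan_point_cases [OF tropical_surface_fan [OF W] u(2)])
    assume r: "ray u \<in> fst W"
    then have "weighted_normal_sum W (ray u) \<in> span (ray u)" using W dim_ray [OF u(2)] unfolding tropical_fan_2 by blast
    then show ?thesis unfolding germ_normal_sum_ray [OF ws u r] span_ray .
  next
    fix a b s t assume c: "cone2 a b \<in> fst W" "a \<in> int_points" "b \<in> int_points" "indep2 a b"
      "0 < s" "0 < t" "u = s *\<^sub>R a + t *\<^sub>R b"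
    then show ?thesis by (rule germ_normal_sum_interior [OF ws u])
  next
    assume "\<And>\<sigma>. \<sigma> \<in> fst W \<Longrightarrow> u \<notin> \<sigma>"
    then have "normals (germ_weight W) u = {}" by (rule normals_outside [OF ws u])
    then show ?thesis unfolding germ_normal_sum_def by (simp add: span_zero)
  qed
qed

text \<open>The converse direction, by which a refined fan inherits balancing from a fan with the
  same germ weights.\<close>

lemma tropical_fan_2I:
  assumes W: "weighted_surface W" and bal: "\<And>u. u \<in> int_points \<Longrightarrow> u \<noteq> 0 \<Longrightarrow> germ_normal_sum (germ_weight W) u \<in> span {u}"
  shows "tropical_fan 2 W"
  unfolding tropical_fan_2
proof (intro conjI ballI impI)
  fix \<tau> assume t: "\<tau> \<in> fst W" "dim \<tau> = 1"
  have "surface_fan (fst W)" using W unfolding weighted_surface_def by blast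
  then obtain u where u: "u \<in> int_points" "u \<noteq> 0" "\<tau> = ray u" using flat_cone_dim1 surface_fan_flat t by metis
  show "weighted_normal_sum W \<tau> \<in> span \<tau>"
    using germ_normal_sum_ray [OF W u(1,2)] bal [OF u(1,2)] t unfolding u(3) span_ray by simp
qed (rule W)

section \<open>Cutting a fan along a hyperplane\<close>

text \<open>The hyperplane is listed as well, so that the family is closed under intersection, as
  the pieces of a fan have to be.\<close>

definition halves :: "real ^ 'n \<Rightarrow> (real ^ 'n) set set" where
  "halves l = {{x. 0 \<le> l \<bullet> x}, {x. l \<bullet> x \<le> 0}, {x. l \<bullet> x = 0}}"

definition cut_fan :: "real ^ 'n \<Rightarrow> (real ^ 'n) set set \<Rightarrow> (real ^ 'n) set set" where
  "cut_fan l F = (\<Union>\<sigma>\<in>F. (\<lambda>A. \<sigma> \<inter> A) ` halves l)"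

text \<open>A two-dimensional piece lies in exactly one two-dimensional cone
  (\<open>cut_weight\<close>), so the sum has one term and names the inherited weight without a
  choice.\<close>

definition cut :: "real ^ 'n \<Rightarrow> 'n::finite weighted_fan \<Rightarrow> 'n weighted_fan" where
  "cut l W = (cut_fan l (fst W), \<lambda>\<sigma>. if \<sigma> \<in> cut_fan l (fst W) \<and> dim \<sigma> = 2
     then sum (snd W) {\<rho>\<in>fst W. dim \<rho> = 2 \<and> \<sigma> \<subseteq> \<rho>} else 0)"

lemma mem_cut_fan: "\<rho> \<in> cut_fan l F \<longleftrightarrow> (\<exists>\<sigma>\<in>F. \<exists>A\<in>halves l. \<rho> = \<sigma> \<inter> A)"
  unfolding cut_fan_def by blast

lemma cut_fanI: "\<tau> \<in> F \<Longrightarrow> A \<in> halves l \<Longrightarrow> \<tau> \<subseteq> A \<Longrightarrow> \<tau> \<in> cut_fan l F"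
  unfolding mem_cut_fan by (metis Int_absorb2)

lemma zero_face_of_flat_cone: assumes "flat_cone \<sigma>" shows "{0} face_of \<sigma>"
  using assms unfolding flat_cone_def
proof (elim disjE bexE conjE)
  fix a b assume "indep2 a b" "\<sigma> = cone2 a b"
  then show ?thesis using face_of_trans [OF zero_face_of_ray ray_face_of_cone2] by blast
qed (auto simp: zero_face_of_ray face_of_refl_eq)

text \<open>\<open>c\<close> is the combination of \<open>a\<close> and \<open>b\<close> on which
  \<open>l\<close> vanishes; its coefficients \<open>l \<bullet> a\<close> and
  \<open>- (l \<bullet> b)\<close> are positive, so the hyperplane meets the cone in the ray of
  \<open>c\<close>.\<close>

lemma cut_cone2:
  assumes ab: "indep2 a b" and l: "0 < l \<bullet> a" "l \<bullet> b < 0" and c: "c = (l \<bullet> a) *\<^sub>R b - (l \<bullet> b) *\<^sub>R a"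
  shows "cone2 a b \<inter> {x. 0 \<le> l \<bullet> x} = cone2 a c" "cone2 a b \<inter> {x. l \<bullet> x = 0} = ray c" "indep2 a c"
proof -
  have lc: "l \<bullet> c = 0" unfolding c by (simp add: inner_diff_right)
  have sub: "cone2 a c \<subseteq> cone2 a b \<inter> {x. 0 \<le> l \<bullet> x}"
  proof
    fix x assume "x \<in> cone2 a c"
    then obtain s t where st: "0 \<le> s" "0 \<le> t" "x = s *\<^sub>R a + t *\<^sub>R c" unfolding mem_cone2 by metis
    have "x = (s - t * (l \<bullet> b)) *\<^sub>R a + (t * (l \<bullet> a)) *\<^sub>R b" unfolding st c by (simp add: algebra_simps)
    moreover have "0 \<le> s - t * (l \<bullet> b)" using st l by (smt (verit) mult_nonneg_nonpos)
    moreover have "0 \<le> t * (l \<bullet> a)" using st l by simp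
    ultimately have "x \<in> cone2 a b" unfolding mem_cone2 by blast
    moreover have "0 \<le> l \<bullet> x" unfolding st using st l by (simp add: inner_add_right lc)
    ultimately show "x \<in> cone2 a b \<inter> {x. 0 \<le> l \<bullet> x}" by blast
  qed
  have dec: "\<exists>s t. 0 \<le> s \<and> 0 \<le> t \<and> x = s *\<^sub>R a + t *\<^sub>R c \<and> l \<bullet> x = s * (l \<bullet> a)"
    if x: "x \<in> cone2 a b" and lx: "0 \<le> l \<bullet> x" for x
  proof -
    obtain s t where st: "0 \<le> s" "0 \<le> t" "x = s *\<^sub>R a + t *\<^sub>R b" using x unfolding mem_cone2 by metis
    \<comment> \<open>As \<open>l\<close> vanishes on \<open>c\<close>, the coefficient of
      \<open>a\<close> is read off from \<open>l \<bullet> x\<close>, and the coefficient of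
      \<open>c\<close> from that of \<open>b\<close>.\<close>
    let ?s = "(l \<bullet> x) / (l \<bullet> a)" and ?t = "t / (l \<bullet> a)"
    have lx': "l \<bullet> x = s * (l \<bullet> a) + t * (l \<bullet> b)" unfolding st by (simp add: inner_add_right)
    have "?s *\<^sub>R a + ?t *\<^sub>R c = (?s - ?t * (l \<bullet> b)) *\<^sub>R a + (?t * (l \<bullet> a)) *\<^sub>R b"
      unfolding c by (simp only: scaleR_right_diff_distrib scaleR_left_diff_distrib scaleR_scaleR) simp
    also have "?t * (l \<bullet> a) = t" using l by simp
    also have "?s - ?t * (l \<bullet> b) = s" using l unfolding lx' by (simp add: field_simps)
    finally have "x = ?s *\<^sub>R a + ?t *\<^sub>R c" using st by simp
    moreover have "0 \<le> ?s" "0 \<le> ?t" "l \<bullet> x = ?s * (l \<bullet> a)" using lx l st by auto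
    ultimately show ?thesis by blast
  qed
  have "cone2 a b \<inter> {x. 0 \<le> l \<bullet> x} \<subseteq> cone2 a c"
  proof
    fix x assume "x \<in> cone2 a b \<inter> {x. 0 \<le> l \<bullet> x}"
    then have "x \<in> cone2 a b" "0 \<le> l \<bullet> x" by simp_all
    then show "x \<in> cone2 a c" using dec unfolding mem_cone2 by metis
  qed
  with sub show "cone2 a b \<inter> {x. 0 \<le> l \<bullet> x} = cone2 a c" by blast
  show "cone2 a b \<inter> {x. l \<bullet> x = 0} = ray c"
  proof (intro subset_antisym subsetI)
    fix x assume "x \<in> cone2 a b \<inter> {x. l \<bullet> x = 0}"
    then have x: "x \<in> cone2 a b" "l \<bullet> x = 0" by simp_all
    then obtain s t where st: "0 \<le> t" "x = s *\<^sub>R a + t *\<^sub>R c" "l \<bullet> x = s * (l \<bullet> a)" using dec by (metis order_refl)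
    then have "s = 0" using x l by simp
    then show "x \<in> ray c" using st unfolding mem_ray by auto
  next
    fix x assume x: "x \<in> ray c"
    then have "l \<bullet> x = 0" unfolding mem_ray by (auto simp: lc)
    then show "x \<in> cone2 a b \<inter> {x. l \<bullet> x = 0}" using x sub ray_subset_cone2(2) [of c a] by blast
  qed
  show "indep2 a c" using indep2_combine [OF ab, of "l \<bullet> a" "- (l \<bullet> b)"] l unfolding c by (simp add: add.commute)
qed

lemma flat_cone_sign_cases:
  assumes "flat_cone \<sigma>"
  obtains (nonneg) "\<And>x. x \<in> \<sigma> \<Longrightarrow> 0 \<le> l \<bullet> x" | (nonpos) "\<And>x. x \<in> \<sigma> \<Longrightarrow> l \<bullet> x \<le> 0"
    | (mixed) a b where "a \<in> int_points" "b \<in> int_points" "indep2 a b" "\<sigma> = cone2 a b" "0 < l \<bullet> a" "l \<bullet> b < 0"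
proof -
  consider (0) "\<sigma> = {0}" | (1) a where "\<sigma> = ray a"
    | (2) a b where "a \<in> int_points" "b \<in> int_points" "indep2 a b" "\<sigma> = cone2 a b"
    using assms unfolding flat_cone_def by blast
  then show thesis
  proof cases
    case 0 then show thesis using nonneg by simp
  next
    case 1
    show thesis
    proof (cases "0 \<le> l \<bullet> a")
      case True
      then have "0 \<le> l \<bullet> x" if "x \<in> \<sigma>" for x using that unfolding 1 ray_def by auto
      then show thesis by (rule nonneg)
    next
      case False
      then have "l \<bullet> x \<le> 0" if "x \<in> \<sigma>" for x using that unfolding 1 ray_def by (auto simp: mult_nonneg_nonpos)
      then show thesis by (rule nonpos)
    qed
  next
    case 2
    have pos: "0 \<le> l \<bullet> x" if "0 \<le> l \<bullet> a" "0 \<le> l \<bullet> b" "x \<in> \<sigma>" for x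
      using that unfolding 2(4) cone2_def by (auto simp: inner_add_right)
    have neg: "l \<bullet> x \<le> 0" if "l \<bullet> a \<le> 0" "l \<bullet> b \<le> 0" "x \<in> \<sigma>" for x
      using that unfolding 2(4) cone2_def by (auto simp: inner_add_right mult_nonneg_nonpos add_nonpos_nonpos)
    consider "0 \<le> l \<bullet> a" "0 \<le> l \<bullet> b" | "l \<bullet> a \<le> 0" "l \<bullet> b \<le> 0" | "0 < l \<bullet> a" "l \<bullet> b < 0" | "l \<bullet> a < 0" "0 < l \<bullet> b"
      by linarith
    then show thesis
    proof cases
      case 1 then show thesis using pos nonneg by blast
    next
      case c: 2 then show thesis using neg nonpos by blast
    next
      case 3 then show thesis using mixed 2 by blast
    next
      case 4 then show thesis using mixed [of b a] 2 indep2_commute [of a b] cone2_commute [of a b] by blast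
    qed
  qed
qed

text \<open>The hyperplane supports the cone, so each piece is the cone itself or its face on the
  hyperplane.\<close>

lemma sign_coherent_cut_face:
  assumes "flat_cone \<sigma>" "A \<in> halves l" and l: "(\<forall>x\<in>\<sigma>. 0 \<le> l \<bullet> x) \<or> (\<forall>x\<in>\<sigma>. l \<bullet> x \<le> 0)"
  shows "\<sigma> \<inter> A face_of \<sigma>"
proof -
  have cv: "convex \<sigma>" using assms(1) flat_cone_convex_cone convex_cone_imp_convex by blast
  have 0: "\<sigma> \<inter> {x. l \<bullet> x = 0} face_of \<sigma>"
    using l face_of_Int_supporting_hyperplane_ge [OF cv, of 0 l] face_of_Int_supporting_hyperplane_le [OF cv, of l 0] by blast
  have r: "\<sigma> face_of \<sigma>" using cv by (simp add: face_of_refl)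
  consider "A = {x. 0 \<le> l \<bullet> x}" | "A = {x. l \<bullet> x \<le> 0}" | "A = {x. l \<bullet> x = 0}" using assms(2) unfolding halves_def by blast
  then show ?thesis
  proof cases
    case 1
    then have "\<sigma> \<inter> A = \<sigma> \<or> \<sigma> \<inter> A = \<sigma> \<inter> {x. l \<bullet> x = 0}" using l by (auto intro: antisym)
    then show ?thesis using 0 r by metis
  next
    case 2
    then have "\<sigma> \<inter> A = \<sigma> \<or> \<sigma> \<inter> A = \<sigma> \<inter> {x. l \<bullet> x = 0}" using l by (auto intro: antisym)
    then show ?thesis using 0 r by metis
  qed (use 0 in simp)
qed

context
  fixes F :: "(real ^ 'n) set set" and l :: "real ^ 'n"
  assumes F: "surface_fan F" and l: "l \<in> int_points"
begin

lemma mixed_cut: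
  assumes \<sigma>: "\<sigma> \<in> F" "\<sigma> = cone2 a b" and ab: "a \<in> int_points" "b \<in> int_points" "indep2 a b" "0 < l \<bullet> a" "l \<bullet> b < 0"
  obtains c where "c \<in> int_points" "indep2 a c" "indep2 b c" "\<sigma> \<inter> {x. 0 \<le> l \<bullet> x} = cone2 a c"
    "\<sigma> \<inter> {x. l \<bullet> x \<le> 0} = cone2 b c" "\<sigma> \<inter> {x. l \<bullet> x = 0} = ray c" "ray a \<in> F" "ray b \<in> F"
proof -
  define c where "c = (l \<bullet> a) *\<^sub>R b - (l \<bullet> b) *\<^sub>R a"
  have ci: "c \<in> int_points" unfolding c_def using ab l by (intro int_points_simps int_points_inner)
  have ba: "indep2 b a" using ab indep2_commute by blast
  note 1 = cut_cone2 [OF ab(3-5) c_def]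
  \<comment> \<open>With \<open>- l\<close> for \<open>l\<close> and the generators exchanged the
    same \<open>c\<close> results, so the other half follows from the same lemma.\<close>
  have "c = ((-l) \<bullet> b) *\<^sub>R a - ((-l) \<bullet> a) *\<^sub>R b" unfolding c_def by simp
  then have 2: "cone2 b a \<inter> {x. 0 \<le> (-l) \<bullet> x} = cone2 b c" "indep2 b c"
    using cut_cone2 [OF ba, of "-l" c] ab by auto
  have "ray a face_of \<sigma>" "ray b face_of \<sigma>"
    using ray_face_of_cone2 [OF ab(3)] ray_face_of_cone2 [OF ba] \<sigma>(2) cone2_commute [of a b] by auto
  then have "ray a \<in> F" "ray b \<in> F" using surface_fan_face [OF F \<sigma>(1)] ray_self by blast+
  moreover have "\<sigma> \<inter> {x. l \<bullet> x \<le> 0} = cone2 b c" using 2 \<sigma>(2) cone2_commute [of a b] by simp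
  ultimately show thesis using that [of c] ci 1 2 \<sigma>(2) by blast
qed

text \<open>A sign-coherent cone is cut into faces of itself, which already belong to
  \<open>F\<close>. Otherwise the faces of the pieces are the origin, the two old edges, each on one
  side of the hyperplane, the new ray \<open>c\<close> and the pieces themselves.\<close>

lemma cut_fan_flat_faces:
  assumes "\<sigma> \<in> F" "A \<in> halves l"
  shows "flat_cone (\<sigma> \<inter> A) \<and> (\<forall>\<tau>. \<tau> face_of \<sigma> \<inter> A \<and> \<tau> \<noteq> {} \<longrightarrow> \<tau> \<in> cut_fan l F)"
proof -
  have flat: "flat_cone \<sigma>" using surface_fan_flat F assms(1) by blast
  have ne: "0 \<in> \<sigma> \<inter> A"
    using convex_cone_contains_0 [OF flat_cone_convex_cone [OF flat]] assms(2) unfolding halves_def by auto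
  have coh: ?thesis if "(\<forall>x\<in>\<sigma>. 0 \<le> l \<bullet> x) \<or> (\<forall>x\<in>\<sigma>. l \<bullet> x \<le> 0)"
  proof -
    have f: "\<sigma> \<inter> A face_of \<sigma>" using sign_coherent_cut_face [OF flat assms(2) that] .
    then have m: "\<sigma> \<inter> A \<in> F" using surface_fan_face [OF F assms(1)] ne by blast
    then have "flat_cone (\<sigma> \<inter> A)" using surface_fan_flat [OF F] by blast
    moreover have "\<tau> \<in> cut_fan l F" if "\<tau> face_of \<sigma> \<inter> A" "\<tau> \<noteq> {}" for \<tau>
      using cut_fanI [OF surface_fan_face [OF F m that] assms(2)] face_of_imp_subset [OF that(1)] by blast
    ultimately show ?thesis by blast
  qed
  show ?thesis
  proof (rule flat_cone_sign_cases [OF flat, of l])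
    fix a b assume ab: "a \<in> int_points" "b \<in> int_points" "indep2 a b" "\<sigma> = cone2 a b" "0 < l \<bullet> a" "l \<bullet> b < 0"
    obtain c where c: "c \<in> int_points" "indep2 a c" "indep2 b c" "\<sigma> \<inter> {x. 0 \<le> l \<bullet> x} = cone2 a c"
      "\<sigma> \<inter> {x. l \<bullet> x \<le> 0} = cone2 b c" "\<sigma> \<inter> {x. l \<bullet> x = 0} = ray c" "ray a \<in> F" "ray b \<in> F"
      using mixed_cut [OF assms(1) ab(4,1,2,3,5,6)] by metis
    have h: "{x. 0 \<le> l \<bullet> x} \<in> halves l" "{x. l \<bullet> x \<le> 0} \<in> halves l" "{x. l \<bullet> x = 0} \<in> halves l"
      unfolding halves_def by auto
    have z: "{0} \<in> cut_fan l F"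
      using cut_fanI [OF surface_fan_face [OF F assms(1) zero_face_of_flat_cone [OF flat]] h(1)] by simp
    have rc: "ray c \<in> cut_fan l F" unfolding mem_cut_fan using assms(1) h(3) c(6) by blast
    have ra: "ray a \<in> cut_fan l F" using c(4) ray_subset_cone2(1) [of a c] by (intro cut_fanI [OF c(7) h(1)]) blast
    have rb: "ray b \<in> cut_fan l F" using c(5) ray_subset_cone2(1) [of b c] by (intro cut_fanI [OF c(8) h(2)]) blast
    have c0: "c \<noteq> 0" using indep2_nonzero c(2) by blast
    have self: "\<sigma> \<inter> A \<in> cut_fan l F" unfolding mem_cut_fan using assms by blast
    consider "A = {x. 0 \<le> l \<bullet> x}" | "A = {x. l \<bullet> x \<le> 0}" | "A = {x. l \<bullet> x = 0}" using assms(2) unfolding halves_def by blast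
    then show ?thesis
    proof cases
      case 1
      then have e: "\<sigma> \<inter> A = cone2 a c" using c by simp
      have "\<tau> \<in> cut_fan l F" if "\<tau> face_of cone2 a c" "\<tau> \<noteq> {}" for \<tau>
        using faces_of_cone2 [OF that] z ra rc self e by metis
      moreover have "flat_cone (cone2 a c)" unfolding flat_cone_def using ab c by blast
      ultimately show ?thesis unfolding e by blast
    next
      case 2
      then have e: "\<sigma> \<inter> A = cone2 b c" using c by simp
      have "\<tau> \<in> cut_fan l F" if "\<tau> face_of cone2 b c" "\<tau> \<noteq> {}" for \<tau>
        using faces_of_cone2 [OF that] z rb rc self e by metis
      moreover have "flat_cone (cone2 b c)" unfolding flat_cone_def using ab c by blast
      ultimately show ?thesis unfolding e by blast
    next
      case 3
      then have e: "\<sigma> \<inter> A = ray c" using c by simp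
      have "\<tau> \<in> cut_fan l F" if "\<tau> face_of ray c" "\<tau> \<noteq> {}" for \<tau>
        using faces_of_ray [OF that] z rc by metis
      moreover have "flat_cone (ray c)" unfolding flat_cone_def using c c0 by blast
      ultimately show ?thesis unfolding e by blast
    qed
  qed (use coh in blast)+
qed

lemma halves_Int_face:
  assumes "A \<in> halves l" "B \<in> halves l" shows "A \<inter> B face_of A"
proof -
  have p: "{x. 0 \<le> l \<bullet> x} \<inter> {x. l \<bullet> x = 0} face_of {x. 0 \<le> l \<bullet> x}"
    using convex_halfspace_ge [of 0 l] by (intro face_of_Int_supporting_hyperplane_ge) auto
  have m: "{x. l \<bullet> x \<le> 0} \<inter> {x. l \<bullet> x = 0} face_of {x. l \<bullet> x \<le> 0}"
    by (intro face_of_Int_supporting_hyperplane_le convex_halfspace_le) auto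
  have z: "{x. l \<bullet> x = 0} face_of {x. l \<bullet> x = 0}" by (simp add: face_of_refl convex_hyperplane)
  have pp: "{x. 0 \<le> l \<bullet> x} face_of {x. 0 \<le> l \<bullet> x}" using convex_halfspace_ge [of 0 l] by (simp add: face_of_refl)
  have mm: "{x. l \<bullet> x \<le> 0} face_of {x. l \<bullet> x \<le> 0}" by (simp add: face_of_refl convex_halfspace_le)
  have e: "{x. 0 \<le> l \<bullet> x} \<inter> {x. l \<bullet> x = 0} = {x. l \<bullet> x = 0}" "{x. l \<bullet> x \<le> 0} \<inter> {x. l \<bullet> x = 0} = {x. l \<bullet> x = 0}"
    "{x. l \<bullet> x = 0} \<inter> {x. 0 \<le> l \<bullet> x} = {x. l \<bullet> x = 0}" "{x. l \<bullet> x = 0} \<inter> {x. l \<bullet> x \<le> 0} = {x. l \<bullet> x = 0}"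
    "{x. 0 \<le> l \<bullet> x} \<inter> {x. l \<bullet> x \<le> 0} = {x. l \<bullet> x = 0}" "{x. l \<bullet> x \<le> 0} \<inter> {x. 0 \<le> l \<bullet> x} = {x. l \<bullet> x = 0}"
    by auto
  have "A = {x. 0 \<le> l \<bullet> x} \<or> A = {x. l \<bullet> x \<le> 0} \<or> A = {x. l \<bullet> x = 0}" using assms(1) unfolding halves_def by blast
  moreover have "B = {x. 0 \<le> l \<bullet> x} \<or> B = {x. l \<bullet> x \<le> 0} \<or> B = {x. l \<bullet> x = 0}" using assms(2) unfolding halves_def by blast
  ultimately show ?thesis using p m z pp mm unfolding e by (elim disjE; simp only: e Int_absorb)
qed

lemma cut_fan_surface: "surface_fan (cut_fan l F)"
  unfolding surface_fan_def rational_fan_def pure_dim_def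
proof (intro conjI ballI allI impI)
  show "finite (cut_fan l F)" unfolding cut_fan_def using surface_fan_finite [OF F] by (auto simp: halves_def)
next
  fix \<rho> assume "\<rho> \<in> cut_fan l F"
  then have "flat_cone \<rho>" unfolding mem_cut_fan using cut_fan_flat_faces by blast
  then show "rational_cone \<rho>" "strongly_convex \<rho>" using flat_cone_rational by blast+
next
  fix \<rho> \<tau> assume "\<rho> \<in> cut_fan l F" "\<tau> face_of \<rho> \<and> \<tau> \<noteq> {}"
  then show "\<tau> \<in> cut_fan l F" unfolding mem_cut_fan [of \<rho>] using cut_fan_flat_faces by blast
next
  have *: "\<rho> \<inter> \<rho>' face_of \<rho>" if r: "\<rho> \<in> cut_fan l F" and r': "\<rho>' \<in> cut_fan l F" for \<rho> \<rho>'
  proof -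
    obtain \<sigma> A where 1: "\<sigma> \<in> F" "A \<in> halves l" "\<rho> = \<sigma> \<inter> A" using r unfolding mem_cut_fan by blast
    obtain \<sigma>' A' where 2: "\<sigma>' \<in> F" "A' \<in> halves l" "\<rho>' = \<sigma>' \<inter> A'" using r' unfolding mem_cut_fan by blast
    \<comment> \<open>A face of \<sigma> and a face of the half-space or hyperplane \<open>A\<close>
      meet in a face of the piece \<open>\<sigma> \<inter> A\<close>.\<close>
    have "(\<sigma> \<inter> \<sigma>') \<inter> (A \<inter> A') face_of \<sigma> \<inter> A"
      using surface_fan_Int [OF F 1(1) 2(1)] halves_Int_face [OF 1(2) 2(2)] by (rule face_of_Int_Int)
    moreover have "(\<sigma> \<inter> \<sigma>') \<inter> (A \<inter> A') = \<rho> \<inter> \<rho>'" using 1 2 by blast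
    ultimately show ?thesis using 1 by simp
  qed
  fix \<rho> \<rho>' assume "\<rho> \<in> cut_fan l F" "\<rho>' \<in> cut_fan l F"
  then show "\<rho> \<inter> \<rho>' face_of \<rho>" "\<rho> \<inter> \<rho>' face_of \<rho>'" using * [of \<rho> \<rho>'] * [of \<rho>' \<rho>] by (auto simp: Int_commute)
next
  fix \<rho> assume "\<rho> \<in> cut_fan l F"
  then obtain \<tau> A where \<tau>: "\<tau> \<in> F" "A \<in> halves l" "\<rho> = \<tau> \<inter> A" unfolding mem_cut_fan by blast
  then obtain \<sigma> where \<sigma>: "\<sigma> \<in> F" "\<tau> \<subseteq> \<sigma>" "dim \<sigma> = 2" using F unfolding surface_fan_def pure_dim_def by blast
  have flat: "flat_cone \<sigma>" using surface_fan_flat F \<sigma>(1) by blast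
  have h: "{x. 0 \<le> l \<bullet> x} \<in> halves l" "{x. l \<bullet> x \<le> 0} \<in> halves l" unfolding halves_def by auto
  show "\<exists>\<sigma>\<in>cut_fan l F. \<rho> \<subseteq> \<sigma> \<and> dim \<sigma> = 2"
  proof (rule flat_cone_sign_cases [OF flat, of l])
    assume "\<And>x. x \<in> \<sigma> \<Longrightarrow> 0 \<le> l \<bullet> x"
    then have "\<sigma> \<in> cut_fan l F" using cut_fanI [OF \<sigma>(1) h(1)] by blast
    then show ?thesis using \<sigma> \<tau> by blast
  next
    assume "\<And>x. x \<in> \<sigma> \<Longrightarrow> l \<bullet> x \<le> 0"
    then have "\<sigma> \<in> cut_fan l F" using cut_fanI [OF \<sigma>(1) h(2)] by blast
    then show ?thesis using \<sigma> \<tau> by blast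
  next
    fix a b assume ab: "a \<in> int_points" "b \<in> int_points" "indep2 a b" "\<sigma> = cone2 a b" "0 < l \<bullet> a" "l \<bullet> b < 0"
    obtain c where c: "c \<in> int_points" "indep2 a c" "indep2 b c" "\<sigma> \<inter> {x. 0 \<le> l \<bullet> x} = cone2 a c"
      "\<sigma> \<inter> {x. l \<bullet> x \<le> 0} = cone2 b c" "\<sigma> \<inter> {x. l \<bullet> x = 0} = ray c" "ray a \<in> F" "ray b \<in> F"
      using mixed_cut [OF \<sigma>(1) ab(4,1,2,3,5,6)] by metis
    have "A \<subseteq> {x. 0 \<le> l \<bullet> x} \<or> A \<subseteq> {x. l \<bullet> x \<le> 0}" using \<tau>(2) unfolding halves_def by auto
    then have "\<rho> \<subseteq> \<sigma> \<inter> {x. 0 \<le> l \<bullet> x} \<or> \<rho> \<subseteq> \<sigma> \<inter> {x. l \<bullet> x \<le> 0}" using \<tau>(3) \<sigma>(2) by blast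
    moreover have "\<sigma> \<inter> {x. 0 \<le> l \<bullet> x} \<in> cut_fan l F" "\<sigma> \<inter> {x. l \<bullet> x \<le> 0} \<in> cut_fan l F"
      unfolding mem_cut_fan using \<sigma>(1) h by blast+
    moreover have "dim (\<sigma> \<inter> {x. 0 \<le> l \<bullet> x}) = 2" "dim (\<sigma> \<inter> {x. l \<bullet> x \<le> 0}) = 2"
      unfolding c(4,5) using dim_cone2 c(2,3) by auto
    ultimately show ?thesis by blast
  qed
qed

end

lemma cut_weight:
  assumes F: "surface_fan (fst W)" and s: "\<sigma> \<in> cut_fan l (fst W)" "\<rho> \<in> fst W" "\<sigma> \<subseteq> \<rho>"
    and xy: "indep2 x y" "x \<in> \<sigma>" "y \<in> \<sigma>"
  shows "snd (cut l W) \<sigma> = snd W \<rho>" "dim \<sigma> = 2" "dim \<rho> = 2"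
proof -
  show r: "dim \<rho> = 2" using surface_fan_dim2 [OF F s(2) _ _ xy(1)] xy s(3) by blast
  then have "dim \<sigma> \<le> 2" using dim_subset [OF s(3)] by simp
  then show d: "dim \<sigma> = 2" using dim_ge_2 [OF xy] by simp
  have "{\<rho>'\<in>fst W. dim \<rho>' = 2 \<and> \<sigma> \<subseteq> \<rho>'} = {\<rho>}"
    using surface_fan_unique [OF F _ s(2) xy(1)] xy s r by blast
  then show "snd (cut l W) \<sigma> = snd W \<rho>" unfolding cut_def using s(1) d by simp
qed

text \<open>Along the germ \<open>l\<close> is an affine function of the step length, so it keeps
  its weak sign at least up to its zero.\<close>

lemma germ_halves:
  assumes "germ \<sigma> u d" "convex \<sigma>" shows "\<exists>A\<in>halves l. germ (\<sigma> \<inter> A) u d"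
proof -
  obtain e where e: "0 < e" "\<And>s. 0 \<le> s \<Longrightarrow> s \<le> e \<Longrightarrow> u + s *\<^sub>R d \<in> \<sigma>" using germE assms by blast
  define f where "f s = l \<bullet> u + s * (l \<bullet> d)" for s
  have f: "l \<bullet> (u + s *\<^sub>R d) = f s" for s unfolding f_def by (simp add: inner_add_right)
  have "\<exists>s. 0 < s \<and> s \<le> e \<and> (0 \<le> f 0 \<and> 0 \<le> f s \<or> f 0 \<le> 0 \<and> f s \<le> 0)"
  proof (cases "0 \<le> f 0 \<and> 0 \<le> f e \<or> f 0 \<le> 0 \<and> f e \<le> 0")
    case True then show ?thesis using e(1) by blast
  next
    case False
    have ld: "f e = f 0 + e * (l \<bullet> d)" unfolding f_def by simp
    then have ne: "l \<bullet> d \<noteq> 0" using False by auto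
    \<comment> \<open>The zero of \<open>f\<close>. In this case \<open>f 0\<close> and
      \<open>f e\<close> have strictly opposite signs, so it lies between 0 and
      \<open>e\<close>.\<close>
    define s where "s = - f 0 / (l \<bullet> d)"
    have s0: "f s = 0" unfolding s_def using ne by (simp add: f_def)
    have "0 < s \<and> s \<le> e"
    proof (cases "0 < f 0")
      case True
      then have "f e < 0" using False by linarith
      then have "e * (l \<bullet> d) < - f 0" using ld by linarith
      moreover then have "e * (l \<bullet> d) < 0" using True by linarith
      then have "l \<bullet> d < 0" using e(1) by (simp add: mult_less_0_iff)
      ultimately have "- f 0 / (l \<bullet> d) \<le> e" using neg_divide_le_eq [of "l \<bullet> d" "- f 0" e] by linarith
      moreover have "0 < - f 0 / (l \<bullet> d)" using True \<open>l \<bullet> d < 0\<close> divide_neg_neg [of "- f 0" "l \<bullet> d"] by linarith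
      ultimately show ?thesis unfolding s_def by blast
    next
      case c: False
      then have "f 0 < 0" "0 < f e" using False by linarith+
      then have "- f 0 < e * (l \<bullet> d)" using ld by linarith
      moreover then have "0 < e * (l \<bullet> d)" using c by linarith
      then have "0 < l \<bullet> d" using e(1) by (simp add: zero_less_mult_iff)
      ultimately have "- f 0 / (l \<bullet> d) \<le> e" using pos_divide_le_eq [of "l \<bullet> d" "- f 0" e] by linarith
      moreover have "0 < - f 0 / (l \<bullet> d)" using \<open>f 0 < 0\<close> \<open>0 < l \<bullet> d\<close> divide_pos_pos [of "- f 0" "l \<bullet> d"] by linarith
      ultimately show ?thesis unfolding s_def by blast
    qed
    then show ?thesis using s0 False by (intro exI [of _ s]) auto
  qed
  then obtain s where s: "0 < s" "s \<le> e" "0 \<le> f 0 \<and> 0 \<le> f s \<or> f 0 \<le> 0 \<and> f s \<le> 0" by blast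
  then have m: "u \<in> \<sigma>" "u + s *\<^sub>R d \<in> \<sigma>" using e(2) [of 0] e(2) [of s] e(1) by auto
  have f0: "l \<bullet> u = f 0" unfolding f_def by simp
  from s(3) show ?thesis
  proof
    assume "0 \<le> f 0 \<and> 0 \<le> f s"
    then have "germ (\<sigma> \<inter> {x. 0 \<le> l \<bullet> x}) u d" unfolding germ_def using m s(1) f f0 by auto
    then show ?thesis unfolding halves_def by blast
  next
    assume "f 0 \<le> 0 \<and> f s \<le> 0"
    then have "germ (\<sigma> \<inter> {x. l \<bullet> x \<le> 0}) u d" unfolding germ_def using m s(1) f f0 by auto
    then show ?thesis unfolding halves_def by blast
  qed
qed

text \<open>The new rays require no balancing check of their own: cutting leaves the germ weights
  unchanged, and balancing at all integral vectors is a property of these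
  (\<open>tropical_fan_2I\<close>).\<close>

lemma cut_tropical:
  assumes W: "tropical_fan 2 W" and l: "l \<in> int_points"
  shows "tropical_fan 2 (cut l W)" "germ_weight (cut l W) = germ_weight W"
proof -
  note F = tropical_surface_fan [OF W]
  have fc: "fst (cut l W) = cut_fan l (fst W)" unfolding cut_def by simp
  have F': "surface_fan (fst (cut l W))" unfolding fc by (rule cut_fan_surface [OF F l])
  have mem: "\<exists>\<rho>\<in>fst W. \<sigma> \<subseteq> \<rho>" if "\<sigma> \<in> fst (cut l W)" for \<sigma> using that unfolding fc mem_cut_fan by blast
  have germ_mono: "germ \<rho> u d" if "germ \<sigma> u d" "\<sigma> \<subseteq> \<rho>" for \<sigma> \<rho> and u d :: "real^'n" using that unfolding germ_def by blast
  show g: "germ_weight (cut l W) = germ_weight W"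
  proof (rule germ_weight_eqI [OF F' F])
    show "\<exists>\<sigma>'\<in>fst W. germ \<sigma>' u d" if "\<sigma> \<in> fst (cut l W)" "germ \<sigma> u d" for u d \<sigma>
      using mem [OF that(1)] germ_mono [OF that(2)] by blast
    show "\<exists>\<sigma>'\<in>fst (cut l W). germ \<sigma>' u d" if \<sigma>: "\<sigma> \<in> fst W" "germ \<sigma> u d" for u d \<sigma>
    proof -
      obtain A where "A \<in> halves l" "germ (\<sigma> \<inter> A) u d"
        using germ_halves [OF \<sigma>(2) surface_fan_convex [OF F \<sigma>(1)]] by blast
      moreover then have "\<sigma> \<inter> A \<in> fst (cut l W)" unfolding fc mem_cut_fan using \<sigma>(1) by blast
      ultimately show ?thesis by blast
    qed
    show "snd (cut l W) \<sigma> = snd W \<sigma>'"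
      if h: "indep2 u d" "\<sigma> \<in> fst (cut l W)" "\<sigma>' \<in> fst W" "germ \<sigma> u d" "germ \<sigma>' u d" for u d \<sigma> \<sigma>'
    proof -
      obtain \<rho> where r: "\<rho> \<in> fst W" "\<sigma> \<subseteq> \<rho>" using mem [OF h(2)] by blast
      have "\<rho> = \<sigma>'" using surface_fan_germ_unique [OF F r(1) h(3,1) germ_mono [OF h(4) r(2)] h(5)] .
      obtain e where "0 < e" "u \<in> \<sigma>" "u + e *\<^sub>R d \<in> \<sigma>" using \<open>germ \<sigma> u d\<close> unfolding germ_def by blast
      then show ?thesis using cut_weight(1) [OF F _ r, of l u "u + e *\<^sub>R d"] h(2) indep2_germ [OF h(1), of e]
        \<open>\<rho> = \<sigma>'\<close> unfolding fc by simp
    qed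
  qed
  have "weighted_surface (cut l W)" unfolding weighted_surface_def
  proof (intro conjI ballI allI impI)
    show "surface_fan (fst (cut l W))" by (rule F')
    show "snd (cut l W) \<sigma> = 0" if "\<not> (\<sigma> \<in> fst (cut l W) \<and> dim \<sigma> = 2)" for \<sigma>
      using that unfolding cut_def fst_conv snd_conv by presburger
    fix \<sigma> assume s: "\<sigma> \<in> fst (cut l W)" "dim \<sigma> = 2"
    obtain \<rho> where r: "\<rho> \<in> fst W" "\<sigma> \<subseteq> \<rho>" using mem [OF s(1)] by blast
    obtain a b where ab: "indep2 a b" "\<sigma> = cone2 a b" using flat_cone_dim2 [OF surface_fan_flat [OF F' s(1)] s(2)] by metis
    have "a \<in> \<sigma>" "b \<in> \<sigma>" unfolding ab(2) by (rule cone2_self)+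
    note cw = cut_weight [OF F s(1) [unfolded fc] r ab(1) this]
    then have "snd (cut l W) \<sigma> = snd W \<rho>" "dim \<rho> = 2" by blast+
    then show "snd (cut l W) \<sigma> \<in> \<int>" "0 < snd (cut l W) \<sigma>"
      using tropical_weighted_surface [OF W] r(1) unfolding weighted_surface_def by metis+
  qed
  then show "tropical_fan 2 (cut l W)" by (rule tropical_fan_2I) (unfold g, rule tropical_normal_sum [OF W])
qed

definition sign_coherent :: "'a::real_inner \<Rightarrow> 'a set \<Rightarrow> bool" where
  "sign_coherent l \<sigma> \<longleftrightarrow> (\<forall>x\<in>\<sigma>. 0 \<le> l \<bullet> x) \<or> (\<forall>x\<in>\<sigma>. l \<bullet> x \<le> 0)"

text \<open>One cut for each form; sign coherence already achieved survives later cuts because it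
  passes to subsets.\<close>

lemma coherent_refinement_exists:
  assumes W: "tropical_fan 2 W" and A: "finite A" "A \<subseteq> int_points"
  shows "\<exists>R. tropical_fan 2 R \<and> germ_weight R = germ_weight W \<and> (\<forall>\<rho>\<in>fst R. \<exists>\<sigma>\<in>fst W. \<rho> \<subseteq> \<sigma>) \<and>
     (\<forall>l\<in>A. \<forall>\<rho>\<in>fst R. sign_coherent l \<rho>)"
  using A
proof (induction A)
  case empty show ?case using W by blast
next
  case (insert l A)
  then obtain R where R: "tropical_fan 2 R" "germ_weight R = germ_weight W" "\<And>\<rho>. \<rho> \<in> fst R \<Longrightarrow> \<exists>\<sigma>\<in>fst W. \<rho> \<subseteq> \<sigma>"
    "\<And>l \<rho>. l \<in> A \<Longrightarrow> \<rho> \<in> fst R \<Longrightarrow> sign_coherent l \<rho>" by auto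
  have l: "l \<in> int_points" using insert.prems by auto
  have mem: "\<exists>\<sigma>\<in>fst R. \<rho> \<subseteq> \<sigma>" if "\<rho> \<in> fst (cut l R)" for \<rho> using that unfolding cut_def fst_conv mem_cut_fan by blast
  have 1: "sign_coherent l' \<rho>" if \<rho>: "\<rho> \<in> fst (cut l R)" and l': "l' \<in> insert l A" for \<rho> l'
  proof (cases "l' = l")
    case True
    then show ?thesis using \<rho> unfolding cut_def fst_conv mem_cut_fan halves_def sign_coherent_def by auto
  next
    case False
    then obtain \<sigma> where "\<sigma> \<in> fst R" "\<rho> \<subseteq> \<sigma>" "l' \<in> A" using mem \<rho> l' by blast
    then show ?thesis using R(4) [of l' \<sigma>] unfolding sign_coherent_def by blast
  qed
  have 2: "\<exists>\<sigma>\<in>fst W. \<rho> \<subseteq> \<sigma>" if \<rho>: "\<rho> \<in> fst (cut l R)" for \<rho>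
  proof -
    obtain \<sigma> where "\<sigma> \<in> fst R" "\<rho> \<subseteq> \<sigma>" using mem [OF \<rho>] by blast
    then show ?thesis using R(3) [of \<sigma>] by (meson order_trans)
  qed
  show ?case
  proof (intro exI [of _ "cut l R"] conjI ballI)
    show "tropical_fan 2 (cut l R)" by (rule cut_tropical(1) [OF R(1) l])
    show "germ_weight (cut l R) = germ_weight W" using cut_tropical(2) [OF R(1) l] R(2) by (rule trans)
  qed (erule 2, erule (1) 1)
qed

section \<open>Refinement and equivalence\<close>

lemma not_germ_eventually:
  fixes \<sigma> :: "'a::real_normed_vector set"
  assumes "closed \<sigma>" "\<not> germ \<sigma> u d" shows "\<forall>\<^sub>F s in at_right 0. u + s *\<^sub>R d \<notin> \<sigma>"
proof (cases "u \<in> \<sigma>")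
  case True
  then have "\<forall>s>0. u + s *\<^sub>R d \<notin> \<sigma>" using assms(2) unfolding germ_def by blast
  then show ?thesis by (auto simp: eventually_at_right_field intro: exI [of _ 1])
next
  case False
  have "((\<lambda>s. u + s *\<^sub>R d) \<longlongrightarrow> u + 0 *\<^sub>R d) (at_right 0)" by (intro tendsto_intros)
  then have t: "((\<lambda>s. u + s *\<^sub>R d) \<longlongrightarrow> u) (at_right 0)" by simp
  have "open (- \<sigma>)" using assms(1) by (simp add: open_Compl)
  then have "\<forall>\<^sub>F s in at_right 0. u + s *\<^sub>R d \<in> - \<sigma>" using topological_tendstoD [OF t] False by blast
  then show ?thesis by simp
qed

lemma germ_eventually:
  assumes "convex \<sigma>" "germ \<sigma> u d" shows "\<forall>\<^sub>F s in at_right 0. u + s *\<^sub>R d \<in> \<sigma>"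
proof -
  obtain e where e: "0 < e" "\<And>s. 0 \<le> s \<Longrightarrow> s \<le> e \<Longrightarrow> u + s *\<^sub>R d \<in> \<sigma>" using germE assms by blast
  then show ?thesis unfolding eventually_at_right_field by (intro exI [of _ e]) auto
qed

lemma germ_cone_add:
  assumes "convex_cone \<sigma>" "x \<in> \<sigma>" "d \<in> \<sigma>" shows "germ \<sigma> x d"
  unfolding germ_def using assms convex_cone_add [OF assms] by (intro conjI exI [of _ 1]) auto

text \<open>The point is that no germ gets lost in the refinement. If no cone of \<open>R\<close>
  had the germ, each closed cone, and by finiteness all of them at once, would miss
  \<open>u + s *\<^sub>R d\<close> for small \<open>s\<close>, although the supports agree.\<close>

lemma refines_germ_weight:
  assumes R: "refines 2 R W" and W: "tropical_fan 2 W"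
  shows "germ_weight R = germ_weight W"
proof -
  have tR: "tropical_fan 2 R" and un: "\<Union> (fst R) = \<Union> (fst W)" and sub: "\<And>\<rho>. \<rho> \<in> fst R \<Longrightarrow> \<exists>\<sigma>\<in>fst W. \<rho> \<subseteq> \<sigma>"
    and wt: "\<And>\<rho> \<sigma>. \<rho> \<in> fst R \<Longrightarrow> \<sigma> \<in> fst W \<Longrightarrow> dim \<rho> = 2 \<Longrightarrow> dim \<sigma> = 2 \<Longrightarrow> \<rho> \<subseteq> \<sigma> \<Longrightarrow> snd R \<rho> = snd W \<sigma>"
    using R unfolding refines_def by auto
  note F = tropical_surface_fan [OF W] and F' = tropical_surface_fan [OF tR]
  have germ_mono: "germ \<rho> u d" if "germ \<sigma> u d" "\<sigma> \<subseteq> \<rho>" for \<sigma> \<rho> and u d :: "real^'a" using that unfolding germ_def by blast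
  show ?thesis
  proof (rule germ_weight_eqI [OF F' F])
    show "\<exists>\<sigma>'\<in>fst W. germ \<sigma>' u d" if "\<sigma> \<in> fst R" "germ \<sigma> u d" for u d \<sigma>
      using sub [OF that(1)] germ_mono [OF that(2)] by blast
    show "snd R \<rho> = snd W \<sigma>"
      if h: "indep2 u d" "\<rho> \<in> fst R" "\<sigma> \<in> fst W" "germ \<rho> u d" "germ \<sigma> u d" for u d \<rho> \<sigma>
    proof -
      obtain \<sigma>' where s: "\<sigma>' \<in> fst W" "\<rho> \<subseteq> \<sigma>'" using sub [OF h(2)] by blast
      have "\<sigma>' = \<sigma>" using surface_fan_germ_unique [OF F s(1) h(3,1) germ_mono [OF h(4) s(2)] h(5)] .
      then show ?thesis using wt [OF h(2,3) surface_fan_germ_dim [OF F' h(2,1,4)] surface_fan_germ_dim [OF F h(3,1,5)]] s by blast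
    qed
    show "\<exists>\<rho>\<in>fst R. germ \<rho> u d" if \<sigma>: "\<sigma> \<in> fst W" "germ \<sigma> u d" for u d \<sigma>
    proof (rule ccontr)
      assume n: "\<not> ?thesis"
      have "\<forall>\<rho>\<in>fst R. \<forall>\<^sub>F s in at_right 0. u + s *\<^sub>R d \<notin> \<rho>"
        using not_germ_eventually n flat_cone_closed surface_fan_flat [OF F'] by blast
      then have "\<forall>\<^sub>F s in at_right 0. \<forall>\<rho>\<in>fst R. u + s *\<^sub>R d \<notin> \<rho>"
        using surface_fan_finite [OF F'] by (intro eventually_ball_finite)
      moreover have "\<forall>\<^sub>F s in at_right 0. u + s *\<^sub>R d \<in> \<sigma>"
        by (rule germ_eventually [OF surface_fan_convex [OF F \<sigma>(1)] \<sigma>(2)])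
      ultimately have "\<forall>\<^sub>F s in at_right (0::real). False"
      proof eventually_elim
        case (elim s)
        then have "u + s *\<^sub>R d \<in> \<Union> (fst W)" using \<sigma>(1) by blast
        then show False using elim(1) un by blast
      qed
      then show False by simp
    qed
  qed
qed

lemma cone2_indep_point:
  assumes ab: "indep2 a b" and "x \<noteq> 0" shows "\<exists>d\<in>{a, b}. indep2 x d"
proof (rule ccontr)
  assume "\<not> ?thesis"
  then obtain c c' where c: "a = c *\<^sub>R x" "b = c' *\<^sub>R x" using not_indep2 [of x a] not_indep2 [of x b] assms(2) by auto
  then have "c' *\<^sub>R a + (- c) *\<^sub>R b = 0" by simp
  from indep2D [OF ab this] have "c = 0" by simp
  then show False using c(1) indep2_nonzero [OF ab] by simp
qed

text \<open>Equality of supports is deduced and not assumed: a non-zero point of a cone of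
  \<open>W\<close> carries a germ of positive weight, which must then lie in a cone of
  \<open>R\<close>.\<close>

lemma refinesI:
  assumes R: "tropical_fan 2 R" and W: "tropical_fan 2 W" and g: "germ_weight R = germ_weight W"
    and sub: "\<And>\<rho>. \<rho> \<in> fst R \<Longrightarrow> dim \<rho> = 2 \<Longrightarrow> \<exists>\<sigma>\<in>fst W. \<rho> \<subseteq> \<sigma>"
  shows "refines 2 R W"
proof -
  note F = tropical_surface_fan [OF W] and F' = tropical_surface_fan [OF R]
  have sub': "\<exists>\<sigma>\<in>fst W. \<rho> \<subseteq> \<sigma>" if r: "\<rho> \<in> fst R" for \<rho>
  proof -
    obtain \<rho>' where r': "\<rho>' \<in> fst R" "\<rho> \<subseteq> \<rho>'" "dim \<rho>' = 2" using F' r unfolding surface_fan_def pure_dim_def by blast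
    then obtain \<sigma> where "\<sigma> \<in> fst W" "\<rho>' \<subseteq> \<sigma>" using sub by blast
    then show ?thesis using r'(2) by blast
  qed
  have "x \<in> \<Union> (fst R)" if x: "x \<in> \<tau>" "\<tau> \<in> fst W" for x \<tau>
  proof -
    obtain \<sigma> where s: "\<sigma> \<in> fst W" "\<tau> \<subseteq> \<sigma>" "dim \<sigma> = 2" using F x(2) unfolding surface_fan_def pure_dim_def by blast
    obtain a b where ab: "indep2 a b" "\<sigma> = cone2 a b" using flat_cone_dim2 [OF surface_fan_flat [OF F s(1)] s(3)] by metis
    have m: "a \<in> \<sigma>" "b \<in> \<sigma>" "x \<in> \<sigma>" using ab(2) x s(2) cone2_self by auto
    note cc = surface_fan_convex_cone [OF F s(1)]
    have in_R: "\<exists>\<rho>\<in>fst R. y \<in> \<rho>" if y: "y \<in> \<sigma>" "y \<noteq> 0" for y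
    proof -
      obtain d where d: "indep2 y d" "d \<in> \<sigma>" using cone2_indep_point [OF ab(1) y(2)] m by auto
      have "0 < germ_weight W y d"
        by (rule germ_weight_pos [OF tropical_weighted_surface [OF W] s(1) d(1) germ_cone_add [OF cc y(1) d(2)]])
      then have "germ_weight R y d \<noteq> 0" unfolding g by simp
      then obtain \<rho> where "\<rho> \<in> fst R" "germ \<rho> y d" using germ_weight_nonzeroE by metis
      then show ?thesis unfolding germ_def by blast
    qed
    show ?thesis
    proof (cases "x = 0")
      case True
      \<comment> \<open>No germ sits at the origin, since \<open>indep2 0 d\<close> is false, but
        every cone contains it.\<close>
      obtain \<rho> where "\<rho> \<in> fst R" using in_R [of a] m indep2_nonzero [OF ab(1)] by blast
      then show ?thesis using True convex_cone_contains_0 [OF surface_fan_convex_cone [OF F']] by blast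
    next
      case False then show ?thesis using in_R m by blast
    qed
  qed
  then have "\<Union> (fst R) = \<Union> (fst W)" using sub' by blast
  moreover have "snd R \<rho> = snd W \<sigma>" if h: "\<rho> \<in> fst R" "\<sigma> \<in> fst W" "dim \<rho> = 2" "\<rho> \<subseteq> \<sigma>" for \<rho> \<sigma>
  proof -
    obtain a b where ab: "indep2 a b" "\<rho> = cone2 a b" using flat_cone_dim2 [OF surface_fan_flat [OF F' h(1)] h(3)] by metis
    have "germ \<rho> a b" using ab(2) by (intro germ_cone_add surface_fan_convex_cone [OF F' h(1)]) auto
    moreover then have "germ \<sigma> a b" using h(4) unfolding germ_def by blast
    ultimately show ?thesis using germ_weight_eq [OF F' h(1) ab(1)] germ_weight_eq [OF F h(2) ab(1)] g by simp
  qed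
  ultimately show ?thesis unfolding refines_def using R sub' by blast
qed

lemma coherent_refinement:
  assumes W: "tropical_fan 2 W" and A: "finite A" "A \<subseteq> int_points"
  obtains R where "tropical_fan 2 R" "germ_weight R = germ_weight W"
    "\<And>\<rho>. \<rho> \<in> fst R \<Longrightarrow> \<exists>\<sigma>\<in>fst W. \<rho> \<subseteq> \<sigma>" "\<And>l \<rho>. l \<in> A \<Longrightarrow> \<rho> \<in> fst R \<Longrightarrow> sign_coherent l \<rho>"
proof -
  from coherent_refinement_exists [OF assms] obtain R where
    R: "tropical_fan 2 R \<and> germ_weight R = germ_weight W \<and> (\<forall>\<rho>\<in>fst R. \<exists>\<sigma>\<in>fst W. \<rho> \<subseteq> \<sigma>) \<and>
     (\<forall>l\<in>A. \<forall>\<rho>\<in>fst R. sign_coherent l \<rho>)" ..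
  show thesis by (rule that [of R]) (use R in simp_all)
qed

text \<open>\<open>W\<close> is cut along the forms \<open>perp a b\<close> and
  \<open>perp b a\<close> of all cones \<open>cone2 a b\<close> of \<open>W'\<close>. Within its
  plane such a cone is given by these two inequalities, so a cone of the cut fan that shares a germ
  with it, being sign-coherent for both forms, lies inside it.\<close>

lemma common_refinement:
  assumes W: "tropical_fan 2 W" and W': "tropical_fan 2 W'" and g: "germ_weight W = germ_weight W'"
  shows "\<exists>R. refines 2 R W \<and> refines 2 R W'"
proof -
  note F = tropical_surface_fan [OF W] and F' = tropical_surface_fan [OF W']
  let ?S = "{\<sigma>\<in>fst W'. dim \<sigma> = 2}"
  have "\<forall>\<sigma>\<in>?S. \<exists>ab. fst ab \<in> int_points \<and> snd ab \<in> int_points \<and> indep2 (fst ab) (snd ab) \<and> \<sigma> = cone2 (fst ab) (snd ab)"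
    using flat_cone_dim2 surface_fan_flat [OF F'] by (metis (mono_tags, lifting) fst_conv mem_Collect_eq snd_conv)
  from bchoice [OF this] obtain f where "\<forall>\<sigma>\<in>?S. fst (f \<sigma>) \<in> int_points \<and> snd (f \<sigma>) \<in> int_points \<and>
      indep2 (fst (f \<sigma>)) (snd (f \<sigma>)) \<and> \<sigma> = cone2 (fst (f \<sigma>)) (snd (f \<sigma>))" ..
  note f = bspec [OF this]
  define A where "A = (\<lambda>\<sigma>. perp (fst (f \<sigma>)) (snd (f \<sigma>))) ` ?S \<union> (\<lambda>\<sigma>. perp (snd (f \<sigma>)) (fst (f \<sigma>))) ` ?S"
  have "finite A" unfolding A_def using surface_fan_finite [OF F'] by simp
  moreover have "A \<subseteq> int_points" unfolding A_def
  proof (intro Un_least image_subsetI)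
    fix \<sigma> assume "\<sigma> \<in> ?S"
    from f [OF this] show "perp (fst (f \<sigma>)) (snd (f \<sigma>)) \<in> int_points" "perp (snd (f \<sigma>)) (fst (f \<sigma>)) \<in> int_points"
      by (simp_all add: perp_int)
  qed
  ultimately obtain R where R: "tropical_fan 2 R" "germ_weight R = germ_weight W"
    "\<And>\<rho>. \<rho> \<in> fst R \<Longrightarrow> \<exists>\<sigma>\<in>fst W. \<rho> \<subseteq> \<sigma>" "\<And>l \<rho>. l \<in> A \<Longrightarrow> \<rho> \<in> fst R \<Longrightarrow> sign_coherent l \<rho>"
    by (rule coherent_refinement [OF W]) (rule that)
  note FR = tropical_surface_fan [OF R(1)]
  have "\<exists>\<sigma>\<in>fst W'. \<rho> \<subseteq> \<sigma>" if r: "\<rho> \<in> fst R" "dim \<rho> = 2" for \<rho>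
  proof -
    obtain p q where pq: "indep2 p q" "\<rho> = cone2 p q" using flat_cone_dim2 [OF surface_fan_flat [OF FR r(1)] r(2)] by metis
    have mem: "p \<in> \<rho>" "q \<in> \<rho>" unfolding pq(2) by (rule cone2_self)+
    have cc: "convex_cone \<rho>" using surface_fan_convex_cone [OF FR r(1)] .
    \<comment> \<open>An interior point of \<rho>: a sign-coherent form that is non-negative here
      and not identically zero on \<rho> is non-negative on \<rho>.\<close>
    define x where "x = p + q"
    have x: "x \<in> \<rho>" unfolding x_def using convex_cone_add [OF cc mem] .
    have xq: "indep2 x q"
      using indep2_combine [of q p 1 1] pq(1) indep2_commute unfolding x_def by (metis add.commute scaleR_one zero_neq_one)
    have "0 < germ_weight R x q"
      by (rule germ_weight_pos [OF tropical_weighted_surface [OF R(1)] r(1) xq germ_cone_add [OF cc x mem(2)]])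
    then have "germ_weight W' x q \<noteq> 0" unfolding R(2) g by simp
    then obtain \<sigma> where s: "\<sigma> \<in> fst W'" "dim \<sigma> = 2" "germ \<sigma> x q" using germ_weight_nonzeroE by metis
    then have sS: "\<sigma> \<in> ?S" by blast
    define a b where "a = fst (f \<sigma>)" and "b = snd (f \<sigma>)"
    have A1: "perp a b \<in> A" unfolding a_def b_def A_def by (rule UnI1, rule imageI [OF sS])
    have A2: "perp b a \<in> A" unfolding a_def b_def A_def by (rule UnI2, rule imageI [OF sS])
    have A3: "indep2 a b \<and> \<sigma> = cone2 a b" using f [OF sS] unfolding a_def b_def by simp
    note ab = conjunct1 [OF A3] conjunct2 [OF A3] A1 A2
    have ba: "indep2 b a" using ab(1) indep2_commute [of a b] by simp
    obtain e where e: "0 < e" "x \<in> \<sigma>" "x + e *\<^sub>R q \<in> \<sigma>" using s(3) unfolding germ_def by blast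
    have "x \<in> span {a, b}" "x + e *\<^sub>R q \<in> span {a, b}" using e ab(2) span_cone2 [of a b] span_base by metis+
    moreover have "x \<in> span {p, q}" unfolding x_def by (intro span_add span_base) auto
    moreover have "x + e *\<^sub>R q \<in> span {p, q}" unfolding x_def by (intro span_add span_scale span_base) auto
    ultimately have "span {p, q} = span {a, b}"
      using span_indep2_eq [OF indep2_germ [OF xq, of e], of p q] span_indep2_eq [OF indep2_germ [OF xq, of e], of a b] e(1) by simp
    then have pqS: "p \<in> span {a, b}" "q \<in> span {a, b}" using span_base [of p "{p, q}"] span_base [of q "{p, q}"] by auto
    have key: "0 \<le> perp c d \<bullet> y"
      if h: "indep2 c d" "\<sigma> = cone2 c d" "span {c, d} = span {a, b}" "perp c d \<in> A" "y \<in> \<rho>" for c d y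
    proof -
      have co: "sign_coherent (perp c d) \<rho>" using R(4) [OF h(4) r(1)] .
      have px: "0 \<le> perp c d \<bullet> x"
        using e(2) perp_pos [OF h(1)] unfolding h(2) mem_cone2 by (auto simp: inner_add_right perp_orth)
      \<comment> \<open>If the form were nowhere positive on \<rho>, it would vanish at
        \<open>p\<close> and at \<open>q\<close>, and both would lie on the line of
        \<open>c\<close>.\<close>
      have "\<exists>z\<in>\<rho>. 0 < perp c d \<bullet> z" 
      proof (rule ccontr)
        assume n: "\<not> ?thesis"
        then have "perp c d \<bullet> p \<le> 0" "perp c d \<bullet> q \<le> 0" using mem by auto
        then have z: "perp c d \<bullet> p = 0" "perp c d \<bullet> q = 0" using px unfolding x_def inner_add_right by linarith+
        have on_line: "\<exists>k. z = k *\<^sub>R c" if "z \<in> span {a, b}" "perp c d \<bullet> z = 0" for z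
        proof -
          have "z \<in> span {c, d}" using that h(3) by simp
          then obtain k m where km: "z = k *\<^sub>R c + m *\<^sub>R d" unfolding in_span2 by blast
          then have "m * (perp c d \<bullet> d) = 0" using \<open>perp c d \<bullet> z = 0\<close> by (simp add: inner_add_right perp_orth)
          then show ?thesis using km perp_pos [OF h(1)] by auto
        qed
        obtain k m where km: "p = k *\<^sub>R c" "q = m *\<^sub>R c" using on_line [OF pqS(1) z(1)] on_line [OF pqS(2) z(2)] by blast
        then have "m *\<^sub>R p + (- k) *\<^sub>R q = 0" by simp
        from indep2D [OF pq(1) this] have "k = 0" by simp
        then show False using km(1) indep2_nonzero [OF pq(1)] by simp
      qed
      then show ?thesis using co h(5) unfolding sign_coherent_def by fastforce
    qed
    have "\<rho> \<subseteq> \<sigma>"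
    proof
      fix y assume y: "y \<in> \<rho>"
      have "y \<in> span {p, q}" using y pq(2) span_cone2 [of p q] span_base by metis
      then have "y \<in> span {a, b}" using \<open>span {p, q} = span {a, b}\<close> by simp
      then obtain s t where st: "y = s *\<^sub>R a + t *\<^sub>R b" unfolding in_span2 by blast
      have "0 \<le> perp a b \<bullet> y" using key [OF ab(1,2) refl ab(3) y] .
      then have "0 \<le> t" using perp_pos [OF ab(1)] unfolding st by (simp add: inner_add_right perp_orth zero_le_mult_iff)
      have "0 \<le> perp b a \<bullet> y"
        using key [OF ba _ _ ab(4) y] ab(2) cone2_commute [of a b] by (simp add: insert_commute)
      then have "0 \<le> s" using perp_pos [OF ba] unfolding st by (simp add: inner_add_right perp_orth zero_le_mult_iff)
      with \<open>0 \<le> t\<close> show "y \<in> \<sigma>" unfolding ab(2) mem_cone2 using st by blast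
    qed
    then show ?thesis using s(1) by blast
  qed
  moreover have "germ_weight R = germ_weight W'" using R(2) g by simp
  ultimately have "refines 2 R W'" using refinesI [OF R(1) W'] by blast
  moreover have "refines 2 R W" using refinesI [OF R(1) W R(2)] R(3) by blast
  ultimately show ?thesis by blast
qed

text \<open>Equivalence becomes equality of a function. In particular it is transitive, and the
  class of a fan can be written down explicitly.\<close>

lemma fan_equiv_2:
  "(W, W') \<in> fan_equiv 2 \<longleftrightarrow> tropical_fan 2 W \<and> tropical_fan 2 W' \<and> germ_weight W = germ_weight W'"
proof
  assume "(W, W') \<in> fan_equiv 2"
  then obtain R where "tropical_fan 2 W" "tropical_fan 2 W'" "refines 2 R W" "refines 2 R W'" unfolding fan_equiv_def by blast
  then show "tropical_fan 2 W \<and> tropical_fan 2 W' \<and> germ_weight W = germ_weight W'" using refines_germ_weight by metis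
next
  assume "tropical_fan 2 W \<and> tropical_fan 2 W' \<and> germ_weight W = germ_weight W'"
  then show "(W, W') \<in> fan_equiv 2" unfolding fan_equiv_def using common_refinement by blast
qed

lemma cyclesE:
  assumes "C \<in> cycles 2"
  obtains W where "tropical_fan 2 W" "C = {W'. tropical_fan 2 W' \<and> germ_weight W' = germ_weight W}"
proof -
  obtain W where W: "tropical_fan 2 W" "C = fan_equiv 2 `` {W}" using assms unfolding cycles_def quotient_def by blast
  have "C = {W'. tropical_fan 2 W' \<and> germ_weight W' = germ_weight W}"
    unfolding W(2) Image_singleton fan_equiv_2 using W(1) by auto
  then show thesis using that W(1) by blast
qed

section \<open>Fans of dimension at most one\<close>

lemma low_dim_flat:
  assumes W: "tropical_fan k W" and k: "k \<le> 1" and s: "\<sigma> \<in> fst W"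
  shows "\<sigma> = {0} \<or> k = 1 \<and> (\<exists>a\<in>int_points. a \<noteq> 0 \<and> \<sigma> = ray a)" "{0} \<in> fst W"
proof -
  obtain \<rho> where "\<rho> \<in> fst W" "\<sigma> \<subseteq> \<rho>" "dim \<rho> = k" using W s unfolding tropical_fan_def pure_dim_def by blast
  then have d: "dim \<sigma> \<le> k" using dim_subset by metis
  have flat: "flat_cone \<sigma>"
    using W s d k rational_flat_cone unfolding tropical_fan_def rational_fan_def by (metis dual_order.trans one_le_numeral)
  then show "\<sigma> = {0} \<or> k = 1 \<and> (\<exists>a\<in>int_points. a \<noteq> 0 \<and> \<sigma> = ray a)"
    unfolding flat_cone_def using d k dim_cone2 dim_ray by fastforce
  have "\<forall>\<sigma>\<in>fst W. \<forall>\<tau>. \<tau> face_of \<sigma> \<and> \<tau> \<noteq> {} \<longrightarrow> \<tau> \<in> fst W" using W unfolding tropical_fan_def rational_fan_def by blast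
  then show "{0} \<in> fst W" using s zero_face_of_flat_cone [OF flat] by blast
qed

lemma low_dim_subset_eq:
  assumes W: "tropical_fan k W" "tropical_fan k R" and k: "k \<le> 1" and s: "\<sigma> \<in> fst W" "\<rho> \<in> fst R" and x: "x \<noteq> 0" "x \<in> \<sigma>" "x \<in> \<rho>"
  shows "\<sigma> = \<rho>"
proof -
  have e: "\<sigma> = ray x" if W: "tropical_fan k W" and s: "\<sigma> \<in> fst W" and x: "x \<in> \<sigma>" for W \<sigma>
  proof -
    obtain a where a: "\<sigma> = ray a" using low_dim_flat(1) [OF W k s] x \<open>x \<noteq> 0\<close> by auto
    have "x \<in> ray a" using a x by simp
    then obtain t where t: "0 \<le> t" "x = t *\<^sub>R a" unfolding mem_ray by metis
    then have "0 < t" using \<open>x \<noteq> 0\<close> by (cases "t = 0") auto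
    then show ?thesis using t a ray_scale by metis
  qed
  show ?thesis using e [OF W(1) s(1) x(2)] e [OF W(2) s(2) x(3)] by simp
qed

text \<open>A ray cannot be subdivided, so a fan of rays is determined by its support and its
  weights.\<close>

lemma low_dim_refines_eq:
  assumes R: "refines k R W" and W: "tropical_fan k W" and k: "k \<le> 1"
  shows "R = W"
proof -
  have tR: "tropical_fan k R" and un: "\<Union> (fst R) = \<Union> (fst W)" and sub: "\<And>\<rho>. \<rho> \<in> fst R \<Longrightarrow> \<exists>\<sigma>\<in>fst W. \<rho> \<subseteq> \<sigma>"
    and wt: "\<And>\<rho> \<sigma>. \<rho> \<in> fst R \<Longrightarrow> \<sigma> \<in> fst W \<Longrightarrow> dim \<rho> = k \<Longrightarrow> dim \<sigma> = k \<Longrightarrow> \<rho> \<subseteq> \<sigma> \<Longrightarrow> snd R \<rho> = snd W \<sigma>"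
    using R unfolding refines_def by auto
  have *: "\<sigma> \<in> fst W'" if h: "tropical_fan k V" "tropical_fan k W'" "\<Union> (fst V) = \<Union> (fst W')" "\<sigma> \<in> fst V" for V W' \<sigma>
  proof (cases "\<sigma> = {0}")
    case True
    then have "0 \<in> \<Union> (fst W')" using h(3,4) by blast
    then show ?thesis using low_dim_flat(2) [OF h(2) k] True by blast
  next
    case False
    then obtain a where a: "a \<noteq> 0" "\<sigma> = ray a" using low_dim_flat(1) [OF h(1) k h(4)] by blast
    have as: "a \<in> \<sigma>" unfolding a(2) by (rule ray_self)
    then obtain \<rho> where r: "\<rho> \<in> fst W'" "a \<in> \<rho>" using h(3,4) by blast
    then have "\<sigma> = \<rho>" using low_dim_subset_eq [OF h(1,2) k h(4) r(1) a(1) as] by blast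
    then show ?thesis using r by simp
  qed
  have f: "fst R = fst W" using * [OF tR W un] * [OF W tR un [symmetric]] by blast
  moreover have "snd R = snd W"
  proof
    fix \<sigma> show "snd R \<sigma> = snd W \<sigma>"
    proof (cases "\<sigma> \<in> fst W \<and> dim \<sigma> = k")
      case True then show ?thesis using wt [of \<sigma> \<sigma>] f by simp
    next
      case False
      then have "snd W \<sigma> = 0" "snd R \<sigma> = 0" using W tR f unfolding tropical_fan_def by metis+
      then show ?thesis by simp
    qed
  qed
  ultimately show ?thesis by (rule prod_eqI)
qed

lemma low_dim_refines_refl:
  assumes W: "tropical_fan k W" and k: "k \<le> 1" shows "refines k W W"
  unfolding refines_def
proof (intro conjI ballI impI)
  fix \<rho> \<sigma> assume h: "\<rho> \<in> fst W" "\<sigma> \<in> fst W" "dim \<rho> = k \<and> dim \<sigma> = k \<and> \<rho> \<subseteq> \<sigma>"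
  have "\<rho> = \<sigma>"
  proof (cases "\<rho> = {0}")
    case True
    have "dim {0::real^'a} = 0" by simp
    then have "dim \<sigma> = 0" using h(3) True by metis
    have "\<sigma> = {0}"
    proof (rule ccontr)
      assume "\<sigma> \<noteq> {0}"
      then obtain a where "a \<noteq> 0" "\<sigma> = ray a" using low_dim_flat(1) [OF W k h(2)] by blast
      then show False using \<open>dim \<sigma> = 0\<close> dim_ray [of a] by simp
    qed
    then show ?thesis using True by simp
  next
    case False
    then obtain a where a: "a \<noteq> 0" "\<rho> = ray a" using low_dim_flat(1) [OF W k h(1)] by blast
    have "a \<in> \<rho>" unfolding a(2) by (rule ray_self)
    then show ?thesis using low_dim_subset_eq [OF W W k h(1,2) a(1)] h(3) by blast
  qed
  then show "snd W \<rho> = snd W \<sigma>" by simp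
qed (use W in auto)

text \<open>Without proper refinements the class is a singleton; hence the representative chosen for
  the second product, and the one on which the weight of the origin is read off, are forced.\<close>

lemma low_dim_cycle:
  assumes W: "tropical_fan k W" and k: "k \<le> 1" shows "fan_equiv k `` {W} = {W}"
proof -
  have "W' = W" if "(W, W') \<in> fan_equiv k" for W'
    using that low_dim_refines_eq k unfolding fan_equiv_def by blast
  moreover have "(W, W) \<in> fan_equiv k" unfolding fan_equiv_def using W low_dim_refines_refl [OF W k] by blast
  ultimately show ?thesis unfolding Image_singleton by blast
qed

section \<open>The pairing matrix of a tropical surface\<close>

definition generators :: "'n::finite weighted_fan \<Rightarrow> (real ^ 'n) set" where
  "generators W = {u. primitive u \<and> ray u \<in> fst W}"

lemma primitive_int: "primitive u \<Longrightarrow> u \<in> int_points" and primitive_nonzero: "primitive u \<Longrightarrow> u \<noteq> 0"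
  unfolding primitive_def by auto

lemma primitive_ray_inj: "primitive u \<Longrightarrow> primitive u' \<Longrightarrow> ray u = ray u' \<Longrightarrow> u = u'"
  using primitive_generator by metis

lemma finite_generators: assumes "surface_fan (fst W)" shows "finite (generators W)"
proof (rule finite_surj [OF surface_fan_finite [OF assms]])
  show "generators W \<subseteq> (\<lambda>\<rho>. primitive_normal \<rho> {0}) ` fst W"
    unfolding generators_def using primitive_generator by (metis (mono_tags, lifting) image_eqI mem_Collect_eq subsetI)
qed

lemma primitive_scaleR_int:
  assumes "primitive u" "k *\<^sub>R u \<in> int_points" shows "k \<in> \<int>"
proof -
  have "k *\<^sub>R u \<in> span {u}" unfolding in_span1 by blast
  then obtain m :: int where "k *\<^sub>R u = of_int m *\<^sub>R u" using assms unfolding primitive_def by blast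
  then have "k = of_int m" using primitive_nonzero [OF assms(1)] unfolding scaleR_cancel_right by blast
  then show ?thesis by simp
qed

text \<open>Both \<open>m\<close> and \<open>m'\<close> are the index of the lattice spanned by
  \<open>u\<close>, \<open>u'\<close> in the lattice of their plane. Write
  \<open>side_normal u' u\<close> as \<open>x\<close> times \<open>side_normal u u'\<close> plus
  \<open>y\<close> times \<open>u\<close>. Expanding \<open>u\<close> then gives
  \<open>m' y + k' k = 1\<close> and \<open>m' x + k' m = 0\<close>, whence
  \<open>m = m' (m y - k x)\<close>; primitivity makes \<open>k\<close>, \<open>k'\<close>,
  \<open>y\<close> integers.\<close>

lemma side_normal_index_dvd:
  assumes u: "primitive u" and u': "primitive u'" and i: "indep2 u u'"
    and m: "u' = of_int m *\<^sub>R side_normal u u' + k *\<^sub>R u" and m': "u = of_int m' *\<^sub>R side_normal u' u + k' *\<^sub>R u'"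
  shows "m' dvd m"
proof -
  note ui = primitive_int [OF u] and ui' = primitive_int [OF u']
  have i': "indep2 u' u" using i indep2_commute by blast
  let ?v = "side_normal u u'" and ?v' = "side_normal u' u"
  have v: "?v \<in> int_points" "?v' \<in> int_points" using side_normal_int [OF ui ui' i] side_normal_int [OF ui' ui i'] by auto
  have uv: "indep2 u ?v" using side_normal_indep [OF ui ui' i] .
  have "k *\<^sub>R u = u' - of_int m *\<^sub>R ?v" using m by (simp add: algebra_simps)
  then have "k *\<^sub>R u \<in> int_points" using ui' v by (simp add: int_points_simps)
  then obtain k0 where k0: "k = of_int k0" using primitive_scaleR_int [OF u] Ints_cases by metis
  have "k' *\<^sub>R u' = u - of_int m' *\<^sub>R ?v'" using m' by (simp add: algebra_simps)
  then have "k' *\<^sub>R u' \<in> int_points" using ui v by (simp add: int_points_simps)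
  then obtain k1 where k1: "k' = of_int k1" using primitive_scaleR_int [OF u'] Ints_cases by metis
  have "?v' \<in> half_plane u' u" using side_normal_half_plane(2) [OF ui' ui i'] .
  then have "?v' \<in> span {u', u}" using half_plane_span [of u' u] span_base by metis
  then have "?v' \<in> span {u, u'}" by (simp add: insert_commute)
  then obtain x :: int and y where xy: "?v' = of_int x *\<^sub>R ?v + y *\<^sub>R u" using side_normal_gen [OF ui ui' i v(2)] by blast
  then have "y *\<^sub>R u = ?v' - of_int x *\<^sub>R ?v" by (simp add: algebra_simps)
  then have "y *\<^sub>R u \<in> int_points" using v by (simp add: int_points_simps)
  then obtain y0 where y0: "y = of_int y0" using primitive_scaleR_int [OF u] Ints_cases by metis
  have "of_int m' *\<^sub>R ?v' + k' *\<^sub>R u' =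
      of_int m' *\<^sub>R (of_int x *\<^sub>R ?v + y *\<^sub>R u) + k' *\<^sub>R (of_int m *\<^sub>R ?v + k *\<^sub>R u)"
    using m xy by metis
  also have "\<dots> = (of_int m' * y + k' * k) *\<^sub>R u + (of_int m' * of_int x + k' * of_int m) *\<^sub>R ?v"
    by (simp add: algebra_simps)
  finally have "1 *\<^sub>R u = (of_int m' * y + k' * k) *\<^sub>R u + (of_int m' * of_int x + k' * of_int m) *\<^sub>R ?v"
    using m' by simp
  then have "1 = of_int m' * y + k' * k" "of_int m' * of_int x + k' * of_int m = 0"
    using indep2_unique' [OF uv] by blast+
  then have "real_of_int (m' * y0 + k1 * k0) = of_int 1" "real_of_int (m' * x + k1 * m) = of_int 0"
    unfolding k0 k1 y0 by simp_all
  then have e: "m' * y0 + k1 * k0 = 1" "m' * x + k1 * m = 0" unfolding of_int_eq_iff by blast+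
  have "m = m * (m' * y0 + k1 * k0)" using e(1) by simp
  also have "\<dots> = m' * (m * y0) + k0 * (k1 * m)" by (simp add: algebra_simps)
  also have "k1 * m = - (m' * x)" using e(2) by linarith
  also have "m' * (m * y0) + k0 * - (m' * x) = m' * (m * y0 - k0 * x)" by (simp add: algebra_simps)
  finally show ?thesis by (rule dvdI)
qed

lemma side_normal_coefficient_index:
  assumes u: "primitive u" and u': "primitive u'" and i: "indep2 u u'"
    and a: "side_normal u u' = \<alpha> *\<^sub>R u' + s *\<^sub>R u" "0 < \<alpha>"
  shows "\<exists>(m::int) k. u' = of_int m *\<^sub>R side_normal u u' + k *\<^sub>R u \<and> of_int m * \<alpha> = 1 \<and> 0 < m"
proof -
  note ui = primitive_int [OF u] and ui' = primitive_int [OF u']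
  have "u' \<in> span {u, u'}" by (intro span_base) auto
  then obtain m :: int and k where m: "u' = of_int m *\<^sub>R side_normal u u' + k *\<^sub>R u" using side_normal_gen [OF ui ui' i ui'] by blast
  then have "u' = of_int m *\<^sub>R (\<alpha> *\<^sub>R u' + s *\<^sub>R u) + k *\<^sub>R u" unfolding a(1) .
  then have "1 *\<^sub>R u' = (of_int m * \<alpha>) *\<^sub>R u' + (of_int m * s + k) *\<^sub>R u" by (simp add: algebra_simps)
  then have ma: "of_int m * \<alpha> = 1" using indep2_unique' i indep2_commute by metis
  then have "0 < real_of_int m" using a(2) by (metis zero_less_mult_pos2 zero_less_one)
  then show ?thesis using m ma by auto
qed

text \<open>\<alpha> and \<beta> are the reciprocals of positive integers that divide each
  other.\<close>

lemma side_normal_coefficient_sym: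
  assumes u: "primitive u" and u': "primitive u'" and i: "indep2 u u'"
    and a: "side_normal u u' = \<alpha> *\<^sub>R u' + s *\<^sub>R u" "0 < \<alpha>" and b: "side_normal u' u = \<beta> *\<^sub>R u + t *\<^sub>R u'" "0 < \<beta>"
  shows "\<alpha> = \<beta>"
proof -
  have i': "indep2 u' u" using i indep2_commute by blast
  obtain m :: int and k where m: "u' = of_int m *\<^sub>R side_normal u u' + k *\<^sub>R u" "of_int m * \<alpha> = 1" "0 < m"
    using side_normal_coefficient_index [OF u u' i a] by blast
  obtain m' :: int and k' where m': "u = of_int m' *\<^sub>R side_normal u' u + k' *\<^sub>R u'" "of_int m' * \<beta> = 1" "0 < m'"
    using side_normal_coefficient_index [OF u' u i' b] by blast
  have "m' dvd m" "m dvd m'" using side_normal_index_dvd [OF u u' i m(1) m'(1)] side_normal_index_dvd [OF u' u i' m'(1) m(1)] .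
  then have "m = m'" using m(3) m'(3) by (simp add: zdvd_antisym_nonneg)
  then have "of_int m * \<alpha> = of_int m * \<beta>" using m m' by simp
  then show ?thesis using m(3) by simp
qed

definition neighbours :: "'n::finite weighted_fan \<Rightarrow> real ^ 'n \<Rightarrow> (real ^ 'n) set" where
  "neighbours W u = {u'\<in>generators W. indep2 u u' \<and> cone2 u u' \<in> fst W}"

text \<open>Each cone around \<open>u\<close> is named by the primitive generator of its second
  edge, so that a multiplicity becomes a sum over ray generators.\<close>

lemma neighbours_bij:
  assumes F: "surface_fan (fst W)" and u: "u \<in> generators W"
  shows "bij_betw (cone2 u) (neighbours W u) (facet_cofaces (fst W) (ray u))"
proof (rule bij_betw_imageI)
  have pu: "primitive u" "ray u \<in> fst W" using u unfolding generators_def by auto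
  note u0 = primitive_nonzero [OF pu(1)]
  show "inj_on (cone2 u) (neighbours W u)"
  proof (rule inj_onI)
    fix x y assume "x \<in> neighbours W u" "y \<in> neighbours W u" and e: "cone2 u x = cone2 u y"
    then have px: "primitive x" "primitive y" and ix: "indep2 u x" unfolding neighbours_def generators_def by auto
    have "x \<in> cone2 u y" using e cone2_self(2) [of x u] by simp
    then obtain s t where st: "0 \<le> s" "0 \<le> t" "x = s *\<^sub>R u + t *\<^sub>R y" unfolding mem_cone2 by metis
    have "y \<in> cone2 u x" using e cone2_self(2) [of y u] by simp
    then obtain p q where pq: "0 \<le> p" "0 \<le> q" "y = p *\<^sub>R u + q *\<^sub>R x" unfolding mem_cone2 by metis
    have "x = s *\<^sub>R u + t *\<^sub>R (p *\<^sub>R u + q *\<^sub>R x)" using st(3) pq(3) by metis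
    then have "0 *\<^sub>R u + 1 *\<^sub>R x = (s + t * p) *\<^sub>R u + (t * q) *\<^sub>R x" by (simp add: algebra_simps)
    then have tq: "0 = s + t * p" "1 = t * q" using indep2_unique [OF ix] by blast+
    then have "0 < t" using st(2) by (cases "t = 0") auto
    moreover have "0 \<le> t * p" using st pq by simp
    then have "s = 0" using tq(1) st(1) by linarith
    then have "x = t *\<^sub>R y" using st by simp
    ultimately have "ray x = ray y" using ray_scale by metis
    then show "x = y" by (rule primitive_ray_inj [OF px])
  qed
  show "cone2 u ` neighbours W u = facet_cofaces (fst W) (ray u)"
  proof (intro subset_antisym subsetI)
    fix \<sigma> assume "\<sigma> \<in> cone2 u ` neighbours W u"
    then obtain x where x: "\<sigma> = cone2 u x" "indep2 u x" "\<sigma> \<in> fst W" unfolding neighbours_def by blast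
    then show "\<sigma> \<in> facet_cofaces (fst W) (ray u)"
      unfolding facet_cofaces_ray [OF F pu(2) u0] using dim_cone2 [OF x(2)] by simp
  next
    fix \<sigma> assume s: "\<sigma> \<in> facet_cofaces (fst W) (ray u)"
    then have sF: "\<sigma> \<in> fst W" unfolding facet_cofaces_def by blast
    obtain b where b: "b \<in> int_points" "indep2 u b" "\<sigma> = cone2 u b" "ray b \<in> fst W"
      using facet_coface_form [OF F pu(2) u0 s] by metis
    have b0: "b \<noteq> 0" using indep2_nonzero [OF b(2)] by blast
    define x where "x = primitive_normal (ray b) {0}"
    have x: "primitive x" "ray x = ray b" using ray_generator [OF b(1) b0] unfolding x_def by auto
    obtain c where c: "0 < c" "x = c *\<^sub>R b" using ray_eqD [of b x] x(2) b0 by metis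
    have "cone2 u x = \<sigma>" unfolding b(3) cone2_rays x(2) ..
    moreover have "indep2 u x" using indep2_combine [OF b(2), of c 0] c by simp
    ultimately have "x \<in> neighbours W u" unfolding neighbours_def generators_def using x b(4) sF by simp
    then show "\<sigma> \<in> cone2 u ` neighbours W u" using \<open>cone2 u x = \<sigma>\<close> by blast
  qed
qed

text \<open>Multiplication by \<open>T\<close> as a symmetric matrix acting on the values of
  \<open>T\<close> at the ray generators, a discrete Laplacian of the fan. The diagonal part
  \<kappa> is kept apart because no sign is known for it.\<close>

definition is_pairing ::
    "'n::finite weighted_fan \<Rightarrow> (real ^ 'n \<Rightarrow> real ^ 'n \<Rightarrow> real) \<Rightarrow> (real ^ 'n \<Rightarrow> real) \<Rightarrow> bool" where
  "is_pairing W K \<kappa> \<longleftrightarrow>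
     (\<forall>u\<in>generators W. \<forall>u'\<in>generators W. K u u' = K u' u \<and> 0 \<le> K u u') \<and>
     (\<forall>T. (\<forall>\<sigma>\<in>fst W. linear_on_cone T \<sigma>) \<longrightarrow> (\<forall>u\<in>generators W.
        product_weight T W (ray u) = (\<Sum>u'\<in>generators W. K u u' * T u') + \<kappa> u * T u))"

text \<open>For a cone spanned by primitive vectors \<open>u, u'\<close> the primitive normal at \<open>u\<close> is
  \<open>\<alpha> u' + s u\<close>, where \<open>1 / \<alpha>\<close> is the index of the lattice generated by \<open>u, u'\<close>;
  this is why the matrix \<open>K\<close> below is symmetric.\<close>

lemma pairing_exists:
  assumes W: "tropical_fan 2 W" shows "\<exists>K \<kappa>. is_pairing W K \<kappa>"
proof -
  note F = tropical_surface_fan [OF W]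
  let ?U = "generators W"
  have fin: "finite ?U" using finite_generators [OF F] .
  have U: "primitive u" "ray u \<in> fst W" "u \<in> int_points" "u \<noteq> 0" if "u \<in> ?U" for u
    using that primitive_int primitive_nonzero unfolding generators_def by auto
  define E where "E u u' \<longleftrightarrow> u \<in> ?U \<and> u' \<in> ?U \<and> indep2 u u' \<and> cone2 u u' \<in> fst W" for u u'
  have E_sym: "E u u' \<longleftrightarrow> E u' u" for u u' unfolding E_def using indep2_commute [of u u'] cone2_commute [of u u'] by auto
  have "\<forall>p. \<exists>c. E (fst p) (snd p) \<longrightarrow> 0 < fst c \<and> side_normal (fst p) (snd p) = fst c *\<^sub>R snd p + snd c *\<^sub>R fst p"
  proof
    fix p
    show "\<exists>c. E (fst p) (snd p) \<longrightarrow> 0 < fst c \<and> side_normal (fst p) (snd p) = fst c *\<^sub>R snd p + snd c *\<^sub>R fst p"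
    proof (cases "E (fst p) (snd p)")
      case True
      then have "fst p \<in> int_points" "snd p \<in> int_points" "indep2 (fst p) (snd p)" using U unfolding E_def by auto
      from side_normal_dir [OF this] obtain s t where "0 < s" "side_normal (fst p) (snd p) = s *\<^sub>R snd p + t *\<^sub>R fst p" by blast
      then show ?thesis by (intro exI [of _ "(s, t)"]) auto
    qed simp
  qed
  from choice [OF this] obtain c where c0: "\<forall>p. E (fst p) (snd p) \<longrightarrow>
    0 < fst (c p) \<and> side_normal (fst p) (snd p) = fst (c p) *\<^sub>R snd p + snd (c p) *\<^sub>R fst p" ..
  define \<alpha> where "\<alpha> u u' = fst (c (u, u'))" for u u'
  define s where "s u u' = snd (c (u, u'))" for u u'
  have c: "0 < \<alpha> u u'" "side_normal u u' = \<alpha> u u' *\<^sub>R u' + s u u' *\<^sub>R u" if "E u u'" for u u'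
    using spec [OF c0, of "(u, u')"] that unfolding \<alpha>_def s_def by auto
  have a_sym: "\<alpha> u u' = \<alpha> u' u" if e: "E u u'" for u u'
  proof -
    have e': "E u' u" using e E_sym by blast
    have "primitive u" "primitive u'" "indep2 u u'" using e U unfolding E_def by auto
    then show ?thesis using side_normal_coefficient_sym [OF _ _ _ c(2,1) [OF e] c(2,1) [OF e']] by blast
  qed
  have "\<forall>u. \<exists>k. u \<in> ?U \<longrightarrow> weighted_normal_sum W (ray u) = k *\<^sub>R u"
  proof
    fix u
    show "\<exists>k. u \<in> ?U \<longrightarrow> weighted_normal_sum W (ray u) = k *\<^sub>R u"
    proof (cases "u \<in> ?U")
      case True
      then have "weighted_normal_sum W (ray u) \<in> span {u}"
        using W U [OF True] dim_ray [of u] span_ray [of u] unfolding tropical_fan_2 by metis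
      then show ?thesis unfolding in_span1 by blast
    qed simp
  qed
  from choice [OF this] obtain k where k: "\<forall>u. u \<in> ?U \<longrightarrow> weighted_normal_sum W (ray u) = k u *\<^sub>R u" ..
  define w where "w u u' = snd W (cone2 u u')" for u u'
  define K where "K u u' = (if E u u' then w u u' * \<alpha> u u' else 0)" for u u'
  \<comment> \<open>The components along \<open>u\<close> of the normals of the adjacent cones,
    minus the coefficient \<open>k u\<close> from the balancing relation.\<close>
  define \<kappa> where "\<kappa> u = (\<Sum>u'\<in>neighbours W u. w u u' * s u u') - k u" for u
  have K_sym: "K u u' = K u' u" for u u'
    unfolding K_def w_def using a_sym [of u u'] E_sym [of u u'] cone2_commute [of u u'] by simp
  have K_nn: "0 \<le> K u u'" for u u'
  proof (cases "E u u'")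
    case True
    then have "0 < w u u'" unfolding w_def
      using tropical_weighted_surface [OF W] dim_cone2 [of u u'] unfolding weighted_surface_def E_def by blast
    then show ?thesis unfolding K_def using c(1) [OF True] True by simp
  qed (simp add: K_def)
  have main: "product_weight T W (ray u) = (\<Sum>u'\<in>?U. K u u' * T u') + \<kappa> u * T u"
    if T: "\<forall>\<sigma>\<in>fst W. linear_on_cone T \<sigma>" and u: "u \<in> ?U" for T u
  proof -
    have N: "neighbours W u = {u'\<in>?U. E u u'}" unfolding neighbours_def E_def using u by blast
    have term_eq: "linear_ext T (cone2 u u') (primitive_normal (cone2 u u') (ray u)) = \<alpha> u u' * T u' + s u u' * T u"
      if n: "u' \<in> neighbours W u" for u'
    proof -
      have e: "E u u'" using n N by blast
      then have l: "linear_on_cone T (cone2 u u')" using T unfolding E_def by blast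
      have "linear_ext T (cone2 u u') (\<alpha> u u' *\<^sub>R u' + s u u' *\<^sub>R u)
          = \<alpha> u u' * linear_ext T (cone2 u u') u' + s u u' * linear_ext T (cone2 u u') u"
        using linear_linear_ext [OF l] by (simp add: linear_add linear_scale)
      then show ?thesis unfolding primitive_normal_cone2 c(2) [OF e]
        by (simp add: linear_ext_eq [OF l])
    qed
    have l: "linear_on_cone T (ray u)" using T U(2) [OF u] by blast
    have r: "linear_ext T (ray u) (k u *\<^sub>R u) = k u * T u"
      using linear_linear_ext [OF l] linear_ext_eq [OF l ray_self] by (simp add: linear_scale)
    have "(\<Sum>\<sigma>\<in>facet_cofaces (fst W) (ray u). snd W \<sigma> * linear_ext T \<sigma> (primitive_normal \<sigma> (ray u)))
       = (\<Sum>u'\<in>neighbours W u. w u u' * linear_ext T (cone2 u u') (primitive_normal (cone2 u u') (ray u)))"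
      unfolding w_def using sum.reindex_bij_betw [OF neighbours_bij [OF F u],
        of "\<lambda>\<sigma>. snd W \<sigma> * linear_ext T \<sigma> (primitive_normal \<sigma> (ray u))"] by simp
    also have "\<dots> = (\<Sum>u'\<in>neighbours W u. w u u' * \<alpha> u u' * T u' + w u u' * s u u' * T u)"
      using term_eq by (intro sum.cong refl) (simp add: algebra_simps)
    also have "\<dots> = (\<Sum>u'\<in>neighbours W u. w u u' * \<alpha> u u' * T u') + (\<Sum>u'\<in>neighbours W u. w u u' * s u u') * T u"
      by (simp add: sum.distrib sum_distrib_right)
    also have "(\<Sum>u'\<in>neighbours W u. w u u' * \<alpha> u u' * T u') = (\<Sum>u'\<in>?U. K u u' * T u')"
      unfolding N using fin by (intro sum.mono_neutral_cong_left) (auto simp: K_def)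
    finally show ?thesis
      unfolding product_weight_def spec [OF k, THEN mp, OF u] r \<kappa>_def by (simp add: algebra_simps)
  qed
  show ?thesis unfolding is_pairing_def
    using K_sym K_nn main by (intro exI [of _ K] exI [of _ \<kappa>]) blast
qed

lemma linear_ext_span:
  assumes "linear f" "\<And>x. x \<in> \<sigma> \<Longrightarrow> f x = T x" "x \<in> span \<sigma>"
  shows "linear_ext T \<sigma> x = f x"
proof -
  have l: "linear_on_cone T \<sigma>" unfolding linear_on_cone_def using assms(1,2) by blast
  show ?thesis
    by (rule linear_eq_on_span [OF linear_linear_ext [OF l] assms(1) _ assms(3)])
      (simp add: linear_ext_eq [OF l] assms(2))
qed

text \<open>For a function that is linear everywhere, both terms of the multiplicity are its value
  at the weighted normal sum.\<close>

lemma product_weight_linear: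
  assumes W: "tropical_fan 2 W" and u: "u \<in> generators W" and f: "linear f"
  shows "product_weight f W (ray u) = 0"
proof -
  note F = tropical_surface_fan [OF W] and ws = tropical_weighted_surface [OF W]
  have pu: "primitive u" "ray u \<in> fst W" "u \<in> int_points" "u \<noteq> 0"
    using u primitive_int primitive_nonzero unfolding generators_def by auto
  have "linear_ext f \<sigma> (primitive_normal \<sigma> (ray u)) = f (primitive_normal \<sigma> (ray u))"
    if s: "\<sigma> \<in> facet_cofaces (fst W) (ray u)" for \<sigma>
  proof (rule linear_ext_span [OF f refl])
    obtain b where b: "b \<in> int_points" "indep2 u b" "\<sigma> = cone2 u b"
      using facet_coface_form [OF F pu(2,4) s] by metis
    show "primitive_normal \<sigma> (ray u) \<in> span \<sigma>"
      unfolding b(3) primitive_normal_cone2 span_cone2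
      using side_normal_half_plane(2) [OF pu(3) b(1,2)] half_plane_span [of u b] span_base by metis
  qed
  then have "(\<Sum>\<sigma>\<in>facet_cofaces (fst W) (ray u). snd W \<sigma> * linear_ext f \<sigma> (primitive_normal \<sigma> (ray u)))
    = f (weighted_normal_sum W (ray u))"
    unfolding weighted_normal_sum_def using f by (simp add: linear_sum linear_scale)
  moreover have "linear_ext f (ray u) (weighted_normal_sum W (ray u)) = f (weighted_normal_sum W (ray u))"
    using W pu dim_ray [of u] unfolding tropical_fan_2 by (intro linear_ext_span [OF f refl]) metis
  ultimately show ?thesis unfolding product_weight_def by simp
qed

lemma pairing_linear:
  assumes W: "tropical_fan 2 W" and P: "is_pairing W K \<kappa>" and u: "u \<in> generators W" and f: "linear f"
  shows "(\<Sum>u'\<in>generators W. K u u' * f u') + \<kappa> u * f u = 0"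
proof -
  have "\<forall>\<sigma>\<in>fst W. linear_on_cone f \<sigma>" unfolding linear_on_cone_def using f by blast
  then have "product_weight f W (ray u) = (\<Sum>u'\<in>generators W. K u u' * f u') + \<kappa> u * f u"
    using P u unfolding is_pairing_def by blast
  then show ?thesis using product_weight_linear [OF W u f] by simp
qed

text \<open>Used twice: with one argument linear it yields the balancing of
  \<open>T \<cdot> F\<close>, with piecewise linear arguments the symmetry of intersection
  numbers.\<close>

lemma pairing_sym:
  assumes P: "is_pairing W K \<kappa>"
  shows "(\<Sum>u\<in>generators W. S u * ((\<Sum>u'\<in>generators W. K u u' * T u') + \<kappa> u * T u))
    = (\<Sum>u\<in>generators W. T u * ((\<Sum>u'\<in>generators W. K u u' * S u') + \<kappa> u * S u))"
proof -
  let ?U = "generators W"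
  have e: "(\<Sum>u\<in>?U. S u * ((\<Sum>u'\<in>?U. K u u' * T u') + \<kappa> u * T u))
    = (\<Sum>u\<in>?U. \<Sum>u'\<in>?U. K u u' * (S u * T u')) + (\<Sum>u\<in>?U. \<kappa> u * S u * T u)" for S T
    by (simp add: distrib_left sum.distrib sum_distrib_left mult_ac)
  have "(\<Sum>u\<in>?U. \<Sum>u'\<in>?U. K u u' * (S u * T u')) = (\<Sum>u'\<in>?U. \<Sum>u\<in>?U. K u u' * (S u * T u'))" by (rule sum.swap)
  also have "\<dots> = (\<Sum>u\<in>?U. \<Sum>u'\<in>?U. K u u' * (T u * S u'))"
    using P unfolding is_pairing_def by (intro sum.cong refl) (simp add: mult_ac)
  finally have "(\<Sum>u\<in>?U. \<Sum>u'\<in>?U. K u u' * (S u * T u')) = (\<Sum>u\<in>?U. \<Sum>u'\<in>?U. K u u' * (T u * S u'))" .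
  moreover have "(\<Sum>u\<in>?U. \<kappa> u * S u * T u) = (\<Sum>u\<in>?U. \<kappa> u * T u * S u)" by (simp add: mult_ac)
  ultimately show ?thesis unfolding e by simp
qed

section \<open>Piecewise linear functions\<close>

lemma max_of_forms_ge: "finite L \<Longrightarrow> l \<in> L \<Longrightarrow> l \<bullet> x \<le> max_of_forms L x"
  unfolding max_of_forms_def by (intro Max_ge) auto

lemma max_of_forms_attained: assumes "finite L" "L \<noteq> {}" shows "\<exists>l\<in>L. max_of_forms L x = l \<bullet> x"
proof -
  have "Max ((\<lambda>l. l \<bullet> x) ` L) \<in> (\<lambda>l. l \<bullet> x) ` L" using assms by (intro Max_in) auto
  then show ?thesis unfolding max_of_forms_def by blast
qed

lemma max_of_forms_eqI:
  assumes "finite L" "l \<in> L" "\<And>l'. l' \<in> L \<Longrightarrow> l' \<bullet> x \<le> l \<bullet> x" shows "max_of_forms L x = l \<bullet> x"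
  unfolding max_of_forms_def using assms by (intro Max_eqI) auto

lemma max_of_forms_scale:
  assumes L: "finite L" "L \<noteq> {}" and t: "0 \<le> t" shows "max_of_forms L (t *\<^sub>R x) = t * max_of_forms L x"
proof -
  obtain l where l: "l \<in> L" "max_of_forms L x = l \<bullet> x" using max_of_forms_attained [OF L] by blast
  have "max_of_forms L (t *\<^sub>R x) = l \<bullet> (t *\<^sub>R x)"
  proof (rule max_of_forms_eqI [OF L(1) l(1)])
    fix l' assume "l' \<in> L"
    then have "l' \<bullet> x \<le> l \<bullet> x" using max_of_forms_ge [OF L(1)] l(2) by metis
    then show "l' \<bullet> (t *\<^sub>R x) \<le> l \<bullet> (t *\<^sub>R x)" using t by (simp add: mult_left_mono)
  qed
  then show ?thesis using l(2) by simp
qed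

lemma linear_inner: "linear (\<lambda>x. l \<bullet> x)"
  by (intro linearI) (simp_all add: inner_add_right)

text \<open>The forms are pairwise comparable on the whole cone, so finitely many of them have a
  largest one.\<close>

lemma coherent_linear_on_cone:
  assumes L: "finite L" "L \<noteq> {}" and coh: "\<And>l l'. l \<in> L \<Longrightarrow> l' \<in> L \<Longrightarrow> sign_coherent (l - l') \<sigma>"
  shows "linear_on_cone (max_of_forms L) \<sigma>"
proof -
  have "\<exists>l\<in>L. \<forall>l'\<in>L. \<forall>x\<in>\<sigma>. l' \<bullet> x \<le> l \<bullet> x" using L coh
  proof (induction L rule: finite_ne_induct)
    case (singleton l) then show ?case by simp
  next
    case (insert m L)
    have "\<exists>l\<in>L. \<forall>l'\<in>L. \<forall>x\<in>\<sigma>. l' \<bullet> x \<le> l \<bullet> x" by (rule insert.IH) (use insert.prems in simp)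
    then obtain l where l: "l \<in> L" "\<And>l' x. l' \<in> L \<Longrightarrow> x \<in> \<sigma> \<Longrightarrow> l' \<bullet> x \<le> l \<bullet> x" by blast
    have "sign_coherent (m - l) \<sigma>" using insert.prems l(1) by simp
    then consider "\<And>x. x \<in> \<sigma> \<Longrightarrow> l \<bullet> x \<le> m \<bullet> x" | "\<And>x. x \<in> \<sigma> \<Longrightarrow> m \<bullet> x \<le> l \<bullet> x"
      unfolding sign_coherent_def inner_diff_left by force
    then show ?case
    proof cases
      case 1
      have "l' \<bullet> x \<le> m \<bullet> x" if "l' \<in> insert m L" "x \<in> \<sigma>" for l' x
        using that l(2) [of l' x] 1 [of x] by auto
      then show ?thesis by blast
    next
      case 2
      have "l' \<bullet> x \<le> l \<bullet> x" if "l' \<in> insert m L" "x \<in> \<sigma>" for l' x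
        using that l(2) [of l' x] 2 [of x] by auto
      then show ?thesis using l(1) by blast
    qed
  qed
  then obtain l where l: "l \<in> L" "\<And>l' x. l' \<in> L \<Longrightarrow> x \<in> \<sigma> \<Longrightarrow> l' \<bullet> x \<le> l \<bullet> x" by blast
  have "l \<bullet> x = max_of_forms L x" if "x \<in> \<sigma>" for x
    using max_of_forms_eqI [OF L(1) l(1), of x] l(2) that by simp
  then show ?thesis unfolding linear_on_cone_def using linear_inner by blast
qed

text \<open>A form attaining the maximum at the interior point \<open>a + b\<close> attains it at
  \<open>a\<close> and \<open>b\<close> too, since \<open>T\<close> is additive on the cone and
  dominates the form at both. For integral \<open>L\<close> the linear extension is therefore
  integral on lattice points, which makes multiplicities integers.\<close>

lemma linear_on_cone_form:
  assumes L: "finite L" "L \<noteq> {}" and flat: "flat_cone \<sigma>" and lin: "linear_on_cone (max_of_forms L) \<sigma>"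
  shows "\<exists>l\<in>L. \<forall>x\<in>\<sigma>. max_of_forms L x = l \<bullet> x"
proof -
  let ?T = "max_of_forms L"
  consider (0) "\<sigma> = {0}" | (1) a where "\<sigma> = ray a" | (2) a b where "\<sigma> = cone2 a b"
    using flat unfolding flat_cone_def by blast
  then show ?thesis
  proof cases
    case 0
    then show ?thesis using max_of_forms_attained [OF L, of 0] by auto
  next
    case 1
    obtain l where l: "l \<in> L" "?T a = l \<bullet> a" using max_of_forms_attained [OF L] by blast
    have "?T x = l \<bullet> x" if x: "x \<in> \<sigma>" for x
    proof -
      obtain t where "0 \<le> t" "x = t *\<^sub>R a" using x unfolding 1 mem_ray by metis
      then show ?thesis using max_of_forms_scale [OF L] l(2) by simp
    qed
    then show ?thesis using l(1) by blast
  next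
    case 2
    obtain f where f: "linear f" "\<And>x. x \<in> \<sigma> \<Longrightarrow> f x = ?T x" using lin unfolding linear_on_cone_def by blast
    obtain l where l: "l \<in> L" "?T (a + b) = l \<bullet> (a + b)" using max_of_forms_attained [OF L] by blast
    have m: "a \<in> \<sigma>" "b \<in> \<sigma>" "a + b \<in> \<sigma>" unfolding 2 by (simp_all add: convex_cone_add [OF convex_cone_cone2])
    have "?T a + ?T b = f a + f b" using f(2) m by simp
    also have "\<dots> = f (a + b)" using f(1) by (simp add: linear_add)
    also have "\<dots> = l \<bullet> a + l \<bullet> b" using f(2) [OF m(3)] l(2) by (simp add: inner_add_right)
    finally have "?T a = l \<bullet> a" "?T b = l \<bullet> b"
      using max_of_forms_ge [OF L(1) l(1), of a] max_of_forms_ge [OF L(1) l(1), of b] by linarith+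
    then have fab: "f a = l \<bullet> a" "f b = l \<bullet> b" using f(2) m by auto
    have "?T x = l \<bullet> x" if x: "x \<in> \<sigma>" for x
    proof -
      obtain s t where "x = s *\<^sub>R a + t *\<^sub>R b" using x unfolding 2 mem_cone2 by metis
      then have "f x = l \<bullet> x" using f(1) fab by (simp add: linear_add linear_scale inner_add_right)
      then show ?thesis using f(2) [OF x] by simp
    qed
    then show ?thesis using l(1) by blast
  qed
qed

lemma max_of_forms_linear_on_low_dim:
  assumes L: "finite L" "L \<noteq> {}" and s: "\<sigma> = {0} \<or> (\<exists>a\<in>int_points. a \<noteq> 0 \<and> \<sigma> = ray a)"
  shows "linear_on_cone (max_of_forms L) \<sigma>"
proof -
  obtain a where a: "\<And>x. x \<in> \<sigma> \<Longrightarrow> \<exists>t\<ge>0. x = t *\<^sub>R a"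
  proof (cases "\<sigma> = {0}")
    case True
    then have "\<And>x. x \<in> \<sigma> \<Longrightarrow> \<exists>t\<ge>0. x = t *\<^sub>R 0" by auto
    then show thesis by (rule that)
  next
    case False
    then obtain a where "\<sigma> = ray a" using s by blast
    then have "\<And>x. x \<in> \<sigma> \<Longrightarrow> \<exists>t\<ge>0. x = t *\<^sub>R a" by (simp add: mem_ray)
    then show thesis by (rule that)
  qed
  obtain l where l: "l \<in> L" "max_of_forms L a = l \<bullet> a" using max_of_forms_attained [OF L] by blast
  have "l \<bullet> x = max_of_forms L x" if x: "x \<in> \<sigma>" for x
  proof -
    obtain t where "0 \<le> t" "x = t *\<^sub>R a" using a [OF x] by metis
    then show ?thesis using max_of_forms_scale [OF L] l(2) by simp
  qed
  then show ?thesis unfolding linear_on_cone_def using linear_inner by blast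
qed

lemma linear_representative_exists:
  assumes W: "tropical_fan 2 W" and A: "finite A" and L: "\<And>L. L \<in> A \<Longrightarrow> finite L \<and> L \<noteq> {} \<and> L \<subseteq> int_points"
  obtains R where "tropical_fan 2 R" "germ_weight R = germ_weight W"
    "\<And>L \<sigma>. L \<in> A \<Longrightarrow> \<sigma> \<in> fst R \<Longrightarrow> linear_on_cone (max_of_forms L) \<sigma>"
proof -
  let ?D = "\<Union>L\<in>A. (\<lambda>p. fst p - snd p) ` (L \<times> L)"
  have "finite ?D" using A L by blast
  moreover have "?D \<subseteq> int_points"
  proof
    fix d assume "d \<in> ?D"
    then obtain M l l' where "M \<in> A" "l \<in> M" "l' \<in> M" "d = l - l'" by auto
    then show "d \<in> int_points" using L [of M] by (auto intro: int_points_simps)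
  qed
  ultimately obtain R where R: "tropical_fan 2 R" "germ_weight R = germ_weight W"
      "\<And>l \<rho>. l \<in> ?D \<Longrightarrow> \<rho> \<in> fst R \<Longrightarrow> sign_coherent l \<rho>"
    by (rule coherent_refinement [OF W]) (rule that)
  have "linear_on_cone (max_of_forms M) \<sigma>" if M: "M \<in> A" and s: "\<sigma> \<in> fst R" for M \<sigma>
  proof (rule coherent_linear_on_cone)
    show "finite M" "M \<noteq> {}" using L [OF M] by auto
    fix l l' assume "l \<in> M" "l' \<in> M"
    then have "(\<lambda>p. fst p - snd p) (l, l') \<in> ?D" using M by blast
    then show "sign_coherent (l - l') \<sigma>" using R(3) s by simp
  qed
  with R(1,2) show thesis by (rule that)
qed

section \<open>Products and intersection numbers\<close>

context
  fixes W :: "'n::finite weighted_fan" and L :: "(real ^ 'n) set" and T :: "real ^ 'n \<Rightarrow> real"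
  assumes W: "tropical_fan 2 W" and L: "finite L" "L \<noteq> {}" "L \<subseteq> int_points" and T: "T = max_of_forms L"
    and lin: "\<And>\<sigma>. \<sigma> \<in> fst W \<Longrightarrow> linear_on_cone T \<sigma>"
begin

lemma linear_ext_int:
  assumes s: "\<sigma> \<in> fst W" and x: "x \<in> span \<sigma>" "x \<in> int_points" shows "linear_ext T \<sigma> x \<in> \<int>"
proof -
  obtain l where l: "l \<in> L" "\<And>x. x \<in> \<sigma> \<Longrightarrow> T x = l \<bullet> x"
    using linear_on_cone_form [OF L(1,2) surface_fan_flat [OF tropical_surface_fan [OF W] s]] lin [OF s] unfolding T by blast
  have "linear_ext T \<sigma> x = l \<bullet> x" using l(2) x(1) by (intro linear_ext_span [OF linear_inner]) auto
  then show ?thesis using int_points_inner l(1) L(3) x(2) by auto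
qed

lemma product_weight_int:
  assumes u: "u \<in> generators W" shows "product_weight T W (ray u) \<in> \<int>"
proof -
  have pu: "primitive u" "ray u \<in> fst W" "u \<in> int_points" "u \<noteq> 0"
    using u primitive_int primitive_nonzero unfolding generators_def by auto
  note F = tropical_surface_fan [OF W]
  have cof: "\<sigma> \<in> fst W \<and> snd W \<sigma> \<in> \<int> \<and> primitive_normal \<sigma> (ray u) \<in> int_points \<and> primitive_normal \<sigma> (ray u) \<in> span \<sigma>"
    if s: "\<sigma> \<in> facet_cofaces (fst W) (ray u)" for \<sigma>
  proof -
    obtain b where b: "b \<in> int_points" "indep2 u b" "\<sigma> = cone2 u b"
      using facet_coface_form [OF F pu(2,4) s] by metis
    have "side_normal u b \<in> int_points" using side_normal_int [OF pu(3) b(1,2)] .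
    moreover have "side_normal u b \<in> span (cone2 u b)" unfolding span_cone2
      using side_normal_half_plane(2) [OF pu(3) b(1,2)] half_plane_span [of u b] span_base by metis
    moreover have sF: "\<sigma> \<in> fst W" "dim \<sigma> = 2" using s unfolding facet_cofaces_ray [OF F pu(2,4)] by auto
    moreover have "snd W \<sigma> \<in> \<int>" using tropical_weighted_surface [OF W] sF unfolding weighted_surface_def by blast
    ultimately show ?thesis unfolding b(3) primitive_normal_cone2 by simp
  qed
  have "(\<Sum>\<sigma>\<in>facet_cofaces (fst W) (ray u). snd W \<sigma> * linear_ext T \<sigma> (primitive_normal \<sigma> (ray u))) \<in> \<int>"
    using cof linear_ext_int by (intro Ints_sum Ints_mult) auto
  moreover have "weighted_normal_sum W (ray u) \<in> int_points" unfolding weighted_normal_sum_def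
    using cof by (intro int_points_sum int_points_simps) auto
  moreover have "weighted_normal_sum W (ray u) \<in> span (ray u)"
    using W pu(2) dim_ray [OF pu(4)] unfolding tropical_fan_2 by blast
  ultimately show ?thesis unfolding product_weight_def using linear_ext_int [OF pu(2)] by (intro Ints_diff) auto
qed

text \<open>Subtracting a linear form which is maximal at \<open>u\<close> does not change the product and
  makes \<open>T\<close> non-negative and zero at \<open>u\<close>.\<close>

lemma product_weight_nonneg:
  assumes u: "u \<in> generators W" shows "0 \<le> product_weight T W (ray u)"
proof -
  obtain K \<kappa> where P: "is_pairing W K \<kappa>" using pairing_exists [OF W] by blast
  obtain l where l: "l \<in> L" "T u = l \<bullet> u" using max_of_forms_attained [OF L(1,2)] unfolding T by blast
  let ?U = "generators W"
  have "product_weight T W (ray u) = (\<Sum>u'\<in>?U. K u u' * T u') + \<kappa> u * T u"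
    using P lin u unfolding is_pairing_def by blast
  also have "\<dots> = ((\<Sum>u'\<in>?U. K u u' * T u') + \<kappa> u * T u) - ((\<Sum>u'\<in>?U. K u u' * (l \<bullet> u')) + \<kappa> u * (l \<bullet> u))"
    using pairing_linear [OF W P u linear_inner [of l]] by simp
  also have "\<dots> = (\<Sum>u'\<in>?U. K u u' * (T u' - l \<bullet> u'))"
    using l(2) by (simp add: sum_subtractf right_diff_distrib)
  also have "0 \<le> \<dots>"
  proof (intro sum_nonneg mult_nonneg_nonneg)
    fix u' assume "u' \<in> ?U"
    then show "0 \<le> K u u'" using P u unfolding is_pairing_def by blast
    show "0 \<le> T u' - l \<bullet> u'" using max_of_forms_ge [OF L(1) l(1)] unfolding T by simp
  qed
  finally show ?thesis by simp
qed

definition "supp = {\<tau>\<in>fst W. Suc (dim \<tau>) = 2 \<and> product_weight T W \<tau> \<noteq> 0}"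

lemma fan_product_2:
  "fst (fan_product 2 T W) = {\<rho>\<in>fst W. \<exists>\<tau>\<in>supp. \<rho> \<subseteq> \<tau>}"
  "snd (fan_product 2 T W) = (\<lambda>\<tau>. if \<tau> \<in> supp then product_weight T W \<tau> else 0)"
  unfolding fan_product_def supp_def Let_def by simp_all

lemma supp_generator: assumes "\<tau> \<in> supp" shows "\<exists>u\<in>generators W. \<tau> = ray u"
proof -
  have t: "\<tau> \<in> fst W" "dim \<tau> = 1" using assms unfolding supp_def by auto
  then obtain a where a: "a \<in> int_points" "a \<noteq> 0" "\<tau> = ray a"
    using flat_cone_dim1 surface_fan_flat [OF tropical_surface_fan [OF W]] by metis
  then show ?thesis using ray_generator [OF a(1,2)] t unfolding generators_def by (metis (mono_tags, lifting) mem_Collect_eq)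
qed

lemma supp_ray: "u \<in> generators W \<Longrightarrow> ray u \<in> supp \<longleftrightarrow> product_weight T W (ray u) \<noteq> 0"
  unfolding supp_def generators_def using dim_ray primitive_nonzero by auto

lemma supp_sum:
  fixes f :: "real ^ 'n \<Rightarrow> 'b::real_vector"
  shows "(\<Sum>\<tau>\<in>supp. product_weight T W \<tau> *\<^sub>R f (primitive_normal \<tau> {0})) = (\<Sum>u\<in>generators W. product_weight T W (ray u) *\<^sub>R f u)"
proof -
  let ?V = "{u\<in>generators W. product_weight T W (ray u) \<noteq> 0}"
  have b: "bij_betw ray ?V supp"
  proof (rule bij_betw_imageI)
    show "inj_on ray ?V" using primitive_ray_inj by (intro inj_onI) (auto simp: generators_def)
    show "ray ` ?V = supp" using supp_ray supp_generator by blast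
  qed
  have "(\<Sum>\<tau>\<in>supp. product_weight T W \<tau> *\<^sub>R f (primitive_normal \<tau> {0})) =
      (\<Sum>u\<in>?V. product_weight T W (ray u) *\<^sub>R f (primitive_normal (ray u) {0}))"
    using sum.reindex_bij_betw [OF b, of "\<lambda>\<tau>. product_weight T W \<tau> *\<^sub>R f (primitive_normal \<tau> {0})"] by simp
  also have "\<dots> = (\<Sum>u\<in>?V. product_weight T W (ray u) *\<^sub>R f u)"
    by (intro sum.cong refl) (simp add: generators_def primitive_generator)
  also have "\<dots> = (\<Sum>u\<in>generators W. product_weight T W (ray u) *\<^sub>R f u)"
    using finite_generators [OF tropical_surface_fan [OF W]] by (intro sum.mono_neutral_left) auto
  finally show ?thesis .
qed

lemma supp_subset: "supp \<subseteq> fst (fan_product 2 T W)"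
  unfolding fan_product_2 by (auto simp: supp_def)

lemma fan_product_cofaces: "facet_cofaces (fst (fan_product 2 T W)) {0} = supp"
proof (intro subset_antisym subsetI)
  fix \<sigma> assume "\<sigma> \<in> facet_cofaces (fst (fan_product 2 T W)) {0}"
  then have s: "\<sigma> \<in> fst W" "dim \<sigma> = 1" "\<exists>\<tau>\<in>supp. \<sigma> \<subseteq> \<tau>" unfolding facet_cofaces_def fan_product_2 by auto
  then obtain \<tau> where t: "\<tau> \<in> supp" "\<sigma> \<subseteq> \<tau>" by blast
  obtain b where b: "\<tau> = ray b" using supp_generator [OF t(1)] by blast
  obtain a where a: "a \<noteq> 0" "\<sigma> = ray a" using flat_cone_dim1 [OF surface_fan_flat [OF tropical_surface_fan [OF W] s(1)] s(2)] by metis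
  have "a \<in> ray b" using t(2) ray_self [of a] unfolding a(2) b by blast
  then obtain c where c: "0 \<le> c" "a = c *\<^sub>R b" unfolding mem_ray by metis
  then have "0 < c" using a(1) by (cases "c = 0") auto
  then have "\<sigma> = \<tau>" unfolding a(2) b using c(2) ray_scale by metis
  then show "\<sigma> \<in> supp" using t by simp
next
  fix \<sigma> assume s: "\<sigma> \<in> supp"
  then obtain u where u: "u \<in> generators W" "\<sigma> = ray u" using supp_generator by blast
  have "dim (ray u) = 1" using u primitive_nonzero dim_ray unfolding generators_def by blast
  moreover have "{0} face_of ray u" by (rule zero_face_of_ray)
  ultimately show "\<sigma> \<in> facet_cofaces (fst (fan_product 2 T W)) {0}"
    using s supp_subset unfolding facet_cofaces_def u(2) by auto
qed

text \<open>This is the balancing of \<open>T \<cdot> F\<close>. Its inner product with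
  \<open>z\<close> pairs the linear function of \<open>z\<close> with the multiplicities of
  \<open>T\<close>; by symmetry it pairs \<open>T\<close> with the multiplicities of a linear
  function, which are zero.\<close>

lemma fan_product_normal_sum:
  "weighted_normal_sum (fan_product 2 T W) {0} = 0"
proof -
  obtain K \<kappa> where P: "is_pairing W K \<kappa>" using pairing_exists [OF W] by blast
  let ?U = "generators W"
  have pw: "product_weight T W (ray u) = (\<Sum>u'\<in>?U. K u u' * T u') + \<kappa> u * T u" if "u \<in> ?U" for u
    using P lin that unfolding is_pairing_def by blast
  have "weighted_normal_sum (fan_product 2 T W) {0} = (\<Sum>\<tau>\<in>supp. product_weight T W \<tau> *\<^sub>R primitive_normal \<tau> {0})"
    unfolding weighted_normal_sum_def fan_product_cofaces unfolding fan_product_2 by (intro sum.cong refl) simp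
  also have "\<dots> = (\<Sum>u\<in>?U. product_weight T W (ray u) *\<^sub>R u)" using supp_sum [of "\<lambda>x. x"] by simp
  also have "\<dots> = 0"
  proof (rule vector_eq_ldot [THEN iffD1], rule allI)
    fix z :: "real ^ 'n"
    have "z \<bullet> (\<Sum>u\<in>?U. product_weight T W (ray u) *\<^sub>R u) = (\<Sum>u\<in>?U. (z \<bullet> u) * ((\<Sum>u'\<in>?U. K u u' * T u') + \<kappa> u * T u))"
      using pw by (simp add: inner_sum_right mult.commute)
    also have "\<dots> = (\<Sum>u\<in>?U. T u * ((\<Sum>u'\<in>?U. K u u' * (z \<bullet> u')) + \<kappa> u * (z \<bullet> u)))"
      by (rule pairing_sym [OF P])
    also have "\<dots> = 0" using pairing_linear [OF W P _ linear_inner [of z]] by simp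
    finally show "z \<bullet> (\<Sum>u\<in>?U. product_weight T W (ray u) *\<^sub>R u) = z \<bullet> 0" by simp
  qed
  finally show ?thesis .
qed

lemma fan_product_tropical: "tropical_fan 1 (fan_product 2 T W)"
  unfolding tropical_fan_def
proof (intro conjI)
  let ?P = "fan_product 2 T W"
  have sub: "fst ?P \<subseteq> fst W" unfolding fan_product_2 by blast
  have rat: "rational_fan (fst W)" using W unfolding tropical_fan_def by blast
  have "\<tau> \<in> fst ?P" if h: "\<sigma> \<in> fst ?P" "\<tau> face_of \<sigma>" "\<tau> \<noteq> {}" for \<sigma> \<tau>
  proof -
    have "\<tau> \<in> fst W" using rat h sub unfolding rational_fan_def by blast
    moreover have "\<tau> \<subseteq> \<sigma>" using h(2) face_of_imp_subset by blast
    ultimately show ?thesis using h(1) unfolding fan_product_2 by blast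
  qed
  moreover have "finite (fst ?P)" using rat sub finite_subset unfolding rational_fan_def by blast
  ultimately show "rational_fan (fst ?P)" using rat sub unfolding rational_fan_def by (simp add: subset_eq)
  show "pure_dim 1 (fst ?P)" unfolding pure_dim_def
  proof
    fix \<rho> assume "\<rho> \<in> fst ?P"
    then obtain \<tau> where "\<tau> \<in> supp" "\<rho> \<subseteq> \<tau>" unfolding fan_product_2 by blast
    then show "\<exists>\<sigma>\<in>fst ?P. \<rho> \<subseteq> \<sigma> \<and> dim \<sigma> = 1" using supp_subset unfolding supp_def by auto
  qed
  have top: "\<sigma> \<in> supp" if "\<sigma> \<in> fst ?P" "dim \<sigma> = 1" for \<sigma>
  proof -
    have "flat_cone \<sigma>" using surface_fan_flat [OF tropical_surface_fan [OF W]] that(1) sub by blast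
    then have "\<sigma> \<in> facet_cofaces (fst ?P) {0}" unfolding facet_cofaces_def using that zero_face_of_flat_cone by simp
    then show ?thesis unfolding fan_product_cofaces .
  qed
  show "\<forall>\<sigma>\<in>fst ?P. dim \<sigma> = 1 \<longrightarrow> snd ?P \<sigma> \<in> \<int> \<and> 0 < snd ?P \<sigma>"
  proof (intro ballI impI)
    fix \<sigma> assume "\<sigma> \<in> fst ?P" "dim \<sigma> = 1"
    then have s: "\<sigma> \<in> supp" by (rule top)
    then obtain u where u: "u \<in> generators W" "\<sigma> = ray u" using supp_generator by blast
    have "product_weight T W \<sigma> \<noteq> 0" using s unfolding supp_def by blast
    then show "snd ?P \<sigma> \<in> \<int> \<and> 0 < snd ?P \<sigma>"
      using product_weight_int [OF u(1)] product_weight_nonneg [OF u(1)] s unfolding fan_product_2 u(2) by auto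
  qed
  show "\<forall>\<sigma>. \<not> (\<sigma> \<in> fst ?P \<and> dim \<sigma> = 1) \<longrightarrow> snd ?P \<sigma> = 0"
    using supp_subset unfolding fan_product_2(2) by (auto simp: supp_def)
  show "\<forall>\<tau>\<in>fst ?P. Suc (dim \<tau>) = 1 \<longrightarrow> weighted_normal_sum ?P \<tau> \<in> span \<tau>"
  proof (intro ballI impI)
    fix \<tau> assume t: "\<tau> \<in> fst ?P" "Suc (dim \<tau>) = 1"
    have "flat_cone \<tau>" using surface_fan_flat [OF tropical_surface_fan [OF W]] t(1) sub by blast
    then have "\<tau> = {0}" unfolding flat_cone_def using t(2) dim_ray dim_cone2 by fastforce
    then show "weighted_normal_sum ?P \<tau> \<in> span \<tau>" using fan_product_normal_sum by simp
  qed
qed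

section \<open>The second product and its value at the origin\<close>

context
  fixes S :: "real ^ 'n \<Rightarrow> real" and L' :: "(real ^ 'n) set"
  assumes L': "finite L'" "L' \<subseteq> int_points" "0 \<in> L'" and S: "S = max_of_forms L'"
begin

lemma max_form_nonneg: "0 \<le> S x"
  using max_of_forms_ge [OF L'(1,3), of x] unfolding S by simp

lemma max_form_int: assumes "x \<in> int_points" shows "S x \<in> \<int>"
proof -
  obtain l where "l \<in> L'" "S x = l \<bullet> x" using max_of_forms_attained [of L' x] L' unfolding S by blast
  then show ?thesis using int_points_inner assms L' by auto
qed

lemma max_form_linear_on_product:
  assumes "\<sigma> \<in> fst (fan_product 2 T W)" shows "linear_on_cone S \<sigma>"
  unfolding S using low_dim_flat(1) [OF fan_product_tropical order_refl assms] L'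
  by (intro max_of_forms_linear_on_low_dim) auto

text \<open>The correction term drops out because the weighted normal sum at the origin is
  zero.\<close>

lemma product_weight_zero:
  "product_weight S (fan_product 2 T W) {0} = (\<Sum>u\<in>generators W. product_weight T W (ray u) * S u)"
proof -
  let ?P = "fan_product 2 T W"
  have "linear_on_cone S {0}"
    unfolding S using L' by (intro max_of_forms_linear_on_low_dim) auto
  then have z: "linear_ext S {0} 0 = 0" using linear_linear_ext linear_0 by blast
  have "linear_ext S \<tau> (primitive_normal \<tau> {0}) = S (primitive_normal \<tau> {0})" if t: "\<tau> \<in> supp" for \<tau>
  proof (rule linear_ext_eq)
    show "linear_on_cone S \<tau>" using max_form_linear_on_product t supp_subset by blast
    obtain u where u: "u \<in> generators W" "\<tau> = ray u" using supp_generator [OF t] by blast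
    have "primitive_normal (ray u) {0} = u" using u primitive_generator unfolding generators_def by blast
    then show "primitive_normal \<tau> {0} \<in> \<tau>" using u ray_self [of u] by simp
  qed
  then have "(\<Sum>\<sigma>\<in>facet_cofaces (fst ?P) {0}. snd ?P \<sigma> * linear_ext S \<sigma> (primitive_normal \<sigma> {0}))
     = (\<Sum>\<tau>\<in>supp. product_weight T W \<tau> *\<^sub>R S (primitive_normal \<tau> {0}))"
    unfolding fan_product_cofaces fan_product_2(2) by (intro sum.cong refl) simp
  then show ?thesis unfolding product_weight_def [of S "fan_product 2 T W" "{0}"] fan_product_normal_sum z supp_sum by simp
qed

text \<open>The number is a non-negative integer, so the last product is again a tropical fan: the
  origin alone, or the empty fan if the number is 0.\<close>

lemma fan_product_zero_tropical:
  "tropical_fan 0 (fan_product 1 S (fan_product 2 T W))"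
  "snd (fan_product 1 S (fan_product 2 T W)) {0} = (\<Sum>u\<in>generators W. product_weight T W (ray u) * S u)"
proof -
  let ?P = "fan_product 2 T W" and ?c = "\<Sum>u\<in>generators W. product_weight T W (ray u) * S u"
  let ?Q = "fan_product 1 S ?P"
  define Z where "Z = {\<tau>\<in>fst ?P. Suc (dim \<tau>) = 1 \<and> product_weight S ?P \<tau> \<noteq> 0}"
  have Q: "fst ?Q = {\<rho>\<in>fst ?P. \<exists>\<tau>\<in>Z. \<rho> \<subseteq> \<tau>}" "snd ?Q = (\<lambda>\<tau>. if \<tau> \<in> Z then product_weight S ?P \<tau> else 0)"
    unfolding fan_product_def [of 1] Z_def Let_def by simp_all
  note tP = fan_product_tropical
  have rat: "rational_fan (fst ?P)" using tP unfolding tropical_fan_def by blast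
  have zero: "\<tau> = {0}" if "\<tau> \<in> fst ?P" "dim \<tau> = 0" for \<tau>
    using low_dim_flat(1) [OF tP order_refl that(1)] that(2) dim_ray by fastforce
  have Z0: "\<tau> = {0}" if "\<tau> \<in> Z" for \<tau> using that zero unfolding Z_def by auto
  have d0: "dim {0::real^'n} = 0" by simp
  have c0: "0 \<le> ?c" using product_weight_nonneg max_form_nonneg by (intro sum_nonneg) auto
  have cZ: "?c \<in> \<int>" using product_weight_int max_form_int primitive_int unfolding generators_def by (intro Ints_sum Ints_mult) auto
  show s: "snd ?Q {0} = ?c"
  proof (cases "{0} \<in> fst ?P")
    case True
    then have "{0} \<in> Z \<longleftrightarrow> ?c \<noteq> 0" unfolding Z_def using product_weight_zero d0 by simp
    then show ?thesis unfolding Q using product_weight_zero by auto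
  next
    \<comment> \<open>The first product is the zero cycle, an empty fan; the weight of the origin is
      then 0 by normalisation, and so is the sum because no ray has a non-zero multiplicity.\<close>
    case False
    then have "fst ?P = {}" using low_dim_flat(2) [OF tP order_refl] by blast
    then have "facet_cofaces (fst ?P) {0} = {}" unfolding facet_cofaces_def by blast
    then have "supp = {}" using fan_product_cofaces by simp
    then have "?c = 0" using supp_sum [of S] by simp
    moreover have "{0} \<notin> Z" using False unfolding Z_def by blast
    ultimately show ?thesis unfolding Q by simp
  qed
  show "tropical_fan 0 ?Q"
    unfolding tropical_fan_def
  proof (intro conjI)
    have sub: "fst ?Q \<subseteq> fst ?P" unfolding Q by blast
    have "\<tau> \<in> fst ?Q" if h: "\<sigma> \<in> fst ?Q" "\<tau> face_of \<sigma>" "\<tau> \<noteq> {}" for \<sigma> \<tau>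
    proof -
      have "\<tau> \<in> fst ?P" using rat h sub unfolding rational_fan_def by blast
      moreover have "\<tau> \<subseteq> \<sigma>" using h(2) face_of_imp_subset by blast
      ultimately show ?thesis using h(1) unfolding Q by blast
    qed
    moreover have "finite (fst ?Q)" using rat sub finite_subset unfolding rational_fan_def by blast
    ultimately show "rational_fan (fst ?Q)" using rat sub unfolding rational_fan_def by (simp add: subset_eq)
    show "pure_dim 0 (fst ?Q)" unfolding pure_dim_def
    proof
      fix \<rho> assume "\<rho> \<in> fst ?Q"
      then obtain \<tau> where "\<tau> \<in> Z" "\<rho> \<subseteq> \<tau>" unfolding Q by blast
      moreover then have "\<tau> \<in> fst ?Q" "dim \<tau> = 0" unfolding Q Z_def by auto
      ultimately show "\<exists>\<sigma>\<in>fst ?Q. \<rho> \<subseteq> \<sigma> \<and> dim \<sigma> = 0" by blast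
    qed
    show "\<forall>\<sigma>\<in>fst ?Q. dim \<sigma> = 0 \<longrightarrow> snd ?Q \<sigma> \<in> \<int> \<and> 0 < snd ?Q \<sigma>"
    proof (intro ballI impI)
      fix \<sigma> assume h: "\<sigma> \<in> fst ?Q" "dim \<sigma> = 0"
      then have e: "\<sigma> = {0}" using zero sub by blast
      obtain \<tau> where "\<tau> \<in> Z" using h(1) unfolding Q by blast
      then have "{0} \<in> Z" using Z0 by metis
      then have "snd ?Q {0} \<noteq> 0" unfolding Q Z_def by auto
      then show "snd ?Q \<sigma> \<in> \<int> \<and> 0 < snd ?Q \<sigma>" unfolding e s using c0 cZ by simp
    qed
    show "\<forall>\<sigma>. \<not> (\<sigma> \<in> fst ?Q \<and> dim \<sigma> = 0) \<longrightarrow> snd ?Q \<sigma> = 0"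
    proof (intro allI impI)
      fix \<sigma> assume h: "\<not> (\<sigma> \<in> fst ?Q \<and> dim \<sigma> = 0)"
      have "\<sigma> \<notin> Z" using h unfolding Q Z_def by auto
      then show "snd ?Q \<sigma> = 0" unfolding Q by simp
    qed
  qed simp
qed

end

end

text \<open>The number \<open>S \<cdot> T \<cdot> F\<close> written in germs. Restricting to
  non-zero multiplicities makes the index set finite as soon as \<open>T\<close> is linear on the
  cones of some tropical fan with germ weights \<open>g\<close>.\<close>

definition germ_pairing ::
    "(real ^ 'n \<Rightarrow> real ^ 'n \<Rightarrow> real) \<Rightarrow> (real ^ 'n \<Rightarrow> real) \<Rightarrow> (real ^ 'n \<Rightarrow> real) \<Rightarrow> real" where
  "germ_pairing g S T = (\<Sum>u | primitive u \<and> germ_mult T g u \<noteq> 0. S u * germ_mult T g u)"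

lemma germ_pairing_eq:
  assumes W: "tropical_fan 2 W" and lin: "\<And>\<sigma>. \<sigma> \<in> fst W \<Longrightarrow> linear_on_cone T \<sigma>"
  shows "germ_pairing (germ_weight W) S T = (\<Sum>u\<in>generators W. S u * product_weight T W (ray u))"
proof -
  note ws = tropical_weighted_surface [OF W]
  have pw: "product_weight T W (ray u) = germ_mult T (germ_weight W) u" if "u \<in> generators W" for u
    using that product_weight_ray [OF ws primitive_int primitive_nonzero _ lin tropical_normal_sum [OF W primitive_int primitive_nonzero]]
    unfolding generators_def by blast
  have "{u. primitive u \<and> germ_mult T (germ_weight W) u \<noteq> 0} \<subseteq> generators W"
    using germ_mult_nonzero_ray [OF ws primitive_int primitive_nonzero lin] unfolding generators_def by blast
  then have "germ_pairing (germ_weight W) S T = (\<Sum>u\<in>generators W. S u * germ_mult T (germ_weight W) u)"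
    unfolding germ_pairing_def using finite_generators [OF tropical_surface_fan [OF W]]
    by (intro sum.mono_neutral_left) (auto simp: generators_def)
  then show ?thesis using pw by simp
qed

text \<open>The representative picked by \<open>cycle_product\<close> is unknown but has the germ
  weights of \<open>W\<close>, and these determine the number. The condition
  \<open>0 \<in> L'\<close> makes \<open>S\<close> non-negative, so that the weight of the origin is
  non-negative as well.\<close>

lemma intersection_number_eq:
  assumes W: "tropical_fan 2 W" and C: "C = {W'. tropical_fan 2 W' \<and> germ_weight W' = germ_weight W}"
    and L: "finite L" "L \<noteq> {}" "L \<subseteq> int_points" "T = max_of_forms L"
    and L': "finite L'" "L' \<subseteq> int_points" "0 \<in> L'" "S = max_of_forms L'"
  shows "intersection_number S T C = germ_pairing (germ_weight W) S T"
proof -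
  obtain R where R: "tropical_fan 2 R" "germ_weight R = germ_weight W"
    "\<And>M \<sigma>. M \<in> {L} \<Longrightarrow> \<sigma> \<in> fst R \<Longrightarrow> linear_on_cone (max_of_forms M) \<sigma>"
    by (rule linear_representative_exists [OF W, of "{L}"]) (use L in auto)
  define V where "V = (SOME W. W \<in> C \<and> (\<forall>\<sigma>\<in>fst W. linear_on_cone T \<sigma>))"
  have "R \<in> C \<and> (\<forall>\<sigma>\<in>fst R. linear_on_cone T \<sigma>)" using R unfolding C L(4) by simp
  then have V: "V \<in> C \<and> (\<forall>\<sigma>\<in>fst V. linear_on_cone T \<sigma>)" unfolding V_def by (rule someI)
  then have tV: "tropical_fan 2 V" and gV: "germ_weight V = germ_weight W"
    and lV: "\<And>\<sigma>. \<sigma> \<in> fst V \<Longrightarrow> linear_on_cone T \<sigma>" unfolding C by auto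
  let ?P = "fan_product 2 T V"
  have tP: "tropical_fan 1 ?P" by (rule fan_product_tropical [OF tV L lV])
  have P: "cycle_product 2 T C = {?P}"
    unfolding cycle_product_def V_def [symmetric] using low_dim_cycle [OF tP] by simp
  have lP: "\<forall>\<sigma>\<in>fst ?P. linear_on_cone S \<sigma>" using max_form_linear_on_product [OF tV L lV L'] by blast
  have "(SOME W. W \<in> {?P} \<and> (\<forall>\<sigma>\<in>fst W. linear_on_cone S \<sigma>)) = ?P"
    using lP by (intro some_equality) auto
  moreover have tQ: "tropical_fan 0 (fan_product 1 S ?P)" by (rule fan_product_zero_tropical(1) [OF tV L lV L'])
  ultimately have Q: "cycle_product 1 S {?P} = {fan_product 1 S ?P}"
    unfolding cycle_product_def using low_dim_cycle [OF tQ] by simp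
  have "intersection_number S T C = snd (fan_product 1 S ?P) {0}"
    unfolding intersection_number_def P Q origin_weight_def by simp
  also have "\<dots> = (\<Sum>u\<in>generators V. product_weight T V (ray u) * S u)"
    by (rule fan_product_zero_tropical(2) [OF tV L lV L'])
  also have "\<dots> = germ_pairing (germ_weight W) S T"
    using germ_pairing_eq [OF tV lV, of S] unfolding gV by (simp add: mult.commute)
  finally show ?thesis .
qed

section \<open>Bounding weights and planes\<close>

lemma convex_hull_le_max_of_forms:
  assumes "finite L" "p \<in> convex hull L" shows "p \<bullet> x \<le> max_of_forms L x"
proof -
  have "L \<subseteq> {p. x \<bullet> p \<le> max_of_forms L x}" using max_of_forms_ge [OF assms(1)] by (auto simp: inner_commute)
  then have "convex hull L \<subseteq> {p. x \<bullet> p \<le> max_of_forms L x}" by (rule hull_minimal) (rule convex_halfspace_le)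
  then show ?thesis using assms(2) by (auto simp: inner_commute)
qed

text \<open>The right-hand side is the support function of the Minkowski sum, which contains a ball
  around an interior point \<open>m\<close>; moving from \<open>m\<close> in the direction of
  \<open>x\<close> gains a multiple of \<open>norm x\<close>.\<close>

lemma full_dimensional_support_bound:
  assumes L: "finite L\<^sub>1" "finite L\<^sub>2"
    and d: "aff_dim {p + q | p q. p \<in> convex hull L\<^sub>1 \<and> q \<in> convex hull L\<^sub>2} = int CARD('n)"
  shows "\<exists>m c. 0 < c \<and> (\<forall>x::real^'n. m \<bullet> x + c * norm x \<le> max_of_forms L\<^sub>1 x + max_of_forms L\<^sub>2 x)"
proof -
  let ?Q = "{p + q | p q. p \<in> convex hull L\<^sub>1 \<and> q \<in> convex hull L\<^sub>2}"
  have Qe: "?Q = (\<Union>p\<in>convex hull L\<^sub>1. \<Union>q\<in>convex hull L\<^sub>2. {p + q})" by blast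
  have cv: "convex ?Q" unfolding Qe by (intro convex_sums convex_convex_hull)
  have "?Q \<noteq> {}"
  proof
    assume "?Q = {}"
    then have "aff_dim ?Q = -1" by (simp only: aff_dim_empty)
    then show False using d by linarith
  qed
  then have "rel_interior ?Q \<noteq> {}" using rel_interior_eq_empty [OF cv] by simp
  then have "interior ?Q \<noteq> {}" using interior_rel_interior_gen [of ?Q] d by simp
  then obtain m where "m \<in> interior ?Q" by blast
  then obtain e where e: "0 < e" "ball m e \<subseteq> ?Q" unfolding mem_interior by (elim exE conjE)
  have "m \<bullet> x + (e/2) * norm x \<le> max_of_forms L\<^sub>1 x + max_of_forms L\<^sub>2 x" for x
  proof -
    \<comment> \<open>Half the radius keeps \<open>y\<close> inside the open ball. For
      \<open>x = 0\<close> division by zero gives \<open>y = m\<close>, which is harmless.\<close>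
    define y where "y = m + (e / 2 / norm x) *\<^sub>R x"
    have "norm ((e / 2 / norm x) *\<^sub>R x) \<le> e / 2" using e(1) by simp
    then have "y \<in> ball m e" using e(1) unfolding y_def by (simp add: dist_norm)
    then have "y \<in> ?Q" using e(2) by blast
    then obtain p q where pq: "y = p + q" "p \<in> convex hull L\<^sub>1" "q \<in> convex hull L\<^sub>2" by blast
    have "y \<bullet> x = m \<bullet> x + (e / 2) * norm x" unfolding y_def
      by (cases "x = 0") (auto simp: inner_add_left dot_square_norm power2_eq_square)
    moreover have "y \<bullet> x \<le> max_of_forms L\<^sub>1 x + max_of_forms L\<^sub>2 x"
      unfolding pq(1) inner_add_left
      using convex_hull_le_max_of_forms [OF L(1) pq(2)] convex_hull_le_max_of_forms [OF L(2) pq(3)] by (rule add_mono)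
    ultimately show ?thesis by simp
  qed
  then show ?thesis using e(1) by (intro exI [of _ m] exI [of _ "e/2"]) auto
qed

lemma dir_deriv_max:
  assumes "l \<bullet> u = 0" shows "dir_deriv (max_of_forms {0, l}) u x = max 0 (l \<bullet> x)"
proof -
  have T: "max_of_forms {0, l} y = max 0 (l \<bullet> y)" for y unfolding max_of_forms_def by simp
  have "(max_of_forms {0, l} (u + e *\<^sub>R x) - max_of_forms {0, l} u) / e = max 0 (l \<bullet> x)" if "0 < e" for e
    using that assms unfolding T by (simp add: inner_add_right max_def zero_le_mult_iff)
  then have "((\<lambda>e. (max_of_forms {0, l} (u + e *\<^sub>R x) - max_of_forms {0, l} u) / e) \<longlongrightarrow> max 0 (l \<bullet> x)) (at_right 0)"
    by (intro tendsto_eventually) (auto simp: eventually_at_right_field intro: exI [of _ 1])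
  then show ?thesis unfolding dir_deriv_def by (intro tendsto_Lim) auto
qed

text \<open>The product of the cycle with \<open>max 0 l\<close>, where \<open>l\<close> vanishes on a ray \<open>u\<close> inside a
  cone, contains that ray with a multiplicity which is the weight of the cone times a lattice height.\<close>

lemma germ_mult_max_interior:
  assumes W: "weighted_surface W" and c: "cone2 a b \<in> fst W" "a \<in> int_points" "b \<in> int_points" "indep2 a b"
    and u: "u \<in> int_points" "0 < s" "0 < t" "u = s *\<^sub>R a + t *\<^sub>R b"
  shows "indep2 u b" "germ_mult (max_of_forms {0, perp u b}) (germ_weight W) u = snd W (cone2 a b) * (perp u b \<bullet> side_normal u b)"
    "0 < perp u b \<bullet> side_normal u b" "span {u, b} = span {a, b}"
proof -
  have u0: "u \<noteq> 0"
  proof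
    assume "u = 0"
    then have "s *\<^sub>R a + t *\<^sub>R b = 0" using u(4) by simp
    from indep2D [OF c(4) this] show False using u(2) by simp
  qed
  note i = interior_normals [OF W u(1) u0 c u(2-4)]
  show ub: "indep2 u b" by (rule i(1))
  show "span {u, b} = span {a, b}" by (rule i(8))
  have mb: "- b \<in> int_points" "indep2 u (- b)" using int_points_simps(4) c(3) indep2_combine [OF ub, of "-1" 0] by auto
  let ?l = "perp u b"
  obtain p q where pq: "0 < p" "side_normal u b = p *\<^sub>R b + q *\<^sub>R u" using side_normal_dir [OF u(1) c(3) ub] by blast
  obtain p' q' where pq': "0 < p'" "side_normal u (- b) = p' *\<^sub>R (- b) + q' *\<^sub>R u" using side_normal_dir [OF u(1) mb] by blast
  have lb: "0 < ?l \<bullet> b" using perp_pos [OF ub] .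
  show v: "0 < ?l \<bullet> side_normal u b" unfolding pq(2) using pq(1) lb by (simp add: inner_add_right perp_orth)
  \<comment> \<open>Of the two normals only the one on the positive side contributes to the maximum
    with 0. The correction term vanishes because the normal sum lies on the line of
    \<open>u\<close>, where \<open>?l\<close> is zero.\<close>
  have v': "?l \<bullet> side_normal u (- b) < 0" unfolding pq'(2) using pq'(1) lb by (simp add: inner_diff_right inner_add_right perp_orth)
  have "germ_normal_sum (germ_weight W) u \<in> span {u}" by (rule germ_normal_sum_interior [OF W u(1) u0 c u(2-4)])
  then obtain k where "germ_normal_sum (germ_weight W) u = k *\<^sub>R u" unfolding in_span1 by blast
  then have "?l \<bullet> germ_normal_sum (germ_weight W) u = 0" by (simp add: perp_orth)
  then show "germ_mult (max_of_forms {0, ?l}) (germ_weight W) u = snd W (cone2 a b) * (?l \<bullet> side_normal u b)"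
    unfolding germ_mult_def i(2) dir_deriv_max [OF perp_orth] using i(3,6,7) v v' by simp
qed

lemma weight_bound:
  fixes W :: "'n::finite weighted_fan"
  assumes W: "tropical_fan 2 W"
    and L1: "finite L\<^sub>1" "L\<^sub>1 \<noteq> {}" "L\<^sub>1 \<subseteq> int_points" and L2: "finite L\<^sub>2" "L\<^sub>2 \<noteq> {}" "L\<^sub>2 \<subseteq> int_points"
    and c: "0 < c" "\<And>x. m \<bullet> x + c * norm x \<le> max_of_forms L\<^sub>1 x + max_of_forms L\<^sub>2 x"
    and B12: "germ_pairing (germ_weight W) (max_of_forms L\<^sub>1) (max_of_forms L\<^sub>2) \<le> 1"
    and B11: "germ_pairing (germ_weight W) (max_of_forms L\<^sub>1) (max_of_forms L\<^sub>1) \<le> 1"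
    and B22: "germ_pairing (germ_weight W) (max_of_forms L\<^sub>2) (max_of_forms L\<^sub>2) \<le> 1"
    and u: "primitive u" and l: "l \<in> int_points"
    and pos: "0 < germ_mult (max_of_forms {0, l}) (germ_weight W) u"
  shows "c * norm u * germ_mult (max_of_forms {0, l}) (germ_weight W) u \<le> 4 * norm l / c"
proof -
  \<comment> \<open>All three functions must be linear on the same fan, so that one matrix computes
    every number below.\<close>
  let ?A = "{L\<^sub>1, L\<^sub>2, {0, l}}"
  have Aint: "finite L \<and> L \<noteq> {} \<and> L \<subseteq> int_points" if "L \<in> ?A" for L
    using that L1 L2 l int_points_simps(1) by auto
  obtain R where R: "tropical_fan 2 R" "germ_weight R = germ_weight W"
    "\<And>L \<sigma>. L \<in> ?A \<Longrightarrow> \<sigma> \<in> fst R \<Longrightarrow> linear_on_cone (max_of_forms L) \<sigma>"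
    by (rule linear_representative_exists [OF W, of ?A]) (simp, erule Aint, rule that)
  obtain K \<kappa> where P: "is_pairing R K \<kappa>" using pairing_exists [OF R(1)] by blast
  let ?U = "generators R"
  define M1 M2 T where M: "M1 = max_of_forms L\<^sub>1" "M2 = max_of_forms L\<^sub>2" "T = max_of_forms {0, l}"
  \<comment> \<open>The vector \<open>m\<close> need not be integral, so \<open>N\<close> is in
    general not a tropical regular function; its numbers are taken from the bilinear form
    \<open>Q\<close> and not from cycle products.\<close>
  define N where "N x = M1 x + M2 x - m \<bullet> x" for x
  define D where "D S x = (\<Sum>u'\<in>?U. K x u' * S u') + \<kappa> x * S x" for S x
  define Q where "Q S T = (\<Sum>x\<in>?U. S x * D T x)" for S T
  have lin: "\<And>\<sigma>. \<sigma> \<in> fst R \<Longrightarrow> linear_on_cone M1 \<sigma>" "\<And>\<sigma>. \<sigma> \<in> fst R \<Longrightarrow> linear_on_cone M2 \<sigma>"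
    "\<And>\<sigma>. \<sigma> \<in> fst R \<Longrightarrow> linear_on_cone T \<sigma>" using R(3) unfolding M by simp_all
  have pw: "product_weight S R (ray x) = D S x"
    if "x \<in> ?U" and S: "\<And>\<sigma>. \<sigma> \<in> fst R \<Longrightarrow> linear_on_cone S \<sigma>" for x S
    using P that unfolding is_pairing_def D_def by blast
  have gp: "germ_pairing (germ_weight W) S S' = Q S S'"
    if S': "\<And>\<sigma>. \<sigma> \<in> fst R \<Longrightarrow> linear_on_cone S' \<sigma>" for S S'
    using germ_pairing_eq [OF R(1) S', of S] pw [OF _ S'] unfolding R(2) Q_def by simp
  have Q_sym: "Q S S' = Q S' S" for S S' unfolding Q_def D_def by (rule pairing_sym [OF P])
  have D_lin: "D (\<lambda>x. m \<bullet> x) x = 0" if "x \<in> ?U" for x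
    unfolding D_def by (rule pairing_linear [OF R(1) P that linear_inner])
  have D_N: "D N x = D M1 x + D M2 x" if "x \<in> ?U" for x
  proof -
    have "D N x = D M1 x + D M2 x - D (\<lambda>x. m \<bullet> x) x"
      unfolding D_def N_def by (simp add: algebra_simps sum.distrib sum_subtractf)
    then show ?thesis using D_lin [OF that] by simp
  qed
  have D_nonneg: "0 \<le> D M1 x" "0 \<le> D M2 x" "0 \<le> D T x" if x: "x \<in> ?U" for x
    using product_weight_nonneg [OF R(1) L1 M(1) lin(1) x] pw [OF x lin(1)]
      product_weight_nonneg [OF R(1) L2 M(2) lin(2) x] pw [OF x lin(2)]
      product_weight_nonneg [OF R(1) _ _ _ M(3) lin(3) x] pw [OF x lin(3)] Aint [of "{0, l}"] by auto
  have N_ge: "c * norm x \<le> N x" for x using c(2) [of x] unfolding N_def M by simp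
  have Q_m: "Q (\<lambda>x. m \<bullet> x) S = 0" for S
  proof -
    have "Q (\<lambda>x. m \<bullet> x) S = Q S (\<lambda>x. m \<bullet> x)" by (rule Q_sym)
    then show ?thesis unfolding Q_def using D_lin by simp
  qed
  \<comment> \<open>The multiplicities of \<open>N\<close> come from \<open>M1\<close> and
    \<open>M2\<close> alone, and by symmetry the linear part of the first argument contributes
    nothing. There remain three numbers bounded by 1, the mixed one counted twice.\<close>
  have "Q N N = (\<Sum>x\<in>?U. N x * (D M1 x + D M2 x))" unfolding Q_def using D_N by simp
  also have "\<dots> = Q M1 M1 + Q M1 M2 + Q M2 M1 + Q M2 M2 - Q (\<lambda>x. m \<bullet> x) M1 - Q (\<lambda>x. m \<bullet> x) M2"
    unfolding Q_def N_def by (simp add: algebra_simps sum.distrib sum_subtractf)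
  also have "\<dots> = Q M1 M1 + 2 * Q M1 M2 + Q M2 M2" using Q_sym [of M2 M1] Q_m by simp
  also have "\<dots> \<le> 4"
    using B12 B11 B22 gp [OF lin(2), of M1] gp [OF lin(1), of M1] gp [OF lin(2), of M2] unfolding M by linarith
  finally have QNN: "Q N N \<le> 4" .
  have T_le: "T x \<le> norm l / c * N x" for x
  proof -
    have "l \<bullet> x \<le> norm l * norm x" by (rule norm_cauchy_schwarz)
    moreover have "0 \<le> norm l * norm x" by simp
    ultimately have "T x \<le> norm l * norm x" unfolding M max_of_forms_def by simp
    also have "\<dots> = norm l / c * (c * norm x)" using c(1) by simp
    also have "\<dots> \<le> norm l / c * N x" using N_ge c(1) by (intro mult_left_mono) auto
    finally show ?thesis .
  qed
  \<comment> \<open>After the exchange the larger function \<open>N\<close> can replace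
    \<open>T\<close> in the first argument, because the multiplicities \<open>D N\<close>, sums of
    those of \<open>M1\<close> and \<open>M2\<close>, are non-negative.\<close>
  have "Q N T = Q T N" by (rule Q_sym)
  also have "\<dots> \<le> (\<Sum>x\<in>?U. (norm l / c * N x) * D N x)" unfolding Q_def
    using T_le D_N D_nonneg by (intro sum_mono mult_right_mono) auto
  also have "\<dots> = norm l / c * Q N N" unfolding Q_def by (simp add: sum_distrib_left mult.assoc)
  also have "\<dots> \<le> norm l / c * 4" using QNN c(1) by (intro mult_left_mono) auto
  finally have upper: "Q N T \<le> 4 * norm l / c" by (simp add: mult.commute)
  have uU: "u \<in> ?U"
    using germ_mult_nonzero_ray [OF tropical_weighted_surface [OF R(1)] primitive_int [OF u] primitive_nonzero [OF u] lin(3)]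
      pos u unfolding generators_def R(2) M by simp
  have "germ_mult T (germ_weight W) u = product_weight T R (ray u)"
    using product_weight_ray [OF tropical_weighted_surface [OF R(1)] primitive_int [OF u] primitive_nonzero [OF u] _ lin(3)
        tropical_normal_sum [OF R(1) primitive_int [OF u] primitive_nonzero [OF u]]] uU
    unfolding generators_def R(2) by simp
  then have mu: "germ_mult T (germ_weight W) u = D T u" using pw [OF uU lin(3)] by simp
  have N_nonneg: "0 \<le> N x" for x
  proof -
    have "0 \<le> c * norm x" using c(1) by simp
    then show ?thesis using N_ge [of x] by linarith
  qed
  \<comment> \<open>All terms of \<open>Q N T\<close> are non-negative, so the term of the ray
    \<open>u\<close> alone is at most the sum.\<close>
  have "c * norm u * D T u \<le> N u * D T u" using N_ge D_nonneg(3) [OF uU] by (rule mult_right_mono)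
  also have "\<dots> \<le> Q N T" unfolding Q_def
    using N_nonneg D_nonneg(3) finite_generators [OF tropical_surface_fan [OF R(1)]]
    by (intro member_le_sum [OF uU, of "\<lambda>x. N x * D T x"]) auto
  finally have "c * norm u * D T u \<le> 4 * norm l / c" using upper by (rule order_trans)
  then show ?thesis unfolding mu [symmetric] unfolding M .
qed

text \<open>The rows of the matrix of Pluecker coordinates of the plane spanned by \<open>u\<close> and \<open>v\<close>; they span this plane.\<close>

definition minor_row :: "real ^ 'n \<Rightarrow> real ^ 'n \<Rightarrow> 'n \<Rightarrow> real ^ 'n" where
  "minor_row u v i = (u $ i) *\<^sub>R v - (v $ i) *\<^sub>R u"

lemma minor_row_int: "u \<in> int_points \<Longrightarrow> v \<in> int_points \<Longrightarrow> minor_row u v i \<in> int_points"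
  unfolding minor_row_def by (intro int_points_simps) (auto simp: int_points_def)

text \<open>The contraction of the bivector of \<open>u\<close> and \<open>v\<close> with
  \<open>z\<close>.\<close>

lemma minor_row_sum: "(\<Sum>i\<in>UNIV. (z $ i) *\<^sub>R minor_row u v i) = (z \<bullet> u) *\<^sub>R v - (z \<bullet> v) *\<^sub>R u"
  unfolding minor_row_def inner_vec_def
  by (simp add: scaleR_diff_right sum_subtractf scaleR_sum_left)

text \<open>Contracting with \<open>perp u v\<close> removes \<open>v\<close> and leaves a non-zero
  multiple of \<open>u\<close>; contracting with \<open>u\<close> then yields
  \<open>v\<close>.\<close>

lemma span_minor_rows:
  fixes u v :: "real ^ 'n"
  assumes "indep2 u v" shows "span (range (minor_row u v)) = span {u, v}"
proof (rule subset_antisym; rule span_minimal)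
  let ?S = "span (range (minor_row u v))"
  show "range (minor_row u v) \<subseteq> span {u, v}"
    unfolding minor_row_def by (auto intro!: span_diff span_scale intro: span_base)
  have comb: "(z \<bullet> u) *\<^sub>R v - (z \<bullet> v) *\<^sub>R u \<in> ?S" for z
    unfolding minor_row_sum [symmetric] by (intro span_sum span_scale span_base) auto
  have "- (perp u v \<bullet> v) *\<^sub>R u \<in> ?S" using comb [of "perp u v"] by (simp add: perp_orth)
  then have "(- 1 / (perp u v \<bullet> v)) *\<^sub>R (- (perp u v \<bullet> v) *\<^sub>R u) \<in> ?S" by (rule span_scale)
  then have u: "u \<in> ?S" using perp_pos [OF assms] by simp
  have "(u \<bullet> u) *\<^sub>R v - (u \<bullet> v) *\<^sub>R u + (u \<bullet> v) *\<^sub>R u \<in> ?S" by (intro span_add comb span_scale u)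
  then have "(u \<bullet> u) *\<^sub>R v \<in> ?S" by simp
  then have "(1 / (u \<bullet> u)) *\<^sub>R ((u \<bullet> u) *\<^sub>R v) \<in> ?S" by (rule span_scale)
  then have "v \<in> ?S" using indep2_nonzero [OF assms] by simp
  then show "{u, v} \<subseteq> ?S" using u by simp
qed auto

lemma finite_bounded_int_points: "finite {x\<in>int_points :: (real ^ 'n) set. norm x \<le> B}"
proof -
  let ?A = "{k\<in>\<int>. \<bar>k\<bar> \<le> B}"
  have "finite ?A" by (rule finite_abs_int_segment)
  then have "finite (PiE (UNIV :: 'n set) (\<lambda>_. ?A))" by (intro finite_PiE) auto
  moreover have "{x\<in>int_points :: (real ^ 'n) set. norm x \<le> B} \<subseteq> (\<lambda>f. \<chi> i. f i) ` (PiE (UNIV :: 'n set) (\<lambda>_. ?A))"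
  proof
    fix x :: "real ^ 'n" assume x: "x \<in> {x\<in>int_points. norm x \<le> B}"
    have "($) x \<in> PiE UNIV (\<lambda>_. ?A)"
    proof (intro PiE_I)
      fix i show "x $ i \<in> ?A" using x component_le_norm_cart [of x i] unfolding int_points_def by auto
    qed simp
    moreover have "x = (\<chi> i. x $ i)" by simp
    ultimately show "x \<in> (\<lambda>f. \<chi> i. f i) ` (PiE UNIV (\<lambda>_. ?A))" by blast
  qed
  ultimately show ?thesis by (rule finite_surj)
qed

lemma int_points_norm_ge_1: assumes "x \<in> int_points" "x \<noteq> 0" shows "1 \<le> norm x"
proof -
  obtain i where "x $ i \<noteq> 0" using assms(2) by (metis vec_eq_iff zero_index)
  moreover have "x $ i \<in> \<int>" using assms(1) unfolding int_points_def by blast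
  ultimately have "1 \<le> \<bar>x $ i\<bar>" by (simp add: Ints_nonzero_abs_ge1)
  then show ?thesis using component_le_norm_cart [of x i] by linarith
qed

text \<open>The minor rows of a lattice basis are integral, span the plane and have norm at most
  \<open>8 / c\<^sup>2\<close>, so the plane is spanned by a subset of a finite set. In
  \<open>8 = 2 * 4\<close> the 4 comes from \<open>weight_bound\<close> and the 2 from the triangle
  inequality for a row.\<close>

lemma plane_and_weight_bound:
  fixes W :: "'n::finite weighted_fan"
  assumes W: "tropical_fan 2 W"
    and L1: "finite L\<^sub>1" "L\<^sub>1 \<noteq> {}" "L\<^sub>1 \<subseteq> int_points" and L2: "finite L\<^sub>2" "L\<^sub>2 \<noteq> {}" "L\<^sub>2 \<subseteq> int_points"
    and c: "0 < c" "\<And>x. m \<bullet> x + c * norm x \<le> max_of_forms L\<^sub>1 x + max_of_forms L\<^sub>2 x"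
    and B: "germ_pairing (germ_weight W) (max_of_forms L\<^sub>1) (max_of_forms L\<^sub>2) \<le> 1"
      "germ_pairing (germ_weight W) (max_of_forms L\<^sub>1) (max_of_forms L\<^sub>1) \<le> 1"
      "germ_pairing (germ_weight W) (max_of_forms L\<^sub>2) (max_of_forms L\<^sub>2) \<le> 1"
    and \<sigma>: "\<sigma> \<in> fst W" "dim \<sigma> = 2"
  shows "span \<sigma> \<in> span ` Pow {x\<in>int_points. norm x \<le> 8 / c\<^sup>2}" "snd W \<sigma> \<le> 8 / c\<^sup>2"
proof -
  obtain a b where ab: "a \<in> int_points" "b \<in> int_points" "indep2 a b" "\<sigma> = cone2 a b"
    using flat_cone_dim2 surface_fan_flat [OF tropical_surface_fan [OF W] \<sigma>(1)] \<sigma>(2) by metis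
  have ab0: "a + b \<in> int_points" "a + b \<noteq> 0"
    using ab int_points_simps(2) indep2D [OF ab(3), of 1 1] by auto
  \<comment> \<open>The primitive vector on the ray of \<open>a + b\<close>, a ray in the interior
    of the cone.\<close>
  define u where "u = primitive_normal (ray (a + b)) {0}"
  have u: "primitive u" "ray u = ray (a + b)" using ray_generator [OF ab0] unfolding u_def by auto
  obtain k where "0 < k" "u = k *\<^sub>R (a + b)" using ray_eqD [of "a + b" u] u(2) ab0(2) by metis
  then have k: "0 < k" "u = k *\<^sub>R a + k *\<^sub>R b" by (simp_all add: scaleR_right_distrib)
  let ?l = "perp u b" and ?v = "side_normal u b" and ?w = "snd W \<sigma>"
  note i = germ_mult_max_interior [OF tropical_weighted_surface [OF W] \<sigma>(1) [unfolded ab(4)] ab(1-3) primitive_int [OF u(1)] k(1,1,2)]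
  have w: "0 < ?w" "?w \<in> \<int>" using tropical_weighted_surface [OF W] \<sigma> unfolding weighted_surface_def by auto
  have "c * norm u * (?w * (?l \<bullet> ?v)) \<le> 4 * norm ?l / c"
    using weight_bound [OF W L1 L2 c B u(1) perp_int [OF primitive_int [OF u(1)] ab(2)]] i(2,3) w(1) ab(4) by simp
  then have bound: "?w * (norm u * (?l \<bullet> ?v)) * c\<^sup>2 \<le> 4 * norm ?l"
    using c(1) by (simp add: field_simps power2_eq_square)
  obtain s t where st: "0 < s" "?v = s *\<^sub>R b + t *\<^sub>R u" using side_normal_dir [OF primitive_int [OF u(1)] ab(2) i(1)] by blast
  have uu: "0 < u \<bullet> u" using primitive_nonzero [OF u(1)] by simp
  have lv: "?l \<bullet> ?v = s * (norm ?l)\<^sup>2 / (u \<bullet> u)"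
  proof -
    have "?l \<bullet> ?v = s * (?l \<bullet> b)" unfolding st(2) by (simp add: inner_add_right perp_orth)
    moreover have "?l \<bullet> b = (?l \<bullet> ?l) / (u \<bullet> u)" using perp_norm [of u b] uu by simp
    ultimately show ?thesis by (simp add: power2_norm_eq_inner)
  qed
  have "?l \<noteq> 0" using perp_pos [OF i(1)] by auto
  then have l0: "0 < norm ?l" by simp
  have "norm ?l * (?w * (norm u * (s * norm ?l / (u \<bullet> u))) * c\<^sup>2) \<le> norm ?l * 4"
    using bound unfolding lv by (simp add: power2_eq_square mult_ac)
  \<comment> \<open>The distance of \<open>?v\<close> from the line of \<open>u\<close> is
    \<open>s * norm ?l / (u \<bullet> u)\<close>; multiplied by \<open>norm u\<close> it is the area
    of the parallelogram of \<open>u\<close> and \<open>?v\<close>, that is, the covolume of the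
    lattice of the plane.\<close>
  then have key: "?w * (norm u * (s * norm ?l / (u \<bullet> u))) * c\<^sup>2 \<le> 4"
    unfolding mult_le_cancel_left_pos [OF l0] .
  have row: "?w * norm (minor_row u ?v j) \<le> 8 / c\<^sup>2" for j
  proof -
    have "minor_row u ?v j = (s / (u \<bullet> u)) *\<^sub>R ((u $ j) *\<^sub>R ?l - (?l $ j) *\<^sub>R u)"
      unfolding minor_row_def st(2) perp_def using uu by (simp add: algebra_simps)
    then have "norm (minor_row u ?v j) = s / (u \<bullet> u) * norm ((u $ j) *\<^sub>R ?l - (?l $ j) *\<^sub>R u)"
      using st(1) uu by simp
    also have "\<dots> \<le> s / (u \<bullet> u) * (2 * (norm u * norm ?l))"
    proof (rule mult_left_mono)
      have "norm ((u $ j) *\<^sub>R ?l - (?l $ j) *\<^sub>R u) \<le> \<bar>u $ j\<bar> * norm ?l + \<bar>?l $ j\<bar> * norm u"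
        using norm_triangle_ineq4 [of "(u $ j) *\<^sub>R ?l" "(?l $ j) *\<^sub>R u"] by simp
      also have "\<dots> \<le> norm u * norm ?l + norm ?l * norm u"
        by (intro add_mono mult_right_mono component_le_norm_cart) auto
      finally show "norm ((u $ j) *\<^sub>R ?l - (?l $ j) *\<^sub>R u) \<le> 2 * (norm u * norm ?l)" by simp
    qed (use st(1) uu in auto)
    finally have "?w * norm (minor_row u ?v j) \<le> ?w * (s / (u \<bullet> u) * (2 * (norm u * norm ?l)))"
      using w(1) by (intro mult_left_mono) auto
    also have "\<dots> = 2 * (?w * (norm u * (s * norm ?l / (u \<bullet> u))))" by (simp add: mult_ac)
    also have "\<dots> \<le> 8 / c\<^sup>2" using key c(1) by (simp add: pos_le_divide_eq)
    finally show ?thesis .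
  qed
  have vi: "?v \<in> int_points" using side_normal_int [OF primitive_int [OF u(1)] ab(2) i(1)] .
  have uv: "indep2 u ?v" using side_normal_indep [OF primitive_int [OF u(1)] ab(2) i(1)] .
  have "?v \<in> span {u, b}"
    using side_normal_half_plane(2) [OF primitive_int [OF u(1)] ab(2) i(1)] half_plane_span [of u b] span_base by metis
  then have "span {u, ?v} = span {u, b}" by (intro span_indep2_eq [OF uv]) (auto intro: span_base)
  then have "span \<sigma> = span {u, ?v}" unfolding ab(4) span_cone2 i(4) by simp
  then have sp: "span \<sigma> = span (range (minor_row u ?v))" unfolding span_minor_rows [OF uv] .
  have "1 \<le> ?w" using Ints_nonzero_abs_ge1 [OF w(2)] w(1) by simp
  have "norm (minor_row u ?v j) \<le> 8 / c\<^sup>2" for j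
  proof -
    have "1 * norm (minor_row u ?v j) \<le> ?w * norm (minor_row u ?v j)"
      using \<open>1 \<le> ?w\<close> by (intro mult_right_mono) auto
    then show ?thesis using row [of j] by linarith
  qed
  then have "range (minor_row u ?v) \<in> Pow {x\<in>int_points. norm x \<le> 8 / c\<^sup>2}"
    using minor_row_int [OF primitive_int [OF u(1)] vi] by blast
  then show "span \<sigma> \<in> span ` Pow {x\<in>int_points. norm x \<le> 8 / c\<^sup>2}" unfolding sp by (rule imageI)
  obtain j where j: "minor_row u ?v j \<noteq> 0"
  proof (rule ccontr)
    assume "\<not> thesis"
    then have "minor_row u ?v j = 0" for j using that by blast
    then have "range (minor_row u ?v) \<subseteq> {0}" by auto
    then have "span (range (minor_row u ?v)) \<subseteq> span {0}" by (rule span_mono)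
    then have "span {u, ?v} \<subseteq> {0}" unfolding span_minor_rows [OF uv] by simp
    moreover have "u \<in> span {u, ?v}" by (intro span_base) simp
    ultimately show False using primitive_nonzero [OF u(1)] by blast
  qed
  have "?w * 1 \<le> ?w * norm (minor_row u ?v j)"
    using int_points_norm_ge_1 [OF minor_row_int [OF primitive_int [OF u(1)] vi] j] w(1) by (intro mult_left_mono) auto
  then show "?w \<le> 8 / c\<^sup>2" using row [of j] by linarith
qed

section \<open>Finiteness\<close>

text \<open>After a short step from \<open>u\<close> in direction \<open>d\<close>, a cone with the
  germ is seen both forwards and backwards, and a closed set without it has been left. Along a
  segment, weights can therefore jump only where forward and backward germs have different
  weights.\<close>

lemma germ_near:
  fixes \<sigma> :: "'a::real_normed_vector set"
  assumes "convex \<sigma>" "closed \<sigma>"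
  shows "\<forall>\<^sub>F s in at_right 0. (germ \<sigma> (u + s *\<^sub>R d) d \<longleftrightarrow> germ \<sigma> u d) \<and> (germ \<sigma> (u + s *\<^sub>R d) (- d) \<longleftrightarrow> germ \<sigma> u d)"
proof (cases "germ \<sigma> u d")
  case True
  then obtain e where e: "0 < e" "\<And>s. 0 \<le> s \<Longrightarrow> s \<le> e \<Longrightarrow> u + s *\<^sub>R d \<in> \<sigma>" using germE assms(1) by blast
  have "germ \<sigma> (u + s *\<^sub>R d) d \<and> germ \<sigma> (u + s *\<^sub>R d) (- d)" if s: "0 < s" "s < e" for s
  proof
    have m: "u + s *\<^sub>R d \<in> \<sigma>" using e(2) [of s] s by simp
    have eq: "u + s *\<^sub>R d + (e - s) *\<^sub>R d = u + e *\<^sub>R d" by (simp add: algebra_simps)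
    have "u + s *\<^sub>R d + (e - s) *\<^sub>R d \<in> \<sigma>" unfolding eq using e(2) [of e] e(1) by simp
    moreover have "0 < e - s" using s by simp
    ultimately show "germ \<sigma> (u + s *\<^sub>R d) d" unfolding germ_def using m by blast
    have "u + s *\<^sub>R d + s *\<^sub>R (- d) = u" by simp
    then show "germ \<sigma> (u + s *\<^sub>R d) (- d)" unfolding germ_def using m s e(2) [of 0] e(1) by (intro conjI exI [of _ s]) auto
  qed
  then show ?thesis unfolding eventually_at_right_field using True e(1) by blast
next
  case False
  from not_germ_eventually [OF assms(2) this] show ?thesis
  proof eventually_elim
    case (elim s) then show ?case using False unfolding germ_def by blast
  qed
qed

lemma indep2_shift: assumes "indep2 u d" shows "indep2 (u + s *\<^sub>R d) d" "indep2 (u + s *\<^sub>R d) (- d)"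
proof -
  have "indep2 d (s *\<^sub>R d + 1 *\<^sub>R u)" using indep2_combine [of d u 1 s] assms indep2_commute [of u d] by simp
  then have 1: "indep2 (u + s *\<^sub>R d) d" using indep2_commute [of d "u + s *\<^sub>R d"] by (simp add: add.commute)
  show "indep2 (u + s *\<^sub>R d) d" by fact
  show "indep2 (u + s *\<^sub>R d) (- d)" using indep2_combine [OF 1, of "-1" 0] by simp
qed

lemma germ_weight_near:
  assumes F: "surface_fan (fst W)" and i: "indep2 u d"
  shows "\<forall>\<^sub>F s in at_right 0. germ_weight W (u + s *\<^sub>R d) d = germ_weight W u d \<and>
     germ_weight W (u + s *\<^sub>R d) (- d) = germ_weight W u d"
proof -
  have "\<forall>\<^sub>F s in at_right 0. \<forall>\<sigma>\<in>fst W. (germ \<sigma> (u + s *\<^sub>R d) d \<longleftrightarrow> germ \<sigma> u d) \<and>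
      (germ \<sigma> (u + s *\<^sub>R d) (- d) \<longleftrightarrow> germ \<sigma> u d)"
    using germ_near surface_fan_convex [OF F] flat_cone_closed surface_fan_flat [OF F]
    by (intro eventually_ball_finite surface_fan_finite [OF F]) blast
  then show ?thesis
  proof eventually_elim
    case (elim s)
    then have "{\<sigma>\<in>fst W. dim \<sigma> = 2 \<and> germ \<sigma> (u + s *\<^sub>R d) d} = {\<sigma>\<in>fst W. dim \<sigma> = 2 \<and> germ \<sigma> u d}"
      "{\<sigma>\<in>fst W. dim \<sigma> = 2 \<and> germ \<sigma> (u + s *\<^sub>R d) (- d)} = {\<sigma>\<in>fst W. dim \<sigma> = 2 \<and> germ \<sigma> u d}" by blast+
    then show ?case unfolding germ_weight_def using i indep2_shift [OF i, of s] by simp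
  qed
qed

section \<open>Constancy of germ weights within a plane\<close>

lemma germ_half_plane:
  assumes "convex_cone \<sigma>" "germ \<sigma> z d" "0 < p" shows "germ \<sigma> z (p *\<^sub>R d + q *\<^sub>R z)"
proof -
  obtain e where e: "0 < e" "z \<in> \<sigma>" "z + e *\<^sub>R d \<in> \<sigma>" using assms(2) unfolding germ_def by blast
  define r where "r = \<bar>p / e - q\<bar>"
  \<comment> \<open>Small enough for the coefficient \<open>1 - s * (p / e - q)\<close> of
    \<open>z\<close> below to be non-negative.\<close>
  define s where "s = 1 / (1 + r)"
  have r: "0 \<le> r" unfolding r_def by simp
  then have s: "0 < s" unfolding s_def by simp
  have "s * r \<le> 1" unfolding s_def using r by simp
  moreover have "s * (p / e - q) \<le> s * r" using s unfolding r_def by (intro mult_left_mono) auto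
  ultimately have nn: "0 \<le> 1 - s * (p / e - q)" by linarith
  have "z + s *\<^sub>R (p *\<^sub>R d + q *\<^sub>R z) = (1 - s * (p / e - q)) *\<^sub>R z + (s * p / e) *\<^sub>R (z + e *\<^sub>R d)"
    using e(1) by (simp add: algebra_simps)
  moreover have "(1 - s * (p / e - q)) *\<^sub>R z \<in> \<sigma>" by (rule convex_cone_scaleR [OF assms(1) nn e(2)])
  moreover have "(s * p / e) *\<^sub>R (z + e *\<^sub>R d) \<in> \<sigma>"
    using s assms(3) e(1) by (intro convex_cone_scaleR [OF assms(1) _ e(3)]) simp
  ultimately have "z + s *\<^sub>R (p *\<^sub>R d + q *\<^sub>R z) \<in> \<sigma>" using convex_cone_add [OF assms(1)] by metis
  then show ?thesis unfolding germ_def using e(2) s by blast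
qed

lemma germ_weight_half_plane:
  assumes F: "surface_fan (fst W)" and i: "indep2 z d" and p: "0 < p"
  shows "germ_weight W z (p *\<^sub>R d + q *\<^sub>R z) = germ_weight W z d"
proof -
  let ?d = "p *\<^sub>R d + q *\<^sub>R z"
  have i': "indep2 z ?d" using indep2_combine [OF i, of p q] p by (simp add: add.commute)
  have d: "(1/p) *\<^sub>R ?d + (- q / p) *\<^sub>R z = d" using p by (simp add: algebra_simps)
  have "germ \<sigma> z ?d \<longleftrightarrow> germ \<sigma> z d" if s: "\<sigma> \<in> fst W" for \<sigma>
  proof
    assume "germ \<sigma> z d"
    then show "germ \<sigma> z ?d" by (rule germ_half_plane [OF surface_fan_convex_cone [OF F s] _ p])
  next
    assume "germ \<sigma> z ?d"
    then have "germ \<sigma> z ((1/p) *\<^sub>R ?d + (- q / p) *\<^sub>R z)"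
      by (rule germ_half_plane [OF surface_fan_convex_cone [OF F s]]) (use p in simp)
    then show "germ \<sigma> z d" unfolding d .
  qed
  then have "{\<sigma>\<in>fst W. dim \<sigma> = 2 \<and> germ \<sigma> z ?d} = {\<sigma>\<in>fst W. dim \<sigma> = 2 \<and> germ \<sigma> z d}" by blast
  then show ?thesis unfolding germ_weight_def using i i' by simp
qed

lemma germ_weight_scale:
  assumes F: "surface_fan (fst W)" and c: "0 < c"
  shows "germ_weight W (c *\<^sub>R u) d = germ_weight W u d"
proof -
  have *: "germ \<sigma> (c *\<^sub>R u) d" if s: "\<sigma> \<in> fst W" and g: "germ \<sigma> u d" and c: "0 < c" for \<sigma> u c
  proof -
    note cc = surface_fan_convex_cone [OF F s]
    obtain e where e: "0 < e" "u \<in> \<sigma>" "u + e *\<^sub>R d \<in> \<sigma>" using g unfolding germ_def by blast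
    have "c *\<^sub>R (u + e *\<^sub>R d) \<in> \<sigma>" "c *\<^sub>R u \<in> \<sigma>" using convex_cone_scaleR [OF cc] c e by auto
    moreover have "c *\<^sub>R (u + e *\<^sub>R d) = c *\<^sub>R u + (c * e) *\<^sub>R d" by (simp add: algebra_simps)
    moreover have "0 < c * e" using c e by simp
    ultimately show ?thesis unfolding germ_def by metis
  qed
  have "germ \<sigma> (c *\<^sub>R u) d \<longleftrightarrow> germ \<sigma> u d" if s: "\<sigma> \<in> fst W" for \<sigma>
    using * [OF s, of u c] * [OF s, of "c *\<^sub>R u" "1/c"] c by auto
  then have "{\<sigma>\<in>fst W. dim \<sigma> = 2 \<and> germ \<sigma> (c *\<^sub>R u) d} = {\<sigma>\<in>fst W. dim \<sigma> = 2 \<and> germ \<sigma> u d}" by blast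
  moreover have "indep2 (c *\<^sub>R u) d \<longleftrightarrow> indep2 u d"
    using indep2_scale [of u d c] indep2_scale [of "c *\<^sub>R u" d "1/c"] c by auto
  ultimately show ?thesis unfolding germ_weight_def by simp
qed

text \<open>If all cones at \<open>u\<close> lie in one plane, at most two normals occur and their
  sum lies on the line of \<open>u\<close>. Balancing then puts the difference of the two weights
  times one normal on this line, so the weights agree. As \<open>d\<close> may be irrational,
  \<open>nz\<close> supplies a cone with an integral generator \<open>b\<close> on the side of
  \<open>d\<close>.\<close>

lemma germ_weight_minus_aux:
  assumes W: "tropical_fan 2 W" and u: "u \<in> int_points" "ray u \<in> fst W" and i: "indep2 u d"
    and plane: "\<And>\<sigma>. \<sigma> \<in> fst W \<Longrightarrow> dim \<sigma> = 2 \<Longrightarrow> u \<in> \<sigma> \<Longrightarrow> span \<sigma> = span {u, d}"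
    and nz: "germ_weight W u d \<noteq> 0"
  shows "germ_weight W u d = germ_weight W u (- d)"
proof -
  note F = tropical_surface_fan [OF W] and ws = tropical_weighted_surface [OF W]
  have u0: "u \<noteq> 0" using indep2_nonzero [OF i] by blast
  let ?g = "germ_weight W u"
  obtain \<sigma> where s: "\<sigma> \<in> fst W" "dim \<sigma> = 2" "germ \<sigma> u d" using nz germ_weight_nonzeroE by metis
  then have "\<sigma> \<in> facet_cofaces (fst W) (ray u)" unfolding facet_cofaces_ray [OF F u(2) u0] germ_def by blast
  then obtain b where b: "b \<in> int_points" "indep2 u b" "\<sigma> = cone2 u b"
    using facet_coface_form [OF F u(2) u0] by metis
  have mb: "- b \<in> int_points" "indep2 u (- b)" using int_points_simps(4) b(1) indep2_combine [OF b(2), of "-1" 0] by auto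
  have "d \<in> half_plane u b" using s(3) unfolding b(3) germ_cone2_half_plane [OF b(2)] .
  then obtain p q where pq: "0 \<le> p" "d = p *\<^sub>R b + q *\<^sub>R u" unfolding mem_half_plane by metis
  have "p \<noteq> 0" using pq i not_indep2 [of u d] by auto
  then have p: "0 < p" using pq(1) by simp
  have md: "- d = p *\<^sub>R (- b) + (- q) *\<^sub>R u" unfolding pq(2) by simp
  let ?v = "side_normal u b" and ?v' = "side_normal u (- b)"
  have gb: "?g x = ?g y" if x: "x \<in> half_plane u y" and ix: "indep2 u x" and iy: "indep2 u y" for x y
  proof -
    obtain m n where mn: "0 \<le> m" "x = m *\<^sub>R y + n *\<^sub>R u" using x unfolding mem_half_plane by metis
    have "m \<noteq> 0" using mn ix not_indep2 [of u x] by auto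
    then show ?thesis using germ_weight_half_plane [OF F iy, of m n] mn by simp
  qed
  have g: "?g ?v = ?g b" "?g ?v' = ?g (- b)" "?g d = ?g b" "?g (- d) = ?g (- b)"
    using gb [OF side_normal_half_plane(2) [OF u(1) b(1,2)] side_normal_indep [OF u(1) b(1,2)] b(2)]
      gb [OF side_normal_half_plane(2) [OF u(1) mb] side_normal_indep [OF u(1) mb] mb(2)]
      germ_weight_half_plane [OF F b(2) p, of q] germ_weight_half_plane [OF F mb(2) p, of "- q"] md pq(2) by auto
  have sp: "span {u, d} = span {u, b}" using plane [OF s(1,2)] s(3) unfolding germ_def b(3) span_cone2 by simp
  have "normals (germ_weight W) u \<subseteq> {?v, ?v'}"
  proof
    fix v assume "v \<in> normals (germ_weight W) u"
    then have v: "?g v \<noteq> 0" "side_normal u v = v" unfolding normals_def by auto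
    then obtain \<tau> where t: "indep2 u v" "\<tau> \<in> fst W" "dim \<tau> = 2" "germ \<tau> u v" using germ_weight_nonzeroE by metis
    obtain e where e: "0 < e" "u \<in> \<tau>" "u + e *\<^sub>R v \<in> \<tau>" using t(4) unfolding germ_def by blast
    have "span \<tau> = span {u, b}" using plane [OF t(2,3) e(2)] sp by simp
    then have "u \<in> span {u, b}" "u + e *\<^sub>R v \<in> span {u, b}" using e span_base by blast+
    then have "(u + e *\<^sub>R v) - u \<in> span {u, b}" by (intro span_diff)
    then have "(1/e) *\<^sub>R ((u + e *\<^sub>R v) - u) \<in> span {u, b}" by (rule span_scale)
    then have "v \<in> span {u, b}" using e(1) by simp
    then obtain k m where km: "v = k *\<^sub>R u + m *\<^sub>R b" unfolding in_span2 by blast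
    have "m \<noteq> 0" using km t(1) not_indep2 [of u v] by auto
    then consider "0 < m" | "0 < - m" by linarith
    then show "v \<in> {?v, ?v'}"
    proof cases
      case 1
      have "half_plane u v = half_plane u b" unfolding km using half_plane_eq [OF 1, of u b k] by (simp add: add.commute)
      then show ?thesis using v(2) unfolding side_normal_def by simp
    next
      case 2
      have "half_plane u v = half_plane u (- b)" unfolding km using half_plane_eq [OF 2, of u "- b" k] by (simp add: add.commute)
      then show ?thesis using v(2) unfolding side_normal_def by simp
    qed
  qed
  moreover have "?g x = 0" if "x \<in> {?v, ?v'} - normals (germ_weight W) u" for x
    using that side_normal_pn [OF u(1) b(1,2)] side_normal_pn [OF u(1) mb] unfolding normals_def by auto
  ultimately have "germ_normal_sum (germ_weight W) u = (\<Sum>v\<in>{?v, ?v'}. ?g v *\<^sub>R v)"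
    unfolding germ_normal_sum_def by (intro sum.mono_neutral_left) auto
  moreover obtain k where k: "?v + ?v' = k *\<^sub>R u" using side_normal_minus [OF u(1) b(1,2)] unfolding in_span1 by blast
  moreover have ne: "?v \<noteq> ?v'"
  proof
    assume "?v = ?v'"
    then have "2 *\<^sub>R ?v = k *\<^sub>R u" using k by (simp add: scaleR_2)
    then have "(1/2) *\<^sub>R (2 *\<^sub>R ?v) = (1/2) *\<^sub>R (k *\<^sub>R u)" by simp
    then have "?v = (k/2) *\<^sub>R u" by simp
    then show False using side_normal_indep [OF u(1) b(1,2)] not_indep2 by blast
  qed
  ultimately have ns: "germ_normal_sum (germ_weight W) u = ?g b *\<^sub>R ?v + ?g (- b) *\<^sub>R ?v'" using g by simp
  obtain m where m: "germ_normal_sum (germ_weight W) u = m *\<^sub>R u" using tropical_normal_sum [OF W u(1) u0] unfolding in_span1 by blast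
  have v': "?v' = k *\<^sub>R u - ?v" using k by (simp add: algebra_simps)
  have "(?g (- b) * k - m) *\<^sub>R u + (?g b - ?g (- b)) *\<^sub>R ?v = 0"
    using ns m unfolding v' by (simp add: algebra_simps)
  from indep2D [OF side_normal_indep [OF u(1) b(1,2)] this] show ?thesis using g by simp
qed

text \<open>Balancing speaks of rational rays, while \<open>z\<close> is any real point. If
  \<open>z\<close> does not span a ray of the fan, it lies inside a cone, which has both germs, or
  outside the support, where both weights are zero.\<close>

lemma germ_weight_minus:
  assumes W: "tropical_fan 2 W" and i: "indep2 z d"
    and plane: "\<And>\<sigma>. \<sigma> \<in> fst W \<Longrightarrow> dim \<sigma> = 2 \<Longrightarrow> z \<in> \<sigma> \<Longrightarrow> span \<sigma> = span {z, d}"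
  shows "germ_weight W z d = germ_weight W z (- d)"
proof -
  note F = tropical_surface_fan [OF W]
  have i': "indep2 z (- d)" using indep2_combine [OF i, of "-1" 0] by simp
  show ?thesis
  proof (rule surface_fan_point_cases [OF F indep2_nonzero(1) [OF i]])
    assume "\<And>\<sigma>. \<sigma> \<in> fst W \<Longrightarrow> z \<notin> \<sigma>"
    then have "germ_weight W z x = 0" for x using germ_weight_nonzeroE [of W z x] unfolding germ_def by metis
    then show ?thesis by simp
  next
    fix a b s t assume c: "cone2 a b \<in> fst W" "indep2 a b" "0 < s" "0 < t" "z = s *\<^sub>R a + t *\<^sub>R b"
    have "z \<in> cone2 a b" unfolding c(5) mem_cone2 using c(3,4) less_imp_le by blast
    then have "span {a, b} = span {z, d}" using plane [OF c(1) dim_cone2 [OF c(2)]] span_cone2 [of a b] by simp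
    then have "d \<in> span {a, b}" using span_base [of d "{z, d}"] by simp
    then have "germ (cone2 a b) z d" "germ (cone2 a b) z (- d)"
      unfolding c(5) germ_interior [OF c(3,4)] by (auto intro: span_neg)
    then show ?thesis using germ_weight_eq [OF F c(1) i] germ_weight_eq [OF F c(1) i'] by simp
  next
    assume r: "ray z \<in> fst W"
    have "dim (ray z) = 1" using dim_ray indep2_nonzero [OF i] by blast
    then obtain u where u: "u \<in> int_points" "u \<noteq> 0" "ray z = ray u"
      using flat_cone_dim1 surface_fan_flat [OF F r] by metis
    obtain c where c: "0 < c" "z = c *\<^sub>R u" using ray_eqD [of u z] u by auto
    have ru: "ray u \<in> fst W" using r u by simp
    have iu: "indep2 u d" "indep2 u (- d)"
      using indep2_scale [OF i, of "1/c"] indep2_scale [OF i', of "1/c"] c by auto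
    have sp: "span {z, d} = span {u, d}" "span {u, - d} = span {u, d}"
    proof -
      show "span {z, d} = span {u, d}"
        by (rule span_indep2_eq [OF i]) (auto simp: c(2) intro: span_base span_scale)
      show "span {u, - d} = span {u, d}"
        by (rule span_indep2_eq [OF iu(2)]) (auto intro: span_base span_neg)
    qed
    have pl: "span \<sigma> = span {u, d}" if s: "\<sigma> \<in> fst W" "dim \<sigma> = 2" "u \<in> \<sigma>" for \<sigma>
    proof -
      have "z \<in> \<sigma>" unfolding c(2) using convex_cone_scaleR [OF surface_fan_convex_cone [OF F s(1)]] s(3) c(1) by simp
      then show ?thesis using plane [OF s(1,2)] sp by simp
    qed
    have "germ_weight W u d = germ_weight W u (- d)"
    proof (cases "germ_weight W u d = 0")
      case False then show ?thesis using germ_weight_minus_aux [OF W u(1) ru iu(1) pl] by blast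
    next
      case True
      show ?thesis
      proof (rule ccontr)
        assume "\<not> ?thesis"
        then have nz: "germ_weight W u (- d) \<noteq> 0" using True by simp
        \<comment> \<open>The auxiliary lemma starts from a non-zero weight on its own side, so here
          it is applied to the opposite side.\<close>
        have "germ_weight W u (- d) = germ_weight W u (- (- d))"
          by (rule germ_weight_minus_aux [OF W u(1) ru iu(2) _ nz]) (use pl sp in simp)
        then show False using True nz by simp
      qed
    qed
    then show ?thesis unfolding c(2) germ_weight_scale [OF F c(1)] .
  qed
qed

text \<open>Up to positive factors and multiples of \<open>z\<close> the plane offers only the
  directions \<open>d\<close> and \<open>- d\<close>.\<close>

lemma germ_weight_plane:
  assumes W: "tropical_fan 2 W" and i: "indep2 z d" "indep2 z d'" "d' \<in> span {z, d}"
    and plane: "\<And>\<sigma>. \<sigma> \<in> fst W \<Longrightarrow> dim \<sigma> = 2 \<Longrightarrow> z \<in> \<sigma> \<Longrightarrow> span \<sigma> = span {z, d}"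
  shows "germ_weight W z d' = germ_weight W z d"
proof -
  note F = tropical_surface_fan [OF W]
  obtain q p where pq: "d' = q *\<^sub>R z + p *\<^sub>R d" using i(3) unfolding in_span2 by blast
  have "p \<noteq> 0" using pq i(2) not_indep2 [of z d'] by auto
  then consider "0 < p" | "0 < - p" by linarith
  then show ?thesis
  proof cases
    case 1
    then show ?thesis using germ_weight_half_plane [OF F i(1), of p q] pq by (simp add: add.commute)
  next
    case 2
    have "indep2 z (- d)" using indep2_combine [OF i(1), of "-1" 0] by simp
    from germ_weight_half_plane [OF F this 2, of q] have "germ_weight W z d' = germ_weight W z (- d)"
      using pq by (simp add: add.commute)
    then show ?thesis using germ_weight_minus [OF W i(1) plane] by simp
  qed
qed

text \<open>The weight of the forward germ is locally constant on the unit interval: to the right of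
  \<open>t\<close> by \<open>germ_weight_near\<close>, to the left because it equals the weight of
  the backward germ at \<open>t\<close>, which balancing identifies with that of the forward germ.
  The interval is connected.\<close>

lemma germ_weight_segment:
  assumes W: "tropical_fan 2 W" and i: "indep2 x e"
    and plane: "\<And>\<sigma> t. \<sigma> \<in> fst W \<Longrightarrow> dim \<sigma> = 2 \<Longrightarrow> 0 \<le> t \<Longrightarrow> t \<le> 1 \<Longrightarrow> x + t *\<^sub>R e \<in> \<sigma> \<Longrightarrow> span \<sigma> = span {x, e}"
  shows "germ_weight W (x + e) e = germ_weight W x e"
proof -
  note F = tropical_surface_fan [OF W]
  define f where "f t = germ_weight W (x + t *\<^sub>R e) e" for t :: real
  have it: "indep2 (x + t *\<^sub>R e) e" "indep2 (x + t *\<^sub>R e) (- e)" for t using indep2_shift [OF i] by auto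
  have spt: "span {x + t *\<^sub>R e, e} = span {x, e}" for t
    by (rule span_indep2_eq [OF it(1)]) (auto intro: span_base span_add span_scale)
  have refl: "f t = germ_weight W (x + t *\<^sub>R e) (- e)" if t: "t \<in> {0..1}" for t
    unfolding f_def using t plane spt by (intro germ_weight_minus [OF W it(1)]) auto
  have "\<forall>\<^sub>F s in at t. f t = f s" if t: "t \<in> {0..1}" for t
  proof -
    have "\<forall>\<^sub>F s in at_right 0. f t = f (t + s)"
      using germ_weight_near [OF F it(1) [of t]]
      by eventually_elim (simp add: f_def scaleR_left_distrib add.assoc)
    then have r: "\<forall>\<^sub>F s in at_right t. f t = f s"
      unfolding eventually_at_right_to_0 [of _ t] by (simp add: add.commute)
    have "\<forall>\<^sub>F s in at_right 0. f t = f (t - s)"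
      using germ_weight_near [OF F it(2) [of t]]
    proof eventually_elim
      case (elim s)
      have "x + (t - s) *\<^sub>R e = x + t *\<^sub>R e + s *\<^sub>R (- e)" by (simp add: algebra_simps)
      then have "f (t - s) = germ_weight W (x + t *\<^sub>R e + s *\<^sub>R (- e)) e" unfolding f_def by (simp only:)
      also have "\<dots> = germ_weight W (x + t *\<^sub>R e) (- e)" using conjunct2 [OF elim] by (simp only: minus_minus)
      finally show ?case using refl [OF t] by simp
    qed
    then have "\<forall>\<^sub>F s in at_left t. f t = f s"
      unfolding at_left_minus [of t] eventually_filtermap at_right_to_0 [of "- t"]
      by (simp add: algebra_simps)
    with r show ?thesis unfolding eventually_at_split by blast
  qed
  then have "\<forall>t\<in>{0..1}. \<forall>\<^sub>F s in at t within {0..1}. f t = f s"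
    using filter_leD [OF at_le [OF subset_UNIV]] by blast
  then have "f 0 = f 1" using connected_local_const [of "{0..1::real}" 0 1 f] by simp
  then show ?thesis unfolding f_def by simp
qed

text \<open>The sign of \<open>l\<close> at \<open>u + s d\<close> for all small \<open>s > 0\<close>.\<close>

definition lex_sign :: "'a::real_inner \<Rightarrow> 'a \<Rightarrow> 'a \<Rightarrow> real" where
  "lex_sign u d l = (if l \<bullet> u = 0 then sgn (l \<bullet> d) else sgn (l \<bullet> u))"

lemma lex_sign_near: "\<forall>\<^sub>F s in at_right 0. sgn (l \<bullet> (u + s *\<^sub>R d)) = lex_sign u d l"
proof (cases "l \<bullet> u = 0")
  case True
  have "sgn (l \<bullet> (u + s *\<^sub>R d)) = lex_sign u d l" if "0 < s" for s
    using True that unfolding lex_sign_def by (simp add: inner_add_right sgn_mult)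
  then show ?thesis by (auto simp: eventually_at_right_field intro: exI [of _ 1])
next
  case False
  have "((\<lambda>s. l \<bullet> (u + s *\<^sub>R d)) \<longlongrightarrow> l \<bullet> (u + 0 *\<^sub>R d)) (at_right 0)" by (intro tendsto_intros)
  then have t: "((\<lambda>s. l \<bullet> (u + s *\<^sub>R d)) \<longlongrightarrow> l \<bullet> u) (at_right 0)" by simp
  show ?thesis
  proof (cases "0 < l \<bullet> u")
    case True
    from order_tendstoD(1) [OF t this] show ?thesis by eventually_elim (use True in \<open>simp add: lex_sign_def\<close>)
  next
    case c: False
    then have "l \<bullet> u < 0" using False by simp
    from order_tendstoD(2) [OF t this] show ?thesis by eventually_elim (use \<open>l \<bullet> u < 0\<close> in \<open>simp add: lex_sign_def\<close>)
  qed
qed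

lemma sgn_convex:
  fixes p q :: real
  assumes "sgn p = sgn q" "0 \<le> t" "t \<le> 1" shows "sgn (p + t * (q - p)) = sgn p"
proof -
  have e: "p + t * (q - p) = (1 - t) * p + t * q" by (simp add: algebra_simps)
  consider "0 < p" "0 < q" | "p < 0" "q < 0" | "p = 0" "q = 0" using assms(1) by (auto simp: sgn_if split: if_splits)
  then show ?thesis
  proof cases
    case 1
    have "0 < (1 - t) * p + t * q" using 1 assms(2,3)
      by (cases "t = 0") (auto intro: add_nonneg_pos)
    then show ?thesis unfolding e using 1 by simp
  next
    case 2
    have "(1 - t) * p + t * q < 0" using 2 assms(2,3)
      by (cases "t = 0") (auto intro: add_nonpos_neg simp: mult_nonneg_nonpos mult_pos_neg)
    then show ?thesis unfolding e using 2 by simp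
  qed simp
qed

text \<open>Both germs are moved to nearby points \<open>x1\<close>, \<open>x2\<close> at which the
  lexicographic signs are actual signs, and every form of \<open>A\<close> keeps its sign on the
  segment between these. If the segment met a cone of another plane, a form vanishing on that plane
  but not on \<open>P\<close> would vanish at \<open>x1\<close>, hence at \<open>u\<^sub>1\<close>
  and \<open>d\<^sub>1\<close>, hence on \<open>P\<close>.\<close>

lemma germ_weight_sign_class:
  fixes W :: "'n::finite weighted_fan"
  assumes W: "tropical_fan 2 W" and planes: "\<And>\<sigma>. \<sigma> \<in> fst W \<Longrightarrow> dim \<sigma> = 2 \<Longrightarrow> span \<sigma> \<in> \<P>"
    and A: "finite A" "Basis \<subseteq> A"
    and sep: "\<And>P P'. P \<in> \<P> \<Longrightarrow> P' \<in> \<P> \<Longrightarrow> P \<noteq> P' \<Longrightarrow> \<exists>l\<in>A. (\<forall>x\<in>P'. l \<bullet> x = 0) \<and> (\<exists>y\<in>P. l \<bullet> y \<noteq> 0)"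
    and i1: "indep2 u\<^sub>1 d\<^sub>1" "span {u\<^sub>1, d\<^sub>1} = P" and i2: "indep2 u\<^sub>2 d\<^sub>2" "span {u\<^sub>2, d\<^sub>2} = P" and P: "P \<in> \<P>"
    and sgn: "\<And>l. l \<in> A \<Longrightarrow> lex_sign u\<^sub>1 d\<^sub>1 l = lex_sign u\<^sub>2 d\<^sub>2 l"
  shows "germ_weight W u\<^sub>1 d\<^sub>1 = germ_weight W u\<^sub>2 d\<^sub>2"
proof -
  note F = tropical_surface_fan [OF W]
  have near: "\<exists>s>0. germ_weight W (u + s *\<^sub>R d) d = germ_weight W u d \<and> (\<forall>l\<in>A. sgn (l \<bullet> (u + s *\<^sub>R d)) = lex_sign u d l)"
    if "indep2 u d" for u d
  proof -
    have "\<forall>\<^sub>F s in at_right 0. \<forall>l\<in>A. sgn (l \<bullet> (u + s *\<^sub>R d)) = lex_sign u d l"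
      using lex_sign_near by (intro eventually_ball_finite A(1)) blast
    with germ_weight_near [OF F that]
    have "\<forall>\<^sub>F s in at_right 0. germ_weight W (u + s *\<^sub>R d) d = germ_weight W u d \<and>
        (\<forall>l\<in>A. sgn (l \<bullet> (u + s *\<^sub>R d)) = lex_sign u d l)" by eventually_elim blast
    moreover have "\<forall>\<^sub>F s in at_right (0::real). 0 < s" by (rule eventually_at_right_less)
    ultimately have "\<forall>\<^sub>F s in at_right 0. 0 < s \<and> germ_weight W (u + s *\<^sub>R d) d = germ_weight W u d \<and>
        (\<forall>l\<in>A. sgn (l \<bullet> (u + s *\<^sub>R d)) = lex_sign u d l)" by eventually_elim blast
    from eventually_happens' [OF trivial_limit_at_right_real this] show ?thesis .
  qed
  from near [OF i1(1)] obtain s1 where s1': "0 < s1 \<and> germ_weight W (u\<^sub>1 + s1 *\<^sub>R d\<^sub>1) d\<^sub>1 = germ_weight W u\<^sub>1 d\<^sub>1 \<and>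
    (\<forall>l\<in>A. sgn (l \<bullet> (u\<^sub>1 + s1 *\<^sub>R d\<^sub>1)) = lex_sign u\<^sub>1 d\<^sub>1 l)" ..
  note s1 = conjunct1 [OF conjunct2 [OF s1']] bspec [OF conjunct2 [OF conjunct2 [OF s1']]]
  from near [OF i2(1)] obtain s2 where s2': "0 < s2 \<and> germ_weight W (u\<^sub>2 + s2 *\<^sub>R d\<^sub>2) d\<^sub>2 = germ_weight W u\<^sub>2 d\<^sub>2 \<and>
    (\<forall>l\<in>A. sgn (l \<bullet> (u\<^sub>2 + s2 *\<^sub>R d\<^sub>2)) = lex_sign u\<^sub>2 d\<^sub>2 l)" ..
  note s2 = conjunct1 [OF conjunct2 [OF s2']] bspec [OF conjunct2 [OF conjunct2 [OF s2']]]
  define x1 x2 e where x: "x1 = u\<^sub>1 + s1 *\<^sub>R d\<^sub>1" "x2 = u\<^sub>2 + s2 *\<^sub>R d\<^sub>2" and e: "e = x2 - x1"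
  have j1: "indep2 x1 d\<^sub>1" and j2: "indep2 x2 d\<^sub>2" unfolding x using indep2_shift i1(1) i2(1) by blast+
  have memP: "x1 \<in> P" "x2 \<in> P" "d\<^sub>1 \<in> P" "d\<^sub>2 \<in> P"
    unfolding x using i1(2) i2(2) by (auto intro!: span_add span_scale intro: span_base)
  have subP: "subspace P" using i1(2) subspace_span by metis
  have eP: "e \<in> P" unfolding e using memP subP by (intro subspace_diff)
  have spP: "span {z, d} = P" if "indep2 z d" "z \<in> P" "d \<in> P" for z d
    using span_indep2_eq [of z d u\<^sub>1 d\<^sub>1] that i1(2) by simp
  have sg: "sgn (l \<bullet> x2) = sgn (l \<bullet> x1)" if "l \<in> A" for l using s1(2) s2(2) sgn that unfolding x by simp
  have sgt: "sgn (l \<bullet> (x1 + t *\<^sub>R e)) = sgn (l \<bullet> x1)" if "l \<in> A" "0 \<le> t" "t \<le> 1" for l t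
  proof -
    have "l \<bullet> (x1 + t *\<^sub>R e) = l \<bullet> x1 + t * (l \<bullet> x2 - l \<bullet> x1)" unfolding e by (simp add: inner_add_right inner_diff_right)
    then show ?thesis using sgn_convex [of "l \<bullet> x1" "l \<bullet> x2" t] sg that by simp
  qed
  have plane: "span \<sigma> = P" if s: "\<sigma> \<in> fst W" "dim \<sigma> = 2" "0 \<le> t" "t \<le> 1" "x1 + t *\<^sub>R e \<in> \<sigma>" for \<sigma> t
  proof (rule ccontr)
    assume "span \<sigma> \<noteq> P"
    then obtain l y where l: "l \<in> A" "\<forall>z\<in>span \<sigma>. l \<bullet> z = 0" "y \<in> P" "l \<bullet> y \<noteq> 0"
      using sep [OF P planes [OF s(1,2)]] by metis
    have "l \<bullet> (x1 + t *\<^sub>R e) = 0" using l(2) s(5) span_base by blast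
    then have "l \<bullet> x1 = 0" using sgt [OF l(1) s(3,4)] by (simp add: sgn_0_0)
    then have ls: "lex_sign u\<^sub>1 d\<^sub>1 l = 0" using s1(2) [OF l(1)] unfolding x by simp
    then have "l \<bullet> u\<^sub>1 = 0" unfolding lex_sign_def by (auto simp: sgn_0_0 split: if_splits)
    moreover then have "l \<bullet> d\<^sub>1 = 0" using ls unfolding lex_sign_def by (simp add: sgn_0_0)
    moreover obtain p q where "y = p *\<^sub>R u\<^sub>1 + q *\<^sub>R d\<^sub>1" using l(3) i1(2) in_span2 by blast
    ultimately show False using l(4) by (simp add: inner_add_right)
  qed
  have plane1: "span \<sigma> = P" if "\<sigma> \<in> fst W" "dim \<sigma> = 2" "x1 \<in> \<sigma>" for \<sigma> using plane [of \<sigma> 0] that by simp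
  have plane2: "span \<sigma> = P" if "\<sigma> \<in> fst W" "dim \<sigma> = 2" "x2 \<in> \<sigma>" for \<sigma> using plane [of \<sigma> 1] that unfolding e by simp
  have "germ_weight W x1 d\<^sub>1 = germ_weight W x2 d\<^sub>2"
  proof (cases "indep2 x1 e")
    case True
    have sp: "span {x1, e} = P" using spP [OF True memP(1) eP] .
    have ix2: "indep2 x2 e" using indep2_shift(1) [OF True, of 1] unfolding e by simp
    have sp2: "span {x2, e} = P" using spP [OF ix2 memP(2) eP] .
    have "germ_weight W x1 d\<^sub>1 = germ_weight W x1 e"
      by (rule germ_weight_plane [OF W True j1]) (use sp memP plane1 in auto)
    also have "\<dots> = germ_weight W (x1 + e) e"
      by (rule germ_weight_segment [OF W True, symmetric]) (use plane sp in blast)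
    also have "x1 + e = x2" unfolding e by simp
    also have "germ_weight W x2 e = germ_weight W x2 d\<^sub>2"
      by (rule germ_weight_plane [OF W ix2 j2, symmetric]) (use sp2 memP plane2 in auto)
    finally show ?thesis .
  next
    case False
    have x10: "x1 \<noteq> 0" using indep2_nonzero [OF j1] by blast
    then obtain k where "e = k *\<^sub>R x1" using False not_indep2 [of x1 e] by blast
    then have c: "x2 = (1 + k) *\<^sub>R x1" unfolding e by (simp add: algebra_simps)
    \<comment> \<open>The points lie on one line through the origin. A coordinate that is non-zero
      at \<open>x1\<close> has the same sign at \<open>x2\<close>, by
      \<open>Basis \<subseteq> A\<close>, so \<open>x2\<close> is a positive multiple of
      \<open>x1\<close> and not a negative one.\<close>
    obtain b where b: "b \<in> Basis" "b \<bullet> x1 \<noteq> 0" using x10 euclidean_all_zero_iff by (metis inner_commute)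
    have "sgn ((1 + k) * (b \<bullet> x1)) = sgn (b \<bullet> x1)" using sg [of b] b(1) A(2) unfolding c by auto
    then have "sgn (1 + k) = 1" using b(2) by (simp add: sgn_mult sgn_0_0)
    then have k: "0 < 1 + k" by (simp add: sgn_1_pos)
    have j: "indep2 x1 d\<^sub>2" using indep2_scale [OF j2, of "1 / (1 + k)"] k unfolding c by simp
    have "germ_weight W x2 d\<^sub>2 = germ_weight W x1 d\<^sub>2" unfolding c by (rule germ_weight_scale [OF F k])
    also have "\<dots> = germ_weight W x1 d\<^sub>1"
      by (rule germ_weight_plane [OF W j1 j]) (use spP [OF j1 memP(1,3)] memP plane1 in auto)
    finally show ?thesis by simp
  qed
  then show ?thesis using s1(1) s2(1) unfolding x by simp
qed

section \<open>Finitely many planes, finitely many sign classes\<close>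

lemma subspace_separation:
  fixes P' :: "'a::euclidean_space set"
  assumes "subspace P'" "y \<notin> P'" shows "\<exists>l. (\<forall>x\<in>P'. l \<bullet> x = 0) \<and> l \<bullet> y \<noteq> 0"
proof -
  obtain p l where pl: "p \<in> span P'" "\<And>w. w \<in> span P' \<Longrightarrow> orthogonal l w" "y = p + l"
    using orthogonal_subspace_decomp_exists [of P' y] by metis
  have sp: "span P' = P'" using assms(1) by (simp add: span_eq_iff)
  have l: "\<forall>x\<in>P'. l \<bullet> x = 0" and p: "p \<in> P'" using pl unfolding orthogonal_def sp by auto
  have "l \<noteq> 0" using pl(3) p assms(2) by auto
  then have "l \<bullet> y \<noteq> 0" using pl(3) l p by (simp add: inner_add_right)
  then show ?thesis using l by blast
qed

text \<open>Distinct planes of equal dimension do not contain each other, and a vector of one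
  outside the other has a non-zero orthogonal component. \<open>Basis\<close> is included to tell a
  point from its negative.\<close>

lemma separating_forms:
  fixes \<P> :: "'a::euclidean_space set set"
  assumes "finite \<P>" and sub: "\<And>P. P \<in> \<P> \<Longrightarrow> subspace P \<and> dim P = 2"
  shows "\<exists>A. finite A \<and> Basis \<subseteq> A \<and>
    (\<forall>P\<in>\<P>. \<forall>P'\<in>\<P>. P \<noteq> P' \<longrightarrow> (\<exists>l\<in>A. (\<forall>x\<in>P'. l \<bullet> x = 0) \<and> (\<exists>y\<in>P. l \<bullet> y \<noteq> 0)))"
proof -
  let ?R = "\<lambda>p l. (\<forall>x\<in>snd p. l \<bullet> x = 0) \<and> (\<exists>y\<in>fst p. l \<bullet> y \<noteq> 0)"
  have "\<forall>p\<in>{p\<in>\<P> \<times> \<P>. fst p \<noteq> snd p}. \<exists>l. ?R p l"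
  proof
    fix p assume p: "p \<in> {p\<in>\<P> \<times> \<P>. fst p \<noteq> snd p}"
    then have s: "subspace (fst p)" "subspace (snd p)" "dim (fst p) = dim (snd p)" "fst p \<noteq> snd p" using sub by auto
    then have "\<not> fst p \<subseteq> snd p" using subspace_dim_equal [of "fst p" "snd p"] by force
    then obtain y where "y \<in> fst p" "y \<notin> snd p" by blast
    then show "\<exists>l. ?R p l" using subspace_separation [OF s(2)] by blast
  qed
  from bchoice [OF this] obtain f where f: "\<forall>p\<in>{p\<in>\<P> \<times> \<P>. fst p \<noteq> snd p}. ?R p (f p)" ..
  let ?A = "Basis \<union> f ` {p\<in>\<P> \<times> \<P>. fst p \<noteq> snd p}"
  have "\<exists>l\<in>?A. (\<forall>x\<in>P'. l \<bullet> x = 0) \<and> (\<exists>y\<in>P. l \<bullet> y \<noteq> 0)" if "P \<in> \<P>" "P' \<in> \<P>" "P \<noteq> P'" for P P'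
  proof -
    have m: "(P, P') \<in> {p\<in>\<P> \<times> \<P>. fst p \<noteq> snd p}" using that by simp
    from bspec [OF f m] have "(\<forall>x\<in>P'. f (P, P') \<bullet> x = 0) \<and> (\<exists>y\<in>P. f (P, P') \<bullet> y \<noteq> 0)" by simp
    then show ?thesis using imageI [OF m, of f] by blast
  qed
  moreover have "finite ?A" using assms(1) by simp
  ultimately show ?thesis by blast
qed

text \<open>A germ weight is constant on germs with the same plane and the same signs, so it factors
  through the finite set \<open>?X\<close>; its values are 0 or positive integers up to
  \<open>B\<close>. The map \<Phi> turns a function on \<open>?X\<close> back into a function on
  germs.\<close>

lemma finite_germ_weights:
  assumes fin: "finite \<P>" and sub: "\<And>P. P \<in> \<P> \<Longrightarrow> subspace P \<and> dim P = 2"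
  shows "finite {germ_weight W | W :: 'n::finite weighted_fan. tropical_fan 2 W \<and>
     (\<forall>\<sigma>\<in>fst W. dim \<sigma> = 2 \<longrightarrow> span \<sigma> \<in> \<P> \<and> snd W \<sigma> \<le> B)}" (is "finite ?G")
proof -
  obtain A where A: "finite A" "Basis \<subseteq> A"
    "\<forall>P\<in>\<P>. \<forall>P'\<in>\<P>. P \<noteq> P' \<longrightarrow> (\<exists>l\<in>A. (\<forall>x\<in>P'. l \<bullet> x = 0) \<and> (\<exists>y\<in>P. l \<bullet> y \<noteq> 0))"
    using separating_forms [OF fin sub] by blast
  define key where "key u d = (span {u, d}, restrict (lex_sign u d) A)" for u d :: "real ^ 'n"
  let ?X = "\<P> \<times> PiE A (\<lambda>_. {-1, 0, 1 :: real})" and ?V = "{k\<in>\<int>. \<bar>k\<bar> \<le> \<bar>B\<bar>}"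
  define \<Phi> where "\<Phi> \<phi> = (\<lambda>u d. if indep2 u d \<and> span {u, d} \<in> \<P> then \<phi> (key u d) else 0)"
    for \<phi> :: "(real ^ 'n) set \<times> (real ^ 'n \<Rightarrow> real) \<Rightarrow> real"
  have "finite (PiE ?X (\<lambda>_. ?V))"
    using fin A(1) finite_abs_int_segment [of "\<bar>B\<bar>"] by (intro finite_PiE finite_cartesian_product) auto
  moreover have "?G \<subseteq> \<Phi> ` PiE ?X (\<lambda>_. ?V)"
  proof
    fix g assume "g \<in> ?G"
    then obtain W where W: "tropical_fan 2 W" "g = germ_weight W"
      and b: "\<And>\<sigma>. \<sigma> \<in> fst W \<Longrightarrow> dim \<sigma> = 2 \<Longrightarrow> span \<sigma> \<in> \<P> \<and> snd W \<sigma> \<le> B" by blast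
    note F = tropical_surface_fan [OF W(1)]
    have same: "g u d = g u' d'"
      if h: "indep2 u d" "indep2 u' d'" "span {u, d} \<in> \<P>" "key u d = key u' d'" for u d u' d'
      unfolding W(2)
    proof (rule germ_weight_sign_class [OF W(1) _ A(1,2) _ h(1) refl h(2) _ h(3)])
      show "span {u', d'} = span {u, d}" using h(4) unfolding key_def by simp
      fix l assume "l \<in> A"
      have "restrict (lex_sign u d) A = restrict (lex_sign u' d') A" using h(4) unfolding key_def by simp
      from fun_cong [OF this, of l] show "lex_sign u d l = lex_sign u' d' l" using \<open>l \<in> A\<close> by simp
    qed (use b A(3) in blast)+
    have val: "g u d \<in> ?V" for u d
    proof (cases "g u d = 0")
      case False
      then obtain \<sigma> where s: "indep2 u d" "\<sigma> \<in> fst W" "dim \<sigma> = 2" "germ \<sigma> u d"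
        using germ_weight_nonzeroE unfolding W(2) by metis
      have "g u d = snd W \<sigma>" unfolding W(2) by (rule germ_weight_eq [OF F s(2,1,4)])
      moreover have "snd W \<sigma> \<in> \<int>" "0 < snd W \<sigma>"
        using tropical_weighted_surface [OF W(1)] s(2,3) unfolding weighted_surface_def by auto
      moreover have "snd W \<sigma> \<le> B" using b s by blast
      ultimately show ?thesis by simp
    qed simp
    have zero: "g u d = 0" if n: "\<not> (indep2 u d \<and> span {u, d} \<in> \<P>)" for u d
    proof (rule ccontr)
      assume "g u d \<noteq> 0"
      then obtain \<sigma> where s: "indep2 u d" "\<sigma> \<in> fst W" "dim \<sigma> = 2" "germ \<sigma> u d"
        using germ_weight_nonzeroE unfolding W(2) by metis
      obtain e where e: "0 < e" "u \<in> \<sigma>" "u + e *\<^sub>R d \<in> \<sigma>" using s(4) unfolding germ_def by blast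
      obtain a c where ac: "\<sigma> = cone2 a c" using flat_cone_dim2 [OF surface_fan_flat [OF F s(2)] s(3)] by metis
      have ed: "indep2 u (u + e *\<^sub>R d)" using indep2_germ [OF s(1), of e] e(1) by simp
      have "u \<in> span {a, c}" "u + e *\<^sub>R d \<in> span {a, c}"
        using span_base [of u \<sigma>] span_base [of "u + e *\<^sub>R d" \<sigma>] e span_cone2 [of a c] unfolding ac by simp_all
      then have "span {u, u + e *\<^sub>R d} = span {a, c}" by (rule span_indep2_eq [OF ed])
      moreover have "span {u, u + e *\<^sub>R d} = span {u, d}"
        by (intro span_indep2_eq [OF ed]) (auto intro!: span_add span_scale intro: span_base)
      ultimately have "span {u, d} = span \<sigma>" unfolding ac span_cone2 by simp
      then show False using n s b by metis
    qed
    \<comment> \<open>For each key some germ with that key is evaluated; by \<open>same\<close> it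
      does not matter which. As \<open>val\<close> holds for all pairs of vectors, keys that belong
      to no germ also receive an admissible value.\<close>
    define \<phi> where "\<phi> = restrict (\<lambda>k. let p = (SOME p. indep2 (fst p) (snd p) \<and> key (fst p) (snd p) = k)
      in g (fst p) (snd p)) ?X"
    have "\<phi> \<in> PiE ?X (\<lambda>_. ?V)" unfolding \<phi>_def Let_def using val by (intro PiE_I) auto
    moreover have "g = \<Phi> \<phi>"
    proof (intro ext)
      fix u d
      show "g u d = \<Phi> \<phi> u d"
      proof (cases "indep2 u d \<and> span {u, d} \<in> \<P>")
        case True
        define p where "p = (SOME p. indep2 (fst p) (snd p) \<and> key (fst p) (snd p) = key u d)"
        have "indep2 (fst (u, d)) (snd (u, d)) \<and> key (fst (u, d)) (snd (u, d)) = key u d" using True by simp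
        then have p: "indep2 (fst p) (snd p) \<and> key (fst p) (snd p) = key u d" unfolding p_def by (rule someI)
        have "key u d \<in> ?X" unfolding key_def using True by (auto simp: lex_sign_def sgn_if)
        then have "\<phi> (key u d) = g (fst p) (snd p)" unfolding \<phi>_def Let_def p_def by simp
        also have "\<dots> = g u d" using same [of u d "fst p" "snd p"] p True by simp
        finally show ?thesis unfolding \<Phi>_def using True by simp
      next
        case False then show ?thesis unfolding \<Phi>_def using zero [OF False] by (simp only: if_False)
      qed
    qed
    ultimately show "g \<in> \<Phi> ` PiE ?X (\<lambda>_. ?V)" by blast
  qed
  ultimately show ?thesis by (rule finite_surj)
qed

theorem corollary4p14:
  fixes M\<^sub>1 M\<^sub>2 :: "real ^ 'n \<Rightarrow> real"
  assumes "nonneg_TR_function M\<^sub>1"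
    and "nonneg_TR_function M\<^sub>2"
    and "aff_dim {p + q | p q. p \<in> Newt M\<^sub>1 \<and> q \<in> Newt M\<^sub>2} = int CARD('n)"
  shows "finite {C :: 'n cycle. C \<in> cycles 2 \<and> strongly_regular M\<^sub>1 M\<^sub>2 C}"
proof -
  \<comment> \<open>The presentation chosen inside \<open>Newt\<close> is not known to contain 0,
    whereas non-negativity provides one that does; both are kept, the first for the polytope and the
    second for the outer factor of intersection numbers.\<close>
  have pres: "\<exists>L'. TR_presentation (SOME L. TR_presentation L M) M \<and> TR_presentation L' M \<and> 0 \<in> L'"
    if M: "nonneg_TR_function M" for M :: "real ^ 'n \<Rightarrow> real"
  proof -
    obtain L' where L': "TR_presentation L' M" "0 \<in> L'" using M unfolding nonneg_TR_function_def by blast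
    then have "TR_presentation (SOME L. TR_presentation L M) M" by (intro someI)
    then show ?thesis using L' by blast
  qed
  define L\<^sub>1 where "L\<^sub>1 = (SOME L. TR_presentation L M\<^sub>1)"
  define L\<^sub>2 where "L\<^sub>2 = (SOME L. TR_presentation L M\<^sub>2)"
  obtain L\<^sub>1' where "TR_presentation L\<^sub>1 M\<^sub>1" "TR_presentation L\<^sub>1' M\<^sub>1" "0 \<in> L\<^sub>1'"
    using pres [OF assms(1)] unfolding L\<^sub>1_def by blast
  then have L1: "finite L\<^sub>1" "L\<^sub>1 \<noteq> {}" "L\<^sub>1 \<subseteq> int_points" "M\<^sub>1 = max_of_forms L\<^sub>1"
    and L1': "finite L\<^sub>1'" "L\<^sub>1' \<subseteq> int_points" "0 \<in> L\<^sub>1'" "M\<^sub>1 = max_of_forms L\<^sub>1'" unfolding TR_presentation_def by auto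
  obtain L\<^sub>2' where "TR_presentation L\<^sub>2 M\<^sub>2" "TR_presentation L\<^sub>2' M\<^sub>2" "0 \<in> L\<^sub>2'"
    using pres [OF assms(2)] unfolding L\<^sub>2_def by blast
  then have L2: "finite L\<^sub>2" "L\<^sub>2 \<noteq> {}" "L\<^sub>2 \<subseteq> int_points" "M\<^sub>2 = max_of_forms L\<^sub>2"
    and L2': "finite L\<^sub>2'" "L\<^sub>2' \<subseteq> int_points" "0 \<in> L\<^sub>2'" "M\<^sub>2 = max_of_forms L\<^sub>2'" unfolding TR_presentation_def by auto
  have "aff_dim {p + q | p q. p \<in> convex hull L\<^sub>1 \<and> q \<in> convex hull L\<^sub>2} = int CARD('n)"
    using assms(3) unfolding Newt_def L\<^sub>1_def L\<^sub>2_def .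
  from full_dimensional_support_bound [OF L1(1) L2(1) this] obtain m c where
    c: "0 < c" "\<And>x. m \<bullet> x + c * norm x \<le> max_of_forms L\<^sub>1 x + max_of_forms L\<^sub>2 x" by blast
  \<comment> \<open>Arbitrary sets of bounded lattice points occur here, so the planes among their
    spans are singled out by dimension.\<close>
  define \<P> where "\<P> = {P \<in> span ` Pow {x\<in>int_points :: (real ^ 'n) set. norm x \<le> 8 / c\<^sup>2}. dim P = 2}"
  have "finite (span ` Pow {x\<in>int_points :: (real ^ 'n) set. norm x \<le> 8 / c\<^sup>2})"
    by (intro finite_imageI) (simp add: finite_bounded_int_points)
  then have finP: "finite \<P>" by (rule finite_subset [rotated]) (auto simp: \<P>_def)
  have subP: "subspace P \<and> dim P = 2" if "P \<in> \<P>" for P using that unfolding \<P>_def by auto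
  let ?G = "{germ_weight W | W :: 'n weighted_fan. tropical_fan 2 W \<and>
     (\<forall>\<sigma>\<in>fst W. dim \<sigma> = 2 \<longrightarrow> span \<sigma> \<in> \<P> \<and> snd W \<sigma> \<le> 8 / c\<^sup>2)}"
  \<comment> \<open>A cycle is recovered from the germ weight of any of its fans, so it suffices to
    bound the number of germ weights.\<close>
  have "{C :: 'n cycle. C \<in> cycles 2 \<and> strongly_regular M\<^sub>1 M\<^sub>2 C} \<subseteq>
     (\<lambda>g. {W'. tropical_fan 2 W' \<and> germ_weight W' = g}) ` ?G"
  proof
    fix C :: "'n cycle" assume "C \<in> {C. C \<in> cycles 2 \<and> strongly_regular M\<^sub>1 M\<^sub>2 C}"
    then have C: "C \<in> cycles 2" "strongly_regular M\<^sub>1 M\<^sub>2 C" by auto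
    obtain W where W: "tropical_fan 2 W" "C = {W'. tropical_fan 2 W' \<and> germ_weight W' = germ_weight W}"
      by (rule cyclesE [OF C(1)])
    have B: "germ_pairing (germ_weight W) (max_of_forms L\<^sub>1) (max_of_forms L\<^sub>2) \<le> 1"
      "germ_pairing (germ_weight W) (max_of_forms L\<^sub>1) (max_of_forms L\<^sub>1) \<le> 1"
      "germ_pairing (germ_weight W) (max_of_forms L\<^sub>2) (max_of_forms L\<^sub>2) \<le> 1"
      using C(2) unfolding strongly_regular_def intersection_number_eq [OF W L2 L1']
        intersection_number_eq [OF W L1 L1'] intersection_number_eq [OF W L2 L2'] L1(4) [symmetric] L2(4) [symmetric]
      by linarith+
    have "span \<sigma> \<in> \<P> \<and> snd W \<sigma> \<le> 8 / c\<^sup>2" if "\<sigma> \<in> fst W" "dim \<sigma> = 2" for \<sigma>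
      using plane_and_weight_bound [OF W(1) L1(1-3) L2(1-3) c B that] that(2) unfolding \<P>_def by simp
    then have "germ_weight W \<in> ?G" using W(1) by blast
    then show "C \<in> (\<lambda>g. {W'. tropical_fan 2 W' \<and> germ_weight W' = g}) ` ?G" unfolding W(2) by (rule imageI)
  qed
  then show ?thesis using finite_germ_weights [OF finP subP] by (rule finite_surj [rotated])
qed

end
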